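(* Let $H$ be an infinite-dimensional, separable, complex (respectively, real) Hilbert space, and let $G$ be the unitary group of $H$ (respectively, the orthogonal group of $H$), equipped with the strong operator topology. Then $G$ has the automatic continuity property: every group homomorphism from $G$ to a separable topological group is continuous.
   Context: A topological group is separable if it has a countable dense subset. The unitary (orthogonal) group of a complex (real) Hilbert space $H$ is the group of all surjective linear isometries of $H$. The strong operator topology is the topology of pointwise convergence on $H$ in norm. *)

theory Defs
  imports "HOL-Analysis.Analysis" "HOL-Algebra.Group"
begin

text \<open>
  A complex inner product space. Its norm, metric and topology are those of the underlying real
  inner product space, whose inner product is the real part of the complex one; positive
  definiteness of \<open>cinner\<close> therefore comes from the class \<open>real_inner\<close>
  (see \<open>cinner_self\<close>). The inner product is linear in its first argument. A complex
  Hilbert space is a type of sort \<open>{complex_inner, complete_space}\<close>, a real Hilbert space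
  one of sort \<open>{real_inner, complete_space}\<close>.
\<close>

class complex_inner = real_inner +
  fixes scaleC :: "complex \<Rightarrow> 'a \<Rightarrow> 'a" (infixr \<open>*\<^sub>C\<close> 75)
    and cinner :: "'a \<Rightarrow> 'a \<Rightarrow> complex"
  assumes scaleC_add_right: "c *\<^sub>C (x + y) = c *\<^sub>C x + c *\<^sub>C y"
    and scaleC_add_left: "(c + d) *\<^sub>C x = c *\<^sub>C x + d *\<^sub>C x"
    and scaleC_scaleC: "c *\<^sub>C d *\<^sub>C x = (c * d) *\<^sub>C x"
    and scaleR_scaleC: "r *\<^sub>R x = complex_of_real r *\<^sub>C x"
    and cinner_commute: "cinner x y = cnj (cinner y x)"
    and cinner_add_left: "cinner (x + y) z = cinner x z + cinner y z"
    and cinner_scaleC_left: "cinner (c *\<^sub>C x) y = c * cinner x y"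
    and inner_eq_Re_cinner: "inner x y = Re (cinner x y)"

lemma vector_space_scaleC: "vector_space (scaleC :: complex \<Rightarrow> 'a::complex_inner \<Rightarrow> 'a)"
proof
  fix x :: 'a
  show "1 *\<^sub>C x = x"
    using scaleR_scaleC[of 1 x] by simp
qed (simp_all add: scaleC_add_right scaleC_add_left scaleC_scaleC)

lemma vector_space_scaleR: "vector_space (scaleR :: real \<Rightarrow> 'a::real_vector \<Rightarrow> 'a)"
  by unfold_locales

lemma cinner_self:
  fixes x :: "'a::complex_inner"
  shows "cinner x x = complex_of_real ((norm x)\<^sup>2)"
proof -
  have "Im (cinner x x) = 0"
    using arg_cong[OF cinner_commute[of x x], of Im] by simp
  then show ?thesis
    by (simp add: complex_eq_iff power2_norm_eq_inner inner_eq_Re_cinner)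
qed

definition infinite_dimensional :: "('f::field \<Rightarrow> 'a::ab_group_add \<Rightarrow> 'a) \<Rightarrow> bool" where
  "infinite_dimensional sc \<longleftrightarrow> (\<nexists>B. finite B \<and> module.span sc B = UNIV)"

text \<open>
  The group of all surjective linear isometries, where linearity refers to the scalar
  multiplication \<open>sc\<close>. Its elements are bundled as real bounded linear maps so
  that the library's \<open>strong_operator_topology\<close> applies; this is no restriction for
  isometries that are linear over the complex numbers.
\<close>

definition isometry_group ::
    "('f::field \<Rightarrow> 'a::real_normed_vector \<Rightarrow> 'a) \<Rightarrow> ('a \<Rightarrow>\<^sub>L 'a) monoid" where
  "isometry_group sc =
    \<lparr>carrier = {U. Vector_Spaces.linear sc sc (blinfun_apply U) \<and>
                   surj (blinfun_apply U) \<and> (\<forall>x. norm (blinfun_apply U x) = norm x)},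
     mult = (o\<^sub>L), one = id_blinfun\<rparr>"

definition unitary_group :: "('a::complex_inner \<Rightarrow>\<^sub>L 'a) monoid" where
  "unitary_group = isometry_group scaleC"

definition orthogonal_group :: "('a::real_inner \<Rightarrow>\<^sub>L 'a) monoid" where
  "orthogonal_group = isometry_group scaleR"

definition SOT :: "('a::real_normed_vector \<Rightarrow>\<^sub>L 'a) monoid \<Rightarrow> ('a \<Rightarrow>\<^sub>L 'a) topology" where
  "SOT G = subtopology strong_operator_topology (carrier G)"

text \<open>Topological groups are not required to be Hausdorff.\<close>

definition topological_group :: "('k, 'm) monoid_scheme \<Rightarrow> 'k topology \<Rightarrow> bool" where
  "topological_group K T \<longleftrightarrow>
     group K \<and> topspace T = carrier K \<and>
     continuous_map (prod_topology T T) T (\<lambda>(x, y). x \<otimes>\<^bsub>K\<^esub> y) \<and>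
     continuous_map T T (\<lambda>x. inv\<^bsub>K\<^esub> x)"

text \<open>
  The type argument is the type over which the target groups range; a statement about all
  separable topological groups leaves it a type variable.
\<close>

definition automatic_continuity ::
    "('g, 'm) monoid_scheme \<Rightarrow> 'g topology \<Rightarrow> 'k itself \<Rightarrow> bool" where
  "automatic_continuity G T (_ :: 'k itself) \<longleftrightarrow>
     (\<forall>(K :: 'k monoid) S. topological_group K S \<and> separable_space S \<longrightarrow>
        (\<forall>f \<in> hom G K. continuous_map T S f))"


lemma carrier_isometry_group:
  "U \<in> carrier (isometry_group sc) \<longleftrightarrow>
     Vector_Spaces.linear sc sc (blinfun_apply U) \<and>
     surj (blinfun_apply U) \<and> (\<forall>x. norm (blinfun_apply U x) = norm x)"
  by (simp add: isometry_group_def)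

lemma isometry_group_inverse:
  fixes sc :: "'f::field \<Rightarrow> 'a::real_normed_vector \<Rightarrow> 'a"
  assumes U: "U \<in> carrier (isometry_group sc)"
  shows "\<exists>V \<in> carrier (isometry_group sc). V o\<^sub>L U = id_blinfun"
proof -
  have lin: "Vector_Spaces.linear sc sc (blinfun_apply U)"
    and srj: "surj (blinfun_apply U)" and iso: "\<And>x. norm (blinfun_apply U x) = norm x"
    using U by (auto simp: carrier_isometry_group)
  have inj: "inj (blinfun_apply U)"
  proof (rule injI)
    fix x y assume "blinfun_apply U x = blinfun_apply U y"
    then have "norm (x - y) = 0"
      using iso[of "x - y"] by (simp add: blinfun.diff_right)
    then show "x = y" by simp
  qed
  define g where "g = inv_into UNIV (blinfun_apply U)"
  have Ug: "blinfun_apply U (g x) = x" for x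
    unfolding g_def by (rule surj_f_inv_f[OF srj])
  have gU: "g (blinfun_apply U x) = x" for x
    unfolding g_def by (rule inv_f_f[OF inj])
  have cancel: "a = b" if "blinfun_apply U a = blinfun_apply U b" for a b
    using injD[OF inj that] .
  have ng: "norm (g x) = norm x" for x
    using iso[of "g x"] by (simp add: Ug)
  have "bounded_linear g"
  proof (rule bounded_linear_intro[where K = 1])
    show "g (x + y) = g x + g y" for x y
      by (rule cancel) (simp add: Ug blinfun.add_right)
    show "g (r *\<^sub>R x) = r *\<^sub>R g x" for r x
      by (rule cancel) (simp add: Ug blinfun.scaleR_right)
  qed (simp add: ng)
  then have ap: "blinfun_apply (Blinfun g) = g"
    by (rule bounded_linear_Blinfun_apply)
  interpret Vector_Spaces.linear sc sc "blinfun_apply U" by (rule lin)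
  have "Vector_Spaces.linear sc sc g"
  proof unfold_locales
    show "g (x + y) = g x + g y" for x y
      by (rule cancel) (simp add: Ug blinfun.add_right)
    show "g (sc c x) = sc c (g x)" for c x
      by (rule cancel) (simp add: Ug scale)
  qed
  moreover have "surj g"
    using gU by (metis surjI)
  ultimately have "Blinfun g \<in> carrier (isometry_group sc)"
    by (simp add: carrier_isometry_group ap ng)
  moreover have "Blinfun g o\<^sub>L U = id_blinfun"
    by (rule blinfun_eqI) (simp add: ap gU)
  ultimately show ?thesis by blast
qed

lemma group_isometry_group:
  fixes sc :: "'f::field \<Rightarrow> 'a::real_normed_vector \<Rightarrow> 'a"
  assumes "vector_space sc"
  shows "group (isometry_group sc)"
proof (rule groupI)
  fix U V
  assume U: "U \<in> carrier (isometry_group sc)" and V: "V \<in> carrier (isometry_group sc)"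
  have eq: "blinfun_apply (U o\<^sub>L V) = blinfun_apply U \<circ> blinfun_apply V"
    by (simp add: fun_eq_iff)
  show "U \<otimes>\<^bsub>isometry_group sc\<^esub> V \<in> carrier (isometry_group sc)"
    using U V Vector_Spaces.linear_compose[of sc sc "blinfun_apply V" sc "blinfun_apply U"]
      comp_surj[of "blinfun_apply V" "blinfun_apply U"]
    by (simp add: isometry_group_def eq)
next
  have "blinfun_apply (id_blinfun :: 'a \<Rightarrow>\<^sub>L 'a) = id"
    by (simp add: fun_eq_iff)
  then show "\<one>\<^bsub>isometry_group sc\<^esub> \<in> carrier (isometry_group sc)"
    by (simp add: isometry_group_def vector_space.linear_id[OF assms])
next
  fix U assume "U \<in> carrier (isometry_group sc)"
  then show "\<exists>V \<in> carrier (isometry_group sc).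
      V \<otimes>\<^bsub>isometry_group sc\<^esub> U = \<one>\<^bsub>isometry_group sc\<^esub>"
    using isometry_group_inverse[of U sc] by (simp add: isometry_group_def)
qed (auto simp: isometry_group_def intro!: blinfun_eqI)

lemma topspace_SOT: "topspace (SOT G) = carrier G"
  by (simp add: SOT_def strong_operator_topology_topspace)

lemma continuous_map_SOT_eval: "continuous_map (SOT G) euclidean (\<lambda>U. blinfun_apply U x)"
  unfolding SOT_def
  by (rule continuous_map_from_subtopology[OF strong_operator_topology_continuous_evaluation])

lemma continuous_map_into_SOT:
  assumes "f \<in> topspace T \<rightarrow> carrier G"
    and "\<And>x p. p \<in> topspace T \<Longrightarrow>
      ((\<lambda>q. blinfun_apply (f q) x) \<longlongrightarrow> blinfun_apply (f p) x) (atin T p)"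
  shows "continuous_map T (SOT G) f"
proof -
  have "continuous_map T strong_operator_topology f"
    unfolding continuous_on_strong_operator_topo_iff_coordinatewise
    using assms(2) by (simp add: continuous_map_atin)
  then show ?thesis
    using assms(1) by (simp add: SOT_def continuous_map_in_subtopology image_subset_iff_funcset)
qed

lemma topological_group_isometry_group:
  fixes sc :: "'f::field \<Rightarrow> 'a::real_normed_vector \<Rightarrow> 'a"
  assumes "vector_space sc"
  shows "topological_group (isometry_group sc) (SOT (isometry_group sc))"
proof -
  define G where "G = isometry_group sc"
  interpret group G
    unfolding G_def by (rule group_isometry_group[OF assms])
  have mult: "U \<otimes>\<^bsub>G\<^esub> V = U o\<^sub>L V" for U V
    by (simp add: G_def isometry_group_def)
  have one: "\<one>\<^bsub>G\<^esub> = id_blinfun"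
    by (simp add: G_def isometry_group_def)
  have iso: "norm (blinfun_apply U x) = norm x" if "U \<in> carrier G" for U x
    using that by (simp add: G_def carrier_isometry_group)
  have ev: "((\<lambda>U. blinfun_apply U x) \<longlongrightarrow> blinfun_apply U0 x) (atin (SOT G) U0)"
    if "U0 \<in> carrier G" for U0 x
    using continuous_map_SOT_eval[of G x] that by (auto simp: continuous_map_atin topspace_SOT)
  have "continuous_map (prod_topology (SOT G) (SOT G)) (SOT G) (\<lambda>(U, V). U \<otimes>\<^bsub>G\<^esub> V)"
  proof (rule continuous_map_into_SOT)
    fix x p assume "p \<in> topspace (prod_topology (SOT G) (SOT G))"
    then obtain U0 V0 where p: "p = (U0, V0)" and UV0: "U0 \<in> carrier G" "V0 \<in> carrier G"
      by (auto simp: topspace_SOT)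
    let ?F = "atin (prod_topology (SOT G) (SOT G)) p"
    have c1: "continuous_map (prod_topology (SOT G) (SOT G)) euclidean
        (\<lambda>q. blinfun_apply (fst q) y)" for y
      using continuous_map_compose[OF continuous_map_fst continuous_map_SOT_eval[of G y]]
      by (simp add: o_def)
    have c2: "continuous_map (prod_topology (SOT G) (SOT G)) euclidean
        (\<lambda>q. blinfun_apply (snd q) y)" for y
      using continuous_map_compose[OF continuous_map_snd continuous_map_SOT_eval[of G y]]
      by (simp add: o_def)
    have pt: "p \<in> topspace (prod_topology (SOT G) (SOT G))"
      using p UV0 by (simp add: topspace_SOT)
    have t1: "((\<lambda>q. blinfun_apply (fst q) y) \<longlongrightarrow> blinfun_apply U0 y) ?F" for y
      using c1[of y] pt p by (auto simp: continuous_map_atin)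
    have t2: "((\<lambda>q. blinfun_apply (snd q) y) \<longlongrightarrow> blinfun_apply V0 y) ?F" for y
      using c2[of y] pt p by (auto simp: continuous_map_atin)
    have "((\<lambda>q. norm (blinfun_apply (snd q) x - blinfun_apply V0 x) +
        norm (blinfun_apply (fst q) (blinfun_apply V0 x) - blinfun_apply U0 (blinfun_apply V0 x)))
        \<longlongrightarrow> 0 + 0) ?F"
      by (intro tendsto_add tendsto_norm_zero LIM_zero t1 t2)
    then have lim: "((\<lambda>q. norm (blinfun_apply (snd q) x - blinfun_apply V0 x) +
        norm (blinfun_apply (fst q) (blinfun_apply V0 x) - blinfun_apply U0 (blinfun_apply V0 x)))
        \<longlongrightarrow> 0) ?F" by simp
    have "\<forall>\<^sub>F q in ?F. q \<in> topspace (prod_topology (SOT G) (SOT G))"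
      unfolding eventually_atin
      by (intro disjI2 exI[of _ "topspace (prod_topology (SOT G) (SOT G))"]) (use pt openin_topspace DiffD1 in metis)
    then have bd: "\<forall>\<^sub>F q in ?F. norm (blinfun_apply (fst q) (blinfun_apply (snd q) x)
          - blinfun_apply U0 (blinfun_apply V0 x))
        \<le> norm (blinfun_apply (snd q) x - blinfun_apply V0 x) +
        norm (blinfun_apply (fst q) (blinfun_apply V0 x) - blinfun_apply U0 (blinfun_apply V0 x))"
    proof (rule eventually_mono)
      fix q assume "q \<in> topspace (prod_topology (SOT G) (SOT G))"
      then have q: "fst q \<in> carrier G" by (auto simp: topspace_SOT)
      have "blinfun_apply (fst q) (blinfun_apply (snd q) x) - blinfun_apply U0 (blinfun_apply V0 x)
          = blinfun_apply (fst q) (blinfun_apply (snd q) x - blinfun_apply V0 x) +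
          (blinfun_apply (fst q) (blinfun_apply V0 x) - blinfun_apply U0 (blinfun_apply V0 x))"
        by (simp add: blinfun.diff_right)
      then show "norm (blinfun_apply (fst q) (blinfun_apply (snd q) x)
          - blinfun_apply U0 (blinfun_apply V0 x))
        \<le> norm (blinfun_apply (snd q) x - blinfun_apply V0 x) +
        norm (blinfun_apply (fst q) (blinfun_apply V0 x) - blinfun_apply U0 (blinfun_apply V0 x))"
        using iso[OF q, of "blinfun_apply (snd q) x - blinfun_apply V0 x"]
          norm_triangle_ineq[of "blinfun_apply (fst q) (blinfun_apply (snd q) x - blinfun_apply V0 x)"
            "blinfun_apply (fst q) (blinfun_apply V0 x) - blinfun_apply U0 (blinfun_apply V0 x)"]
        by metis
    qed
    have "((\<lambda>q. blinfun_apply (fst q) (blinfun_apply (snd q) x)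
          - blinfun_apply U0 (blinfun_apply V0 x)) \<longlongrightarrow> 0) ?F"
      by (rule Lim_null_comparison[OF bd lim])
    then show "((\<lambda>q. blinfun_apply (case q of (U, V) \<Rightarrow> U \<otimes>\<^bsub>G\<^esub> V) x) \<longlongrightarrow>
        blinfun_apply (case p of (U, V) \<Rightarrow> U \<otimes>\<^bsub>G\<^esub> V) x) ?F"
      by (simp add: p mult case_prod_beta LIM_zero_iff)
  qed (auto simp: topspace_SOT)
  moreover have "continuous_map (SOT G) (SOT G) (\<lambda>U. inv\<^bsub>G\<^esub> U)"
  proof (rule continuous_map_into_SOT)
    fix x U0 assume "U0 \<in> topspace (SOT G)"
    then have U0: "U0 \<in> carrier G" by (simp add: topspace_SOT)
    define y where "y = blinfun_apply (inv\<^bsub>G\<^esub> U0) x"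
    have inv_app: "blinfun_apply U (blinfun_apply (inv\<^bsub>G\<^esub> U) z) = z"
      "blinfun_apply (inv\<^bsub>G\<^esub> U) (blinfun_apply U z) = z" if "U \<in> carrier G" for U z
      using arg_cong[OF r_inv[OF that], of "\<lambda>W. blinfun_apply W z"]
        arg_cong[OF l_inv[OF that], of "\<lambda>W. blinfun_apply W z"]
      by (simp_all add: mult one)
    have "((\<lambda>U. norm (blinfun_apply U y - blinfun_apply U0 y)) \<longlongrightarrow> 0) (atin (SOT G) U0)"
      by (intro tendsto_norm_zero LIM_zero ev U0)
    moreover have "\<forall>\<^sub>F U in atin (SOT G) U0. U \<in> topspace (SOT G)"
      unfolding eventually_atin
      by (intro disjI2 exI[of _ "topspace (SOT G)"]) (use U0 topspace_SOT in auto)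
    then have "\<forall>\<^sub>F U in atin (SOT G) U0.
        norm (blinfun_apply (inv\<^bsub>G\<^esub> U) x - y) \<le> norm (blinfun_apply U y - blinfun_apply U0 y)"
    proof (rule eventually_mono)
      fix U assume "U \<in> topspace (SOT G)"
      then have U: "U \<in> carrier G" by (simp add: topspace_SOT)
      have "norm (blinfun_apply (inv\<^bsub>G\<^esub> U) x - y)
          = norm (blinfun_apply U (blinfun_apply (inv\<^bsub>G\<^esub> U) x - y))"
        by (simp add: iso[OF U])
      also have "\<dots> = norm (x - blinfun_apply U y)"
        by (simp add: blinfun.diff_right inv_app[OF U])
      also have "\<dots> = norm (blinfun_apply U y - blinfun_apply U0 y)"
        by (simp add: y_def inv_app[OF U0] norm_minus_commute)
      finally show "norm (blinfun_apply (inv\<^bsub>G\<^esub> U) x - y)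
          \<le> norm (blinfun_apply U y - blinfun_apply U0 y)" by simp
    qed
    ultimately have "((\<lambda>U. blinfun_apply (inv\<^bsub>G\<^esub> U) x - y) \<longlongrightarrow> 0) (atin (SOT G) U0)"
      by (rule Lim_null_comparison[rotated])
    then show "((\<lambda>U. blinfun_apply (inv\<^bsub>G\<^esub> U) x) \<longlongrightarrow> blinfun_apply (inv\<^bsub>G\<^esub> U0) x)
        (atin (SOT G) U0)"
      by (simp add: y_def LIM_zero_iff)
  qed (auto simp: topspace_SOT)
  ultimately show ?thesis
    using is_group by (simp add: topological_group_def topspace_SOT flip: G_def)
qed

lemma topological_group_unitary_group: "topological_group unitary_group (SOT unitary_group)"
  unfolding unitary_group_def
  by (rule topological_group_isometry_group[OF vector_space_scaleC])

lemma topological_group_orthogonal_group: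
  "topological_group orthogonal_group (SOT orthogonal_group)"
  unfolding orthogonal_group_def
  by (rule topological_group_isometry_group[OF vector_space_scaleR])

end

(* The theorem is derived from the following Steinhaus property: if W is symmetric and countably many
left translates of W cover the group, then a fixed power of W is a neighbourhood of the identity.
For a set A of indices of an orthonormal basis (e n), let U(A) be the group of the isometries that fix
e n for all n outside A.

(1) A diagonal argument over a partition into infinite blocks, applied twice, shows that on some
infinite block every isometry extends to an element of W^2, and also to an element of W^4 acting only on
a larger block; the commutator of two such extensions only sees the small block. As every element
of U(B) is a commutator in U(A) when B and A - B are infinite, W^12 contains some U(B).
(2) By pigeonhole on an uncountable almost disjoint family there are two conjugates of U(B), by elements
differing by a factor in W^2, whose index sets have a cofinite union; U(A) and U(B) generate U(A \<union> B) in four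
factors if A \<inter> B, A - B and B - A are infinite. So, up to conjugation, a power of W contains the
group V of all isometries fixing e i for i < N.
(3) By pigeonhole on the angles, W^2 contains a rotation w with non-zero angle in each of the N planes
spanned by e i and e (N + i). The set V w V w^-1 V contains all g whose compression
to the span of the e i with i < N is close to cos^2 times the identity. It therefore has interior, and its
square contains a neighbourhood of the identity. *)

theory Submission
  imports Defs
begin

section \<open>Hilbert spaces over the real or complex numbers\<close>

text \<open>The exponent must not depend on W: for a given neighbourhood of the identity in the
  target one first picks a smaller one whose 344-th power stays inside, and only then is W, a
  preimage of quotients, determined. No topological property of W is available, so every step plays
  against the countable cover alone: either one element is built that escapes all translates, or
  uncountably many elements are distributed over them.

  The subgroup V of (2) is not a neighbourhood of the identity when N > 0: the strong operator
  topology controls finitely many vectors up to an error, whereas V fixes them exactly. Step (3) is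
  there to bridge this gap. Conjugating W costs nothing, since it preserves the covering property
  and is compatible with powers; the neighbourhood found at the end is conjugated back.

  The exponents: 12 = 2 + 4 + 2 + 4 for the commutator, 16 = 2 + 12 + 2 for changing the conjugating
  element, 56 = 16 + 12 + 16 + 12 for the four factors, 172 = 56 + 2 + 56 + 2 + 56 for the double
  coset, 344 = 172 + 172.\<close>

text \<open>Treats both cases at once: \<open>cj\<close> is complex conjugation, respectively the identity of the reals.\<close>

locale hilbert =
  fixes sc :: "'f::real_normed_field \<Rightarrow> 'a::{real_normed_vector,complete_space} \<Rightarrow> 'a"
    and ip :: "'a \<Rightarrow> 'a \<Rightarrow> 'f"
    and cj :: "'f \<Rightarrow> 'f"
  assumes vector_space_sc: "vector_space sc"
    and sc_of_real: "sc (of_real r) x = r *\<^sub>R x"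
    and ip_add_left: "ip (x + y) z = ip x z + ip y z"
    and ip_sc_left: "ip (sc c x) y = c * ip x y"
    and ip_commute: "ip x y = cj (ip y x)"
    and ip_self: "ip x x = of_real ((norm x)\<^sup>2)"
    and cj_add: "cj (a + b) = cj a + cj b"
    and cj_mult: "cj (a * b) = cj a * cj b"
    and cj_of_real: "cj (of_real r) = of_real r"
    and mult_cj: "c * cj c = of_real ((norm c)\<^sup>2)"
    and norm_cj: "norm (cj c) = norm c"
    and separable: "separable_space (euclidean :: 'a topology)"
    and infinite_dim: "infinite_dimensional sc"
begin

sublocale vector_space sc
  by (rule vector_space_sc)

abbreviation G :: "('a \<Rightarrow>\<^sub>L 'a) monoid" where
  "G \<equiv> isometry_group sc"

sublocale G: group G
  by (rule group_isometry_group[OF vector_space_sc])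

section \<open>Calculus of the conjugation and the inner product\<close>

text \<open>\<open>mult_cj\<close> has the same right-hand side at \<open>c\<close> and at
  \<open>cj c\<close>, as \<open>cj\<close> preserves norms; cancelling \<open>cj c\<close> leaves
  the claim.\<close>

lemma cj_cj [simp]: "cj (cj c) = c"
proof (cases "c = 0")
  case True
  then show ?thesis using cj_of_real[of 0] by simp
next
  case False
  then have "cj c \<noteq> 0" using norm_cj[of c] by auto
  moreover have "cj c * cj (cj c) = cj c * c"
    using mult_cj[of "cj c"] mult_cj[of c] by (simp add: norm_cj mult.commute)
  ultimately show ?thesis by simp
qed

lemma cj_simps [simp]: "cj 0 = 0" "cj 1 = 1"
  using cj_of_real[of 0] cj_of_real[of 1] by simp_all

lemma cj_minus [simp]: "cj (- a) = - cj a"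
proof -
  have "cj (- a) + cj a = 0" by (metis cj_add cj_simps(1) add.left_inverse)
  then show ?thesis by (simp add: eq_neg_iff_add_eq_0)
qed

lemma cj_diff [simp]: "cj (a - b) = cj a - cj b"
  using cj_add[of a "- b"] by simp

lemma cj_divide [simp]: "cj (a / b) = cj a / cj b"
proof (cases "b = 0")
  case False
  then have "cj b \<noteq> 0" using norm_cj[of b] by auto
  moreover have "cj (a / b) * cj b = cj a"
    using False by (simp flip: cj_mult)
  ultimately show ?thesis by (simp add: field_simps)
qed simp

declare cj_add [simp] cj_mult [simp] cj_of_real [simp]

lemma cj_power [simp]: "cj (a ^ n) = cj a ^ n"
  by (induction n) auto

lemma cj_sum: "cj (sum f A) = (\<Sum>x\<in>A. cj (f x))"
  by (induction A rule: infinite_finite_induct) auto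

lemma ip_add_right: "ip x (y + z) = ip x y + ip x z"
  by (metis ip_commute ip_add_left cj_add)

lemma ip_sc_right: "ip x (sc c y) = cj c * ip x y"
  by (metis ip_commute ip_sc_left cj_mult)

lemma ip_scaleR [simp]: "ip (r *\<^sub>R x) y = of_real r * ip x y" "ip x (r *\<^sub>R y) = of_real r * ip x y"
  by (simp_all add: ip_sc_left ip_sc_right flip: sc_of_real)

lemma ip_zero [simp]: "ip 0 x = 0" "ip x 0 = 0"
proof -
  show "ip 0 x = 0" using ip_add_left[of 0 0 x] by simp
  then show "ip x 0 = 0" using ip_commute[of x 0] by simp
qed

lemma ip_minus [simp]: "ip (- x) y = - ip x y" "ip x (- y) = - ip x y"
  using ip_scaleR(1)[of "-1" x y] ip_scaleR(2)[of x "-1" y] by simp_all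

lemma ip_diff_left: "ip (x - y) z = ip x z - ip y z"
  using ip_add_left[of x "- y"] by simp

lemma ip_diff_right: "ip x (y - z) = ip x y - ip x z"
  using ip_add_right[of x y "- z"] by simp

lemma ip_sum_left: "ip (sum f A) y = (\<Sum>x\<in>A. ip (f x) y)"
  by (induction A rule: infinite_finite_induct) (auto simp: ip_add_left)

lemma ip_sum_right: "ip y (sum f A) = (\<Sum>x\<in>A. ip y (f x))"
  by (induction A rule: infinite_finite_induct) (auto simp: ip_add_right)

lemma ip_self_eq_0 [simp]: "ip x x = 0 \<longleftrightarrow> x = 0"
  by (simp add: ip_self)

lemma ip_eq_0_commute: "ip x y = 0 \<longleftrightarrow> ip y x = 0"
  by (metis ip_commute cj_simps(1))

lemma ip_self_eq_1: "ip x x = 1 \<longleftrightarrow> norm x = 1"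
proof -
  have "ip x x = 1 \<longleftrightarrow> (norm x)\<^sup>2 = 1\<^sup>2"
    unfolding ip_self by (metis of_real_1 of_real_eq_iff one_power2)
  then show ?thesis using power2_eq_iff_nonneg[of "norm x" 1] by simp
qed

lemma norm_eq_iff_ip_self: "norm x = norm y \<longleftrightarrow> ip x x = ip y y"
  unfolding ip_self of_real_eq_iff by (simp add: power2_eq_iff_nonneg)

lemma norm_sc: "norm (sc c x) = norm c * norm x"
proof -
  have "ip (sc c x) (sc c x) = (c * cj c) * ip x x"
    by (simp add: ip_sc_left ip_sc_right mult_ac)
  then have "of_real ((norm (sc c x))\<^sup>2) = (of_real ((norm c * norm x)\<^sup>2) :: 'f)"
    by (simp only: ip_self mult_cj power_mult_distrib of_real_mult)
  then have "(norm (sc c x))\<^sup>2 = (norm c * norm x)\<^sup>2" by (simp only: of_real_eq_iff)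
  then show ?thesis by (simp add: power2_eq_iff_nonneg)
qed

lemma Cauchy_Schwarz: "norm (ip x y) \<le> norm x * norm y"
proof (cases "y = 0")
  case False
  define c where "c = ip x y / of_real ((norm y)\<^sup>2)"
  define z where "z = x - sc c y"
  have zy: "ip z y = 0"
    using False by (simp add: z_def ip_diff_left ip_sc_left c_def ip_self)
  have "ip z z = ip z x"
    by (subst (2) z_def) (simp add: ip_diff_right ip_sc_right zy)
  also have "\<dots> = of_real ((norm x)\<^sup>2) - c * cj (ip x y)"
    by (simp add: z_def ip_diff_left ip_sc_left ip_self ip_commute[of y x])
  also have "\<dots> = of_real ((norm x)\<^sup>2 - (norm (ip x y))\<^sup>2 / (norm y)\<^sup>2)"
    using mult_cj[of "ip x y"] by (simp add: c_def)
  finally have "(norm z)\<^sup>2 = (norm x)\<^sup>2 - (norm (ip x y))\<^sup>2 / (norm y)\<^sup>2"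
    by (simp only: ip_self of_real_eq_iff)
  then have "(norm (ip x y))\<^sup>2 / (norm y)\<^sup>2 \<le> (norm x)\<^sup>2"
    by (metis diff_ge_0_iff_ge zero_le_power2)
  then have "(norm (ip x y))\<^sup>2 \<le> (norm x * norm y)\<^sup>2"
    using False by (simp add: field_simps power_mult_distrib)
  then show ?thesis by (rule power2_le_imp_le) simp
qed simp

lemma bounded_linear_ip: "bounded_linear (\<lambda>x. ip x y)"
  by (rule bounded_linear_intro[where K = "norm y"])
    (simp_all add: ip_add_left scaleR_conv_of_real Cauchy_Schwarz)

section \<open>Orthonormal families and series\<close>

definition orthonormal :: "'i set \<Rightarrow> ('i \<Rightarrow> 'a) \<Rightarrow> bool" where
  "orthonormal I f \<longleftrightarrow> (\<forall>i\<in>I. \<forall>j\<in>I. ip (f i) (f j) = (if i = j then 1 else 0))"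

text \<open>Trivial orthogonal complement instead of dense span: this is what maximality of an
  orthonormal set yields and what the Fourier expansion consumes.\<close>

definition total :: "(nat \<Rightarrow> 'a) \<Rightarrow> bool" where
  "total f \<longleftrightarrow> (\<forall>x. (\<forall>n. ip x (f n) = 0) \<longrightarrow> x = 0)"

lemma norm_sum_orthonormal:
  assumes "orthonormal I f" "finite A" "A \<subseteq> I"
  shows "(norm (\<Sum>i\<in>A. sc (a i) (f i)))\<^sup>2 = (\<Sum>i\<in>A. (norm (a i))\<^sup>2)"
proof -
  have "ip (\<Sum>i\<in>A. sc (a i) (f i)) (\<Sum>i\<in>A. sc (a i) (f i))
      = (\<Sum>i\<in>A. \<Sum>j\<in>A. cj (a j) * (a i * ip (f i) (f j)))"
    by (simp add: ip_sum_left ip_sum_right ip_sc_left ip_sc_right sum_distrib_left mult_ac)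
      (rule sum.swap)
  also have "\<dots> = (\<Sum>i\<in>A. \<Sum>j\<in>A. if i = j then cj (a j) * a i else 0)"
    using assms by (intro sum.cong refl) (auto simp: orthonormal_def subset_iff)
  also have "\<dots> = (\<Sum>i\<in>A. a i * cj (a i))"
    using assms(2) by (simp add: mult.commute)
  finally show ?thesis
    by (simp add: ip_self mult_cj del: of_real_power of_real_sum flip: of_real_sum)
qed

text \<open>The series need not converge absolutely; its partial sums are Cauchy by Pythagoras, and
  the space is complete.\<close>

lemma summable_synthesis:
  assumes f: "orthonormal UNIV (f :: nat \<Rightarrow> 'a)" and a: "summable (\<lambda>n. (norm (a n))\<^sup>2)"
  shows "summable (\<lambda>n. sc (a n) (f n))"
proof -
  have "Cauchy (\<lambda>n. \<Sum>i<n. sc (a i) (f i))"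
  proof (rule metric_CauchyI)
    fix \<epsilon> :: real assume "\<epsilon> > 0"
    then obtain N where N: "\<And>m n. m \<ge> N \<Longrightarrow> norm (\<Sum>i=m..<n. (norm (a i))\<^sup>2) < \<epsilon>\<^sup>2"
      using a unfolding summable_Cauchy by (meson zero_less_power)
    have main: "norm (\<Sum>i=m..<n. sc (a i) (f i)) < \<epsilon>" if "m \<ge> N" for m n
    proof -
      have "(norm (\<Sum>i=m..<n. sc (a i) (f i)))\<^sup>2 < \<epsilon>\<^sup>2"
        using N[OF that, of n] norm_sum_orthonormal[OF f, of "{m..<n}" a] by (simp add: sum_nonneg)
      then show ?thesis using \<open>\<epsilon> > 0\<close> by (simp add: power2_less_imp_less)
    qed
    have eq: "(\<Sum>i<n. sc (a i) (f i)) - (\<Sum>i<m. sc (a i) (f i)) = (\<Sum>i=m..<n. sc (a i) (f i))"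
      if "m \<le> n" for m n
      using sum_diff_nat_ivl[of 0 m n "\<lambda>i. sc (a i) (f i)"] that by (simp add: atLeast0LessThan)
    have "dist (\<Sum>i<m. sc (a i) (f i)) (\<Sum>i<n. sc (a i) (f i)) < \<epsilon>" if "m \<ge> N" "n \<ge> N" for m n
      using main[OF that(1), of n] main[OF that(2), of m] eq[of m n] eq[of n m]
      by (cases "m \<le> n") (simp_all add: dist_norm norm_minus_commute[of "\<Sum>i<m. _ i"])
    then show "\<exists>M. \<forall>m\<ge>M. \<forall>n\<ge>M. dist (\<Sum>i<m. sc (a i) (f i)) (\<Sum>i<n. sc (a i) (f i)) < \<epsilon>" by blast
  qed
  then show ?thesis by (simp add: summable_iff_convergent Cauchy_convergent)
qed

lemma ip_synthesis:
  assumes f: "orthonormal UNIV (f :: nat \<Rightarrow> 'a)" and a: "summable (\<lambda>n. (norm (a n))\<^sup>2)"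
  shows "ip (\<Sum>n. sc (a n) (f n)) (f k) = a k"
proof -
  have "ip (\<Sum>n. sc (a n) (f n)) (f k) = (\<Sum>n. ip (sc (a n) (f n)) (f k))"
    by (rule bounded_linear.suminf[OF bounded_linear_ip summable_synthesis[OF f a]])
  also have "(\<lambda>n. ip (sc (a n) (f n)) (f k)) = (\<lambda>n. if n = k then a n else 0)"
    using f by (auto simp: ip_sc_left orthonormal_def)
  also have "(\<Sum>n. if n = k then a n else 0) = a k"
    using sums_If_finite_set[of "{k}" a] by (simp add: sums_iff)
  finally show ?thesis .
qed

lemma norm_synthesis:
  assumes f: "orthonormal UNIV (f :: nat \<Rightarrow> 'a)" and a: "summable (\<lambda>n. (norm (a n))\<^sup>2)"
  shows "(norm (\<Sum>n. sc (a n) (f n)))\<^sup>2 = (\<Sum>n. (norm (a n))\<^sup>2)"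
proof -
  have "(\<lambda>n. \<Sum>i<n. sc (a i) (f i)) \<longlonglongrightarrow> (\<Sum>n. sc (a n) (f n))"
    by (rule summable_LIMSEQ[OF summable_synthesis[OF f a]])
  then have "(\<lambda>n. (norm (\<Sum>i<n. sc (a i) (f i)))\<^sup>2) \<longlonglongrightarrow> (norm (\<Sum>n. sc (a n) (f n)))\<^sup>2"
    by (intro tendsto_intros)
  then have "(\<lambda>n. \<Sum>i<n. (norm (a i))\<^sup>2) \<longlonglongrightarrow> (norm (\<Sum>n. sc (a n) (f n)))\<^sup>2"
    by (simp add: norm_sum_orthonormal[OF f])
  then show ?thesis
    using summable_LIMSEQ[OF a] LIMSEQ_unique by blast
qed

lemma Bessel_finite:
  assumes f: "orthonormal I f" and "finite A" "A \<subseteq> I"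
  shows "(\<Sum>i\<in>A. (norm (ip x (f i)))\<^sup>2) \<le> (norm x)\<^sup>2"
proof -
  define p where "p = (\<Sum>i\<in>A. sc (ip x (f i)) (f i))"
  have np: "(norm p)\<^sup>2 = (\<Sum>i\<in>A. (norm (ip x (f i)))\<^sup>2)"
    unfolding p_def by (rule norm_sum_orthonormal[OF assms])
  have "ip x p = of_real (\<Sum>i\<in>A. (norm (ip x (f i)))\<^sup>2)"
    by (simp add: p_def ip_sum_right ip_sc_right mult.commute mult_cj)
  then have xp: "ip x p = of_real ((norm p)\<^sup>2)" by (simp add: np)
  have "ip (x - p) (x - p) = of_real ((norm x)\<^sup>2 - (norm p)\<^sup>2)"
    using xp ip_commute[of p x] unfolding ip_diff_left ip_diff_right by (simp add: ip_self)
  then have "(norm (x - p))\<^sup>2 = (norm x)\<^sup>2 - (norm p)\<^sup>2"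
    by (simp only: ip_self of_real_eq_iff)
  then show ?thesis using np by (metis diff_ge_0_iff_ge zero_le_power2)
qed

lemma Bessel_summable:
  assumes "orthonormal UNIV (f :: nat \<Rightarrow> 'a)"
  shows "summable (\<lambda>n. (norm (ip x (f n)))\<^sup>2)"
  by (rule summableI_nonneg_bounded[where x = "(norm x)\<^sup>2"])
    (auto intro: Bessel_finite[OF assms])

lemma Fourier:
  assumes f: "orthonormal UNIV (f :: nat \<Rightarrow> 'a)" and t: "total f"
  shows "(\<Sum>n. sc (ip x (f n)) (f n)) = x"
proof -
  have "\<forall>k. ip ((\<Sum>n. sc (ip x (f n)) (f n)) - x) (f k) = 0"
    by (simp add: ip_diff_left ip_synthesis[OF f Bessel_summable[OF f]])
  then have "(\<Sum>n. sc (ip x (f n)) (f n)) - x = 0"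
    using t unfolding total_def by blast
  then show ?thesis by simp
qed

section \<open>Group elements as operators\<close>

lemma G_app:
  assumes "U \<in> carrier G"
  shows "U (x + y) = U x + U y" "U (sc c x) = sc c (U x)" "norm (U x) = norm x"
    "U (x - y) = U x - U y"
proof -
  interpret U: Vector_Spaces.linear sc sc U
    using assms by (simp add: carrier_isometry_group)
  show "U (x + y) = U x + U y" "U (sc c x) = sc c (U x)" "norm (U x) = norm x"
    "U (x - y) = U x - U y"
    using assms by (simp_all add: U.scale U.add U.diff carrier_isometry_group)
qed

lemma G_mult [simp]: "(U \<otimes>\<^bsub>G\<^esub> V) = U o\<^sub>L V" and G_one [simp]: "\<one>\<^bsub>G\<^esub> = id_blinfun"
  by (simp_all add: isometry_group_def)

lemma G_mult_closed [simp, intro]: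
  "U \<in> carrier G \<Longrightarrow> V \<in> carrier G \<Longrightarrow> U o\<^sub>L V \<in> carrier G"
  using G.m_closed by simp

lemma id_in_G [simp, intro]: "id_blinfun \<in> carrier G"
  using G.one_closed by simp

abbreviation ginv :: "('a \<Rightarrow>\<^sub>L 'a) \<Rightarrow> ('a \<Rightarrow>\<^sub>L 'a)" where
  "ginv U \<equiv> inv\<^bsub>G\<^esub> U"

lemma ginv_app [simp]:
  assumes "U \<in> carrier G"
  shows "U (ginv U x) = x" "ginv U (U x) = x"
  using arg_cong[OF G.r_inv[OF assms], of "\<lambda>W. blinfun_apply W x"]
    arg_cong[OF G.l_inv[OF assms], of "\<lambda>W. blinfun_apply W x"] by simp_all

text \<open>Polarization over both scalar fields at once. Preservation of norms only controls the
  sum of an inner product and its conjugate; replacing \<open>x\<close> by \<open>sc c x\<close> for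
  every scalar \<open>c\<close>, and taking \<open>c = cj a\<close> for the defect \<open>a\<close>,
  gives \<open>a * cj a = 0\<close>.\<close>

lemma G_ip:
  assumes U: "U \<in> carrier G"
  shows "ip (U x) (U y) = ip x y"
proof -
  have re: "ip (U x) (U y) + ip (U y) (U x) = ip x y + ip y x" for x y
  proof -
    have "ip (U (x + y)) (U (x + y)) = ip (x + y) (x + y)" 
         "ip (U x) (U x) = ip x x" "ip (U y) (U y) = ip y y"
      using G_app(3)[OF U] by (simp_all add: ip_self)
    then show ?thesis
      by (simp add: G_app(1)[OF U] ip_add_left ip_add_right algebra_simps)
  qed
  define a where "a = ip (U x) (U y) - ip x y"
  have "c * a + cj (c * a) = 0" for c
  proof -
    have "c * ip (U x) (U y) + cj (c * ip (U x) (U y)) = c * ip x y + cj (c * ip x y)"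
      using re[of "sc c x" y]
      by (simp add: G_app(2)[OF U] ip_sc_left ip_sc_right flip: ip_commute)
    then show ?thesis by (simp add: a_def algebra_simps)
  qed
  from this[of "cj a"] have "a * cj a + a * cj a = 0" by (simp add: algebra_simps)
  then have "a * cj a = 0" by (metis mult_2 mult_eq_0_iff zero_neq_numeral)
  then have "a = 0" by (simp add: mult_cj)
  then show ?thesis by (simp add: a_def)
qed

lemma ip_ginv:
  assumes "U \<in> carrier G"
  shows "ip (ginv U x) y = ip x (U y)" "ip x (ginv U y) = ip (U x) y"
  using G_ip[OF assms, of "ginv U x" y] G_ip[OF assms, of x "ginv U y"] assms by simp_all

lemma G_eq_ginv_iff:
  assumes "U \<in> carrier G"
  shows "U x = y \<longleftrightarrow> ginv U y = x"
  using assms ginv_app by auto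

lemma G_exI:
  assumes add: "\<And>x y. g (x + y) = g x + g y" and scale: "\<And>c x. g (sc c x) = sc c (g x)"
    and norm: "\<And>x. norm (g x) = norm x" and surj: "\<And>y. \<exists>x. g x = y"
  shows "\<exists>U \<in> carrier G. blinfun_apply U = g"
proof
  have "bounded_linear g"
    by (rule bounded_linear_intro[where K = 1]) (simp_all add: add norm scale flip: sc_of_real)
  then show ap: "blinfun_apply (Blinfun g) = g" by (rule bounded_linear_Blinfun_apply)
  have "Vector_Spaces.linear sc sc g"
    by unfold_locales (simp_all add: add scale)
  then show "Blinfun g \<in> carrier G"
    using surj by (auto simp: carrier_isometry_group ap norm surj_def) metis
qed

text \<open>Together with \<open>Householder\<close> this is the source of all isometries
  constructed below. Totality of \<open>e\<close> makes the map norm preserving, totality of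
  \<open>f\<close> makes it surjective.\<close>

lemma G_ex_basis_map:
  assumes e: "orthonormal UNIV (e :: nat \<Rightarrow> 'a)" "total e" and f: "orthonormal UNIV f" "total f"
  shows "\<exists>U \<in> carrier G. \<forall>n. U (e n) = f n"
proof -
  define g where "g x = (\<Sum>n. sc (ip x (e n)) (f n))" for x
  have sm: "summable (\<lambda>n. sc (ip x (e n)) (f n))" for x
    by (rule summable_synthesis[OF f(1) Bessel_summable[OF e(1)]])
  have "\<exists>U \<in> carrier G. blinfun_apply U = g"
  proof (rule G_exI)
    show "g (x + y) = g x + g y" for x y
      by (simp add: g_def ip_add_left scale_left_distrib suminf_add sm)
    show "g (sc c x) = sc c (g x)" for c x
    proof -
      have "bounded_linear (sc c)"
        by (rule bounded_linear_intro[where K = "norm c"])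
          (simp_all add: scale_right_distrib norm_sc mult.commute flip: sc_of_real)
      then show ?thesis
        by (simp add: g_def ip_sc_left bounded_linear.suminf[OF _ sm])
    qed
    show "norm (g x) = norm x" for x
    proof -
      have "(norm (g x))\<^sup>2 = (norm x)\<^sup>2"
        using norm_synthesis[OF f(1) Bessel_summable[OF e(1)]]
          norm_synthesis[OF e(1) Bessel_summable[OF e(1)]] Fourier[OF e] by (simp add: g_def)
      then show ?thesis by (simp add: power2_eq_iff_nonneg)
    qed
    show "\<exists>x. g x = y" for y
    proof
      show "g (\<Sum>n. sc (ip y (f n)) (e n)) = y"
        unfolding g_def ip_synthesis[OF e(1) Bessel_summable[OF f(1)]] by (rule Fourier[OF f])
    qed
  qed
  moreover have "g (e k) = f k" for k
  proof -
    have "(\<lambda>n. sc (ip (e k) (e n)) (f n)) = (\<lambda>n. if n = k then f n else 0)"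
      using e(1) by (auto simp: orthonormal_def)
    then show ?thesis
      using sums_If_finite_set[of "{k}" f] by (simp add: g_def sums_iff)
  qed
  ultimately show ?thesis by auto
qed

end

section \<open>Orthonormal bases and isometries fixing part of a basis\<close>

context hilbert
begin

text \<open>Zorn's lemma inside the annihilator of \<open>Y\<close>: a nonzero vector of the
  annihilator orthogonal to a maximal family could be normalised and adjoined. With \<open>Y\<close>
  empty this yields a basis of the space, in general a basis of a complement.\<close>

lemma orthonormal_ex_extension:
  assumes "orthonormal D0 id" and "D0 \<subseteq> {x. \<forall>y\<in>Y. ip x y = 0}"
  shows "\<exists>D. D0 \<subseteq> D \<and> orthonormal D id \<and> D \<subseteq> {x. \<forall>y\<in>Y. ip x y = 0} \<and>
    (\<forall>x. (\<forall>y\<in>Y. ip x y = 0) \<longrightarrow> (\<forall>d\<in>D. ip x d = 0) \<longrightarrow> x = 0)"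
proof -
  define S where "S = {x. \<forall>y\<in>Y. ip x y = 0}"
  define \<A> where "\<A> = {D. D0 \<subseteq> D \<and> orthonormal D id \<and> D \<subseteq> S}"
  have "\<exists>M\<in>\<A>. \<forall>X\<in>\<A>. M \<subseteq> X \<longrightarrow> X = M"
  proof (rule subset_Zorn_nonempty)
    show "\<A> \<noteq> {}" using assms by (auto simp: \<A>_def S_def)
    fix \<C> assume ne: "\<C> \<noteq> {}" and ch: "subset.chain \<A> \<C>"
    have "orthonormal (\<Union>\<C>) id"
      unfolding orthonormal_def
    proof (intro ballI)
      fix x y assume "x \<in> \<Union>\<C>" "y \<in> \<Union>\<C>"
      then obtain D where "D \<in> \<C>" "x \<in> D" "y \<in> D"
        using ch unfolding subset.chain_def by blast
      then show "ip (id x) (id y) = (if x = y then 1 else 0)"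
        using ch by (auto simp: \<A>_def subset.chain_def orthonormal_def)
    qed
    then show "\<Union>\<C> \<in> \<A>"
      using ne ch by (fastforce simp: \<A>_def subset.chain_def)
  qed
  then obtain D where D: "D \<in> \<A>" and max: "\<And>X. X \<in> \<A> \<Longrightarrow> D \<subseteq> X \<Longrightarrow> X = D" by blast
  have "x = 0" if x: "x \<in> S" "\<forall>d\<in>D. ip x d = 0" for x
  proof (rule ccontr)
    assume "x \<noteq> 0"
    define u where "u = (1 / norm x) *\<^sub>R x"
    have "ip u u = 1" using \<open>x \<noteq> 0\<close> by (simp add: u_def ip_self power2_eq_square)
    moreover have "\<forall>d\<in>D. ip u d = 0" "\<forall>d\<in>D. ip d u = 0"
      using x(2) by (auto simp: u_def ip_eq_0_commute[of _ x])
    ultimately have "insert u D \<in> \<A>"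
      using D x(1) by (auto simp: \<A>_def S_def orthonormal_def u_def)
    then have "u \<in> D" using max by blast
    then show False using \<open>\<forall>d\<in>D. ip u d = 0\<close> \<open>ip u u = 1\<close> by auto
  qed
  then show ?thesis using D unfolding \<A>_def S_def by blast
qed

text \<open>Distinct members have distance sqrt 2, so points of a countable dense set chosen within
  1/2 of them are distinct.\<close>

lemma countable_orthonormal:
  assumes D: "orthonormal D id"
  shows "countable D"
proof -
  obtain C :: "'a set" where C: "countable C" "closure C = UNIV"
    using separable unfolding separable_space_def by auto
  have "\<exists>c\<in>C. dist c d < 1/2" for d
  proof -
    have "d \<in> closure C" using C(2) by simp
    then show ?thesis unfolding closure_approachable by (meson half_gt_zero zero_less_one)
  qed
  then obtain q where q: "\<And>d. q d \<in> C" "\<And>d. dist (q d) d < 1/2" by metis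
  have "inj_on q D"
  proof (rule inj_onI, rule ccontr)
    fix x y assume xy: "x \<in> D" "y \<in> D" "q x = q y" "x \<noteq> y"
    have "ip (x - y) (x - y) = 2"
      using D xy by (auto simp: ip_diff_left ip_diff_right orthonormal_def)
    then have "(norm (x - y))\<^sup>2 = 2"
      by (metis ip_self of_real_eq_iff of_real_numeral)
    moreover have "norm (x - y) < 1"
      using q(2)[of x] q(2)[of y] xy(3) dist_triangle3[of x y "q x"] by (simp add: dist_norm)
    ultimately show False
      using power_strict_mono[of "norm (x - y)" 1 2] by simp
  qed
  then show ?thesis
    using countable_subset[of "q ` D" C] C(1) q(1) countable_image_inj_on by blast
qed

lemma ex_orthonormal_basis: "\<exists>e :: nat \<Rightarrow> 'a. orthonormal UNIV e \<and> total e"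
proof -
  obtain D where D: "orthonormal D id" and max: "\<And>x. (\<forall>d\<in>D. ip x d = 0) \<Longrightarrow> x = 0"
    using orthonormal_ex_extension[of "{}" "{}"] by (auto simp: orthonormal_def)
  have "infinite D"
  proof
    assume fin: "finite D"
    have "x \<in> span D" for x
    proof -
      define p where "p = (\<Sum>d\<in>D. sc (ip x d) d)"
      have "ip (x - p) d = 0" if "d \<in> D" for d
      proof -
        have "ip p d = (\<Sum>d'\<in>D. ip x d' * ip d' d)"
          by (simp add: p_def ip_sum_left ip_sc_left)
        also have "\<dots> = (\<Sum>d'\<in>D. if d' = d then ip x d' else 0)"
          using D that by (intro sum.cong) (auto simp: orthonormal_def)
        finally show ?thesis using fin that by (simp add: ip_diff_left)
      qed
      then have "x = p" using max[of "x - p"] by simp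
      moreover have "p \<in> span D"
        unfolding p_def by (intro span_sum span_scale span_base)
      ultimately show ?thesis by simp
    qed
    then show False using infinite_dim fin unfolding infinite_dimensional_def by blast
  qed
  then have b: "bij_betw (from_nat_into D) UNIV D"
    using bij_betw_from_nat_into[OF countable_orthonormal[OF D]] by blast
  have "orthonormal UNIV (from_nat_into D)"
    using D b unfolding orthonormal_def bij_betw_def inj_on_def by (metis UNIV_I id_apply rangeI)
  moreover have "total (from_nat_into D)"
    unfolding total_def
  proof (intro allI impI max ballI)
    fix x d assume "\<forall>n. ip x (from_nat_into D n) = 0" "d \<in> D"
    then show "ip x d = 0" using b by (metis bij_betw_def imageE)
  qed
  ultimately show ?thesis by blast
qed

text \<open>With \<open>v = b - c\<close>, the usual reflection along \<open>v\<close> sends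
  \<open>b\<close> to \<open>c\<close> only if \<open>ip b c\<close> is real. Dividing by
  \<open>\<beta> = ip b v\<close> instead of half of \<open>ip v v\<close> repairs this:
  \<open>b\<close> is sent to \<open>b - v = c\<close> by construction, and the map is still
  isometric because \<open>ip v v = \<beta> + cj \<beta>\<close>. Over the reals it is the usual
  reflection. The same formula with \<open>cj \<beta>\<close> provides preimages.\<close>

lemma Householder:
  assumes "ip b b = ip c c"
  shows "\<exists>R \<in> carrier G. R b = c \<and> (\<forall>x. ip x (b - c) = 0 \<longrightarrow> R x = x)"
proof (cases "b = c")
  case True
  then show ?thesis by (intro bexI[of _ id_blinfun]) auto
next
  case False
  define v where "v = b - c"
  define \<beta> where "\<beta> = ip b v"
  have vv: "ip v v = \<beta> + cj \<beta>"
    unfolding v_def \<beta>_def using assms ip_commute[of b c] ip_commute[of b b]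
    by (simp add: ip_diff_left ip_diff_right)
  have \<beta>0: "\<beta> \<noteq> 0" "cj \<beta> \<noteq> 0" using vv False norm_cj[of \<beta>] by (auto simp: v_def)
  have cv: "ip c v = - cj \<beta>"
    using assms ip_commute[of b c] ip_commute[of b b]
    unfolding v_def \<beta>_def by (simp add: ip_diff_left ip_diff_right)
  define R where "R x = x - sc (ip x v / \<beta>) v" for x
  define R' where "R' x = x - sc (ip x v / cj \<beta>) v" for x
  have iv: "ip (R' x) v = - (ip x v * \<beta> / cj \<beta>)" for x
    using \<beta>0 by (simp add: R'_def ip_diff_left ip_sc_left vv field_simps)
  have "\<exists>U\<in>carrier G. blinfun_apply U = R"
  proof (rule G_exI)
    show "R (x + y) = R x + R y" for x y
      by (simp add: R_def ip_add_left add_divide_distrib scale_left_distrib)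
    show "R (sc a x) = sc a (R x)" for a x
      by (simp add: R_def ip_sc_left scale_right_diff_distrib)
    show "norm (R x) = norm x" for x
    proof -
      define t where "t = ip x v / \<beta>"
      have "ip (R x) (R x) = ip x x - cj t * ip x v - t * cj (ip x v) + t * (cj t * (\<beta> + cj \<beta>))"
        unfolding R_def t_def[symmetric] ip_diff_left ip_diff_right ip_sc_left ip_sc_right vv
        by (simp add: ip_commute[of v x] algebra_simps)
      also have "\<dots> = ip x x"
      proof -
        have "q - (t' / b') * t - (t / b) * t' + (t / b) * ((t' / b') * (b + b')) = q"
          if "b \<noteq> 0" "b' \<noteq> 0" for q t t' b b' :: 'f
          using that by (simp add: divide_simps) (simp add: algebra_simps)
        from this[OF \<beta>0] show ?thesis unfolding t_def cj_divide .
      qed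
      finally show ?thesis by (simp add: norm_eq_iff_ip_self)
    qed
    show "\<exists>x. R x = y" for y
    proof
      have "R (R' y) = y - sc (ip y v / cj \<beta>) v + sc (ip y v / cj \<beta>) v"
        using \<beta>0 by (simp add: R_def iv) (simp add: R'_def)
      then show "R (R' y) = y" by simp
    qed
  qed
  moreover have "R b = c" using \<beta>0 by (simp add: R_def flip: \<beta>_def) (simp add: v_def)
  moreover have "R x = x" if "ip x (b - c) = 0" for x
    using that by (simp add: R_def v_def)
  ultimately show ?thesis by metis
qed

text \<open>The vectors may be linearly dependent, so they are moved one at a time. The reflection
  that carries \<open>k (b i)\<close> to \<open>c i\<close> leaves the vectors already placed alone:
  equality of the Gram matrices makes them orthogonal to \<open>k (b i) - c i\<close>.\<close>

lemma G_ex_map_of_Gram_eq: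
  assumes "finite I" "\<And>i j. i \<in> I \<Longrightarrow> j \<in> I \<Longrightarrow> ip (b i) (b j) = ip (c i) (c j)"
  shows "\<exists>k \<in> carrier G. \<forall>i\<in>I. k (b i) = c i"
  using assms
proof (induction I rule: finite_induct)
  case empty
  show ?case by auto
next
  case (insert i I)
  then obtain k where k: "k \<in> carrier G" "\<And>j. j \<in> I \<Longrightarrow> k (b j) = c j"
    by auto
  have "ip (k (b i)) (k (b i)) = ip (c i) (c i)"
    using insert.prems[of i i] by (simp add: G_ip k)
  then obtain R where R: "R \<in> carrier G" "R (k (b i)) = c i"
      "\<And>x. ip x (k (b i) - c i) = 0 \<Longrightarrow> R x = x"
    using Householder by metis
  have "R (c j) = c j" if "j \<in> I" for j
  proof (rule R(3))
    have "ip (c j) (k (b i)) = ip (b j) (b i)"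
      using k that G_ip[OF k(1), of "b j" "b i"] by simp
    then show "ip (c j) (k (b i) - c i) = 0"
      using insert.prems[of j i] that by (simp add: ip_diff_right)
  qed
  then have "\<forall>j\<in>insert i I. (R o\<^sub>L k) (b j) = c j"
    using R k by simp
  then show ?case using R(1) k(1) by blast
qed

end

section \<open>Subgroups acting on a set of coordinates\<close>

locale hilbert_basis = hilbert sc ip cj
  for sc :: "'f::real_normed_field \<Rightarrow> 'a::{real_normed_vector,complete_space} \<Rightarrow> 'a" and ip cj +
  fixes e :: "nat \<Rightarrow> 'a"
  assumes orthonormal_e: "orthonormal UNIV e" and total_e: "total e"
begin

definition fixing :: "nat set \<Rightarrow> ('a \<Rightarrow>\<^sub>L 'a) set" where
  "fixing A = {g \<in> carrier G. \<forall>n. n \<notin> A \<longrightarrow> g (e n) = e n}"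

text \<open>By Fourier expansion this is the closed span of the \<open>e n\<close> with
  \<open>n \<in> A\<close>; describing it by vanishing coefficients makes membership a
  coordinatewise check.\<close>

definition supp :: "nat set \<Rightarrow> 'a set" where
  "supp A = {x. \<forall>n. n \<notin> A \<longrightarrow> ip x (e n) = 0}"

lemma ip_e: "ip (e m) (e n) = (if m = n then 1 else 0)"
  using orthonormal_e by (simp add: orthonormal_def)

lemma eq_if_ip_e: "(\<And>n. ip x (e n) = ip y (e n)) \<Longrightarrow> x = y"
  using total_e unfolding total_def by (metis ip_diff_left eq_iff_diff_eq_0)

lemma e_in_supp: "n \<in> A \<Longrightarrow> e n \<in> supp A"
  by (auto simp: supp_def ip_e)

lemma supp_mono: "A \<subseteq> B \<Longrightarrow> supp A \<subseteq> supp B"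
  by (auto simp: supp_def)

lemma fixing_in_G: "g \<in> fixing A \<Longrightarrow> g \<in> carrier G"
  by (simp add: fixing_def)

lemma fixing_mono: "A \<subseteq> B \<Longrightarrow> fixing A \<subseteq> fixing B"
  by (auto simp: fixing_def)

lemma subgroup_fixing: "subgroup (fixing A) G"
proof
  show "fixing A \<subseteq> carrier G" by (auto simp: fixing_def)
  show "x \<otimes>\<^bsub>G\<^esub> y \<in> fixing A" if "x \<in> fixing A" "y \<in> fixing A" for x y
    using that by (auto simp: fixing_def)
  show "\<one>\<^bsub>G\<^esub> \<in> fixing A" by (auto simp: fixing_def)
  show "ginv x \<in> fixing A" if "x \<in> fixing A" for x
    using that by (auto simp: fixing_def G_eq_ginv_iff[symmetric])
qed

lemma G_eqI:
  assumes "g \<in> carrier G" "h \<in> carrier G" "\<And>n. g (e n) = h (e n)"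
  shows "g = h"
proof (rule blinfun_eqI)
  fix x
  have "ginv h (g x) = x"
  proof (rule eq_if_ip_e)
    show "ip (ginv h (g x)) (e n) = ip x (e n)" for n
      using assms G_ip[of g x "e n"] by (simp add: ip_ginv flip: assms(3))
  qed
  then show "g x = h x" using assms(2) G_eq_ginv_iff by metis
qed

lemma fixing_supp:
  assumes g: "g \<in> fixing A" and x: "x \<in> supp B" and "A \<inter> B = {}"
  shows "g x = x"
proof -
  have gG: "g \<in> carrier G" using g by (rule fixing_in_G)
  have "x = (\<Sum>n. sc (ip x (e n)) (e n))"
    by (rule Fourier[OF orthonormal_e total_e, symmetric])
  then have "g x = g (\<Sum>n. sc (ip x (e n)) (e n))" by simp
  also have "\<dots> = (\<Sum>n. g (sc (ip x (e n)) (e n)))"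
    by (rule bounded_linear.suminf[OF blinfun.bounded_linear_right
          summable_synthesis[OF orthonormal_e Bessel_summable[OF orthonormal_e]]])
  also have "(\<lambda>n. g (sc (ip x (e n)) (e n))) = (\<lambda>n. sc (ip x (e n)) (e n))"
  proof
    show "g (sc (ip x (e n)) (e n)) = sc (ip x (e n)) (e n)" for n
      using g x assms(3) by (cases "n \<in> A") (auto simp: G_app(2)[OF gG] fixing_def supp_def)
  qed
  also have "(\<Sum>n. sc (ip x (e n)) (e n)) = x"
    by (rule Fourier[OF orthonormal_e total_e])
  finally show ?thesis .
qed

lemma fixing_preserves_supp:
  assumes g: "g \<in> fixing A" and x: "x \<in> supp B" and "A \<subseteq> B"
  shows "g x \<in> supp B"
  unfolding supp_def
proof (intro CollectI allI impI)
  fix n assume "n \<notin> B"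
  then have "g (e n) = e n" "ip x (e n) = 0" using assms by (auto simp: fixing_def supp_def)
  then show "ip (g x) (e n) = 0" using G_ip[OF fixing_in_G[OF g], of x "e n"] by simp
qed

lemma supp_disjoint:
  assumes x: "x \<in> supp A" and y: "y \<in> supp B" and "A \<inter> B = {}"
  shows "ip x y = 0"
proof -
  have "ip x y = ip (\<Sum>n. sc (ip x (e n)) (e n)) y"
    by (simp add: Fourier[OF orthonormal_e total_e])
  also have "\<dots> = (\<Sum>n. ip (sc (ip x (e n)) (e n)) y)"
    by (rule bounded_linear.suminf[OF bounded_linear_ip
          summable_synthesis[OF orthonormal_e Bessel_summable[OF orthonormal_e]]])
  also have "(\<lambda>n. ip (sc (ip x (e n)) (e n)) y) = (\<lambda>n. 0)"
  proof
    show "ip (sc (ip x (e n)) (e n)) y = 0" for n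
      using x y assms(3) by (cases "n \<in> A") (auto simp: ip_sc_left supp_def ip_eq_0_commute[of "e n"])
  qed
  finally show ?thesis by simp
qed

lemma fixing_commute:
  assumes g: "g \<in> fixing A" and h: "h \<in> fixing B" and "A \<inter> B = {}"
  shows "g o\<^sub>L h = h o\<^sub>L g"
proof (rule G_eqI)
  fix n
  consider "n \<in> A" "n \<notin> B" | "n \<in> B" "n \<notin> A" | "n \<notin> A" "n \<notin> B" using assms(3) by auto
  then show "(g o\<^sub>L h) (e n) = (h o\<^sub>L g) (e n)"
  proof cases
    case 1
    then show ?thesis
      using fixing_supp[OF h fixing_preserves_supp[OF g e_in_supp[of n A] order_refl]] h assms(3)
      by (auto simp: fixing_def Int_commute)
  next
    case 2
    then show ?thesis
      using fixing_supp[OF g fixing_preserves_supp[OF h e_in_supp[of n B] order_refl]] g assms(3)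
      by (auto simp: fixing_def Int_commute)
  qed (use g h in \<open>auto simp: fixing_def\<close>)
qed (use g h in \<open>auto intro: fixing_in_G\<close>)

text \<open>The infinite block sum of the \<open>u k\<close>. The second half of the conclusion,
  that each \<open>u k\<close> splits off with a cofactor acting only on the other blocks, is what
  the diagonal argument contradicts.\<close>

lemma fixing_glue:
  assumes disj: "\<And>k l. k \<noteq> l \<Longrightarrow> A k \<inter> A l = {}" and X: "(\<Union>k. A k) = X"
    and u: "\<And>k :: 'i. u k \<in> fixing (A k)"
  shows "\<exists>g. g \<in> fixing X \<and> (\<forall>k. \<forall>n \<in> A k. g (e n) = u k (e n)) \<and>
    (\<forall>k. \<exists>c \<in> fixing (X - A k). u k o\<^sub>L c = g)"
proof -
  define f where "f n = (if n \<in> X then u (THE k. n \<in> A k) (e n) else e n)" for n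
  have the: "(THE k. n \<in> A k) = k" if "n \<in> A k" for n k
    using disj that by (intro the_equality) blast+
  have f_in: "f n = u k (e n)" if "n \<in> A k" for n k
    using that X by (auto simp: f_def the)
  have f_out: "f n = e n" if "n \<notin> X" for n
    using that by (simp add: f_def)
  have f_supp: "f n \<in> supp (A k)" if "n \<in> A k" for n k
    using fixing_preserves_supp[OF u[of k] e_in_supp order_refl] that by (simp add: f_in)
  have on: "orthonormal UNIV f"
    unfolding orthonormal_def
  proof (intro ballI)
    fix m n
    consider k where "m \<in> A k" "n \<in> A k" | k l where "m \<in> A k" "n \<in> A l" "k \<noteq> l"
      | k where "m \<in> A k" "n \<notin> X" | k where "m \<notin> X" "n \<in> A k" | "m \<notin> X" "n \<notin> X"
      using X by blast
    then show "ip (f m) (f n) = (if m = n then 1 else 0)"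
    proof cases
      case 1
      then show ?thesis using G_ip[OF fixing_in_G[OF u[of k]]] by (simp add: f_in ip_e)
    next
      case 2
      then show ?thesis using supp_disjoint[OF f_supp f_supp disj] disj by fastforce
    next
      case 3
      then show ?thesis using f_supp[of m k] X by (auto simp: supp_def f_out)
    next
      case 4
      then show ?thesis using f_supp[of n k] X by (auto simp: supp_def f_out ip_eq_0_commute[of "e m"])
    qed (simp add: f_out ip_e)
  qed
  have tot: "total f"
    unfolding total_def
  proof (intro allI impI)
    fix x assume x: "\<forall>n. ip x (f n) = 0"
    have "ip x (e n) = ip 0 (e n)" for n
    proof (cases "n \<in> X")
      case True
      then obtain k where k: "n \<in> A k" using X by auto
      have uk: "u k \<in> carrier G" using u by (rule fixing_in_G)
      define y where "y = ginv (u k) x"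
      \<comment> \<open>\<open>x\<close> is orthogonal to all \<open>u k (e n)\<close> with
        \<open>n \<in> A k\<close>, so its preimage under \<open>u k\<close> has no coordinates in
        \<open>A k\<close>; hence \<open>u k\<close> fixes that preimage, and \<open>x\<close>
        itself has none either.\<close>
      have "y \<in> supp (- A k)"
        using x f_in[of _ k] by (auto simp: supp_def y_def ip_ginv[OF uk]) metis
      then have "u k y = y" by (intro fixing_supp[OF u]) auto
      then have "x = y" using uk by (simp add: y_def)
      then show ?thesis using \<open>y \<in> supp (- A k)\<close> k by (simp add: supp_def)
    next
      case False
      then show ?thesis using x f_out[of n] by (metis ip_zero(1))
    qed
    then show "x = 0" by (rule eq_if_ip_e)
  qed
  obtain g where g: "g \<in> carrier G" "\<And>n. g (e n) = f n"
    using G_ex_basis_map[OF orthonormal_e total_e on tot] by blast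
  have gX: "g \<in> fixing X" using g f_out by (simp add: fixing_def)
  have "\<exists>c \<in> fixing (X - A k). u k o\<^sub>L c = g" for k
  proof
    have uk: "u k \<in> carrier G" using u by (rule fixing_in_G)
    show "u k o\<^sub>L (ginv (u k) o\<^sub>L g) = g"
      using uk by (intro blinfun_eqI) simp
    have "ginv (u k) (g (e n)) = e n" if "n \<notin> X - A k" for n
    proof (cases "n \<in> A k")
      case True
      then show ?thesis using uk by (simp add: g f_in)
    next
      case False
      then have "n \<notin> X" using that by simp
      then have "g (e n) = e n" "u k (e n) = e n"
        using g f_out u[of k] False by (auto simp: fixing_def)
      then show ?thesis using uk G_eq_ginv_iff by metis
    qed
    then show "ginv (u k) o\<^sub>L g \<in> fixing (X - A k)"
      using uk g(1) by (auto simp: fixing_def)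
  qed
  then show ?thesis using gX g(2) f_in by auto
qed

lemma ex_perm:
  assumes "bij \<sigma>"
  shows "\<exists>s \<in> carrier G. \<forall>n. s (e n) = e (\<sigma> n)"
proof (rule G_ex_basis_map[OF orthonormal_e total_e])
  show "orthonormal UNIV (\<lambda>n. e (\<sigma> n))"
    using assms by (auto simp: orthonormal_def ip_e bij_def inj_def)
  show "total (\<lambda>n. e (\<sigma> n))"
    using assms total_e unfolding total_def by (metis bij_pointE)
qed

lemma fixing_conj:
  assumes s: "s \<in> carrier G" "\<And>n. s (e n) = e (\<sigma> n)" and "bij \<sigma>" and g: "g \<in> fixing A"
  shows "s o\<^sub>L g o\<^sub>L ginv s \<in> fixing (\<sigma> ` A)"
proof -
  have gG: "g \<in> carrier G" using g by (rule fixing_in_G)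
  have "(s o\<^sub>L g o\<^sub>L ginv s) (e n) = e n" if n: "n \<notin> \<sigma> ` A" for n
  proof -
    obtain m where m: "n = \<sigma> m" using assms(3) by (metis bij_pointE)
    then have "m \<notin> A" using n by auto
    moreover have "ginv s (e n) = e m" using s G_eq_ginv_iff m by metis
    ultimately show ?thesis using g s m by (simp add: fixing_def)
  qed
  then show ?thesis using s gG by (simp add: fixing_def)
qed

lemma ginv_perm:
  assumes s: "s \<in> carrier G" "\<And>n. s (e n) = e (\<sigma> n)" and "bij \<sigma>"
  shows "ginv s (e n) = e (inv_into UNIV \<sigma> n)"
proof -
  have "s (e (inv_into UNIV \<sigma> n)) = e n" using s(2) assms(3) by (simp add: bij_is_surj surj_f_inv_f)
  then show ?thesis using s(1) G_eq_ginv_iff by metis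
qed

end

section \<open>Symmetric sets with countably many covering translates\<close>

text \<open>Exactly \<open>n\<close> factors. As \<open>W\<close> may omit the identity, the powers
  need not be nested, and all bounds below are exact counts.\<close>

primrec wpow :: "('g, 'm) monoid_scheme \<Rightarrow> 'g set \<Rightarrow> nat \<Rightarrow> 'g set" where
  "wpow K W 0 = {\<one>\<^bsub>K\<^esub>}"
| "wpow K W (Suc n) = {a \<otimes>\<^bsub>K\<^esub> b |a b. a \<in> W \<and> b \<in> wpow K W n}"

text \<open>The premise of the Steinhaus property: the condition on \<open>h\<close> says that the
  left translates \<open>h n W\<close> cover the group.\<close>

definition sigma_syndetic :: "('g, 'm) monoid_scheme \<Rightarrow> 'g set \<Rightarrow> bool" where
  "sigma_syndetic K W \<longleftrightarrow> W \<subseteq> carrier K \<and> (\<forall>x\<in>W. inv\<^bsub>K\<^esub> x \<in> W) \<and>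
    (\<exists>h :: nat \<Rightarrow> 'g. (\<forall>n. h n \<in> carrier K) \<and>
      (\<forall>x \<in> carrier K. \<exists>n. inv\<^bsub>K\<^esub> (h n) \<otimes>\<^bsub>K\<^esub> x \<in> W))"

context group
begin

lemma wpow_closed:
  assumes "W \<subseteq> carrier G"
  shows "wpow G W n \<subseteq> carrier G"
  by (induction n) (use assms in auto)

lemma wpow_add:
  assumes W: "W \<subseteq> carrier G"
  shows "a \<in> wpow G W m \<Longrightarrow> b \<in> wpow G W n \<Longrightarrow> a \<otimes> b \<in> wpow G W (m + n)"
proof (induction m arbitrary: a)
  case 0
  then show ?case using wpow_closed[OF W, of n] by auto
next
  case (Suc m)
  then obtain c d where cd: "a = c \<otimes> d" "c \<in> W" "d \<in> wpow G W m" by auto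
  have "a \<otimes> b = c \<otimes> (d \<otimes> b)"
    unfolding cd(1) using cd W wpow_closed[OF W] Suc.prems(2) by (intro m_assoc) auto
  moreover have "d \<otimes> b \<in> wpow G W (m + n)" using Suc cd by simp
  ultimately show ?case using cd(2) by auto
qed

lemma wpow_one:
  assumes "W \<subseteq> carrier G" "a \<in> W"
  shows "a \<in> wpow G W 1"
proof -
  have "a = a \<otimes> \<one>" using assms by auto
  then show ?thesis using assms(2) by auto
qed

lemma wpow_inv:
  assumes W: "W \<subseteq> carrier G" "\<And>x. x \<in> W \<Longrightarrow> inv x \<in> W"
  shows "a \<in> wpow G W n \<Longrightarrow> inv a \<in> wpow G W n"
proof (induction n arbitrary: a)
  case (Suc n)
  then obtain c d where cd: "a = c \<otimes> d" "c \<in> W" "d \<in> wpow G W n" by auto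
  have "inv a = inv d \<otimes> inv c"
    unfolding cd(1) using cd W(1) wpow_closed[OF W(1)] by (intro inv_mult_group) auto
  moreover have "inv d \<otimes> inv c \<in> wpow G W (n + 1)"
    by (intro wpow_add Suc.IH wpow_one W cd)
  ultimately show ?case by simp
qed simp

lemma wpow_conj:
  assumes W: "W \<subseteq> carrier G" and g: "g \<in> carrier G"
  shows "a \<in> wpow G W n \<Longrightarrow> g \<otimes> a \<otimes> inv g \<in> wpow G ((\<lambda>x. g \<otimes> x \<otimes> inv g) ` W) n"
proof (induction n arbitrary: a)
  case (Suc n)
  then obtain c d where cd: "a = c \<otimes> d" "c \<in> W" "d \<in> wpow G W n" by auto
  have c: "c \<in> carrier G" and d: "d \<in> carrier G" using cd W wpow_closed[OF W] by auto
  have "g \<otimes> a \<otimes> inv g = (g \<otimes> c \<otimes> inv g) \<otimes> (g \<otimes> d \<otimes> inv g)"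
    using c d g unfolding cd(1) by (simp add: m_assoc inv_solve_left)
  then show ?case using Suc.IH[OF cd(3)] cd(2) by auto
qed (use g in simp)

lemma sigma_syndetic_conj:
  assumes W: "sigma_syndetic G W" and g: "g \<in> carrier G"
  shows "sigma_syndetic G ((\<lambda>x. g \<otimes> x \<otimes> inv g) ` W)"
proof -
  obtain h where h: "\<And>n::nat. h n \<in> carrier G"
    and cov: "\<And>x. x \<in> carrier G \<Longrightarrow> \<exists>n. inv (h n) \<otimes> x \<in> W"
    using W unfolding sigma_syndetic_def by blast
  have sub: "W \<subseteq> carrier G" and sym: "\<And>x. x \<in> W \<Longrightarrow> inv x \<in> W"
    using W by (auto simp: sigma_syndetic_def)
  have "inv (g \<otimes> x \<otimes> inv g) = g \<otimes> inv x \<otimes> inv g" if "x \<in> W" for x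
    using that sub g by (simp add: inv_mult_group subset_iff m_assoc)
  then have 1: "\<forall>x\<in>(\<lambda>x. g \<otimes> x \<otimes> inv g) ` W. inv x \<in> (\<lambda>x. g \<otimes> x \<otimes> inv g) ` W"
    using sym by auto
  have 2: "\<exists>n. inv (g \<otimes> h n \<otimes> inv g) \<otimes> x \<in> (\<lambda>x. g \<otimes> x \<otimes> inv g) ` W" if x: "x \<in> carrier G" for x
  proof -
    obtain n where n: "inv (h n) \<otimes> (inv g \<otimes> x \<otimes> g) \<in> W"
      using cov[of "inv g \<otimes> x \<otimes> g"] x g by auto
    have "inv (g \<otimes> h n \<otimes> inv g) \<otimes> x = g \<otimes> (inv (h n) \<otimes> (inv g \<otimes> x \<otimes> g)) \<otimes> inv g"
      using x g h[of n] by (simp add: inv_mult_group m_assoc)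
    then show ?thesis using n by auto
  qed
  show ?thesis
    unfolding sigma_syndetic_def
    using 1 2 sub g h by (intro conjI exI[of _ "\<lambda>n. g \<otimes> h n \<otimes> inv g"]) auto
qed

text \<open>Two of the uncountably many elements fall into the same translate; dividing one by the
  other cancels the translating element and leaves a product of two members of
  \<open>W\<close>.\<close>

lemma sigma_syndetic_pigeonhole:
  assumes W: "sigma_syndetic G W" and T: "uncountable T" and g: "\<And>t. t \<in> T \<Longrightarrow> g t \<in> carrier G"
  shows "\<exists>r\<in>T. \<exists>s\<in>T. r \<noteq> s \<and> inv (g r) \<otimes> g s \<in> wpow G W 2"
proof -
  obtain h where h: "\<And>n::nat. h n \<in> carrier G"
    and cov: "\<And>x. x \<in> carrier G \<Longrightarrow> \<exists>n. inv (h n) \<otimes> x \<in> W"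
    using W unfolding sigma_syndetic_def by blast
  have sub: "W \<subseteq> carrier G" and sym: "\<And>x. x \<in> W \<Longrightarrow> inv x \<in> W"
    using W by (auto simp: sigma_syndetic_def)
  obtain N where N: "\<And>t. t \<in> T \<Longrightarrow> inv (h (N t)) \<otimes> g t \<in> W"
    using bchoice[of T "\<lambda>t n. inv (h n) \<otimes> g t \<in> W"] cov g by blast
  have "\<not> inj_on N T"
    using T countableI by blast
  then obtain r s where rs: "r \<in> T" "s \<in> T" "N r = N s" "r \<noteq> s" by (auto simp: inj_on_def)
  have "inv (inv (h (N r)) \<otimes> g r) \<otimes> (inv (h (N r)) \<otimes> g s) \<in> wpow G W (1 + 1)"
    using N[OF rs(1)] N[OF rs(2)] unfolding rs(3) by (intro wpow_add wpow_inv wpow_one sub sym)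
  moreover have "inv (inv (h (N r)) \<otimes> g r) \<otimes> (inv (h (N r)) \<otimes> g s) = inv (g r) \<otimes> g s"
  proof -
    have "h (N r) \<otimes> (inv (h (N r)) \<otimes> g s) = g s"
      using g[OF rs(2)] h[of "N r"] by (simp flip: m_assoc)
    then show ?thesis
      using g[OF rs(1)] g[OF rs(2)] h[of "N r"] by (simp add: inv_mult_group m_assoc)
  qed
  ultimately show ?thesis using rs by (metis one_add_one)
qed

end

section \<open>Diagonal argument and commutators\<close>

context hilbert_basis
begin

lemma id_blinfun_compose: "id_blinfun o\<^sub>L (g :: 'a \<Rightarrow>\<^sub>L 'a) = g"
  by (rule blinfun_eqI) simp

lemma fixing_ginv: "g \<in> fixing A \<Longrightarrow> ginv g \<in> fixing A"
  using subgroup.m_inv_closed[OF subgroup_fixing] .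

lemma fixing_mult: "g \<in> fixing A \<Longrightarrow> h \<in> fixing A \<Longrightarrow> g o\<^sub>L h \<in> fixing A"
  using subgroup.m_closed[OF subgroup_fixing] by simp

lemma id_in_fixing: "id_blinfun \<in> fixing A"
  using subgroup.one_closed[OF subgroup_fixing] by simp

lemma fixing_commute_app:
  assumes "g \<in> fixing A" "h \<in> fixing B" "A \<inter> B = {}"
  shows "g (h x) = h (g x)"
  using arg_cong[OF fixing_commute[OF assms], of "\<lambda>k. blinfun_apply k x"] by simp

text \<open>If for every \<open>k\<close> some \<open>u k\<close> on block \<open>k\<close> had no
  extension in the translate of \<open>S\<close> by \<open>h k\<close>, then the block sum of the
  \<open>u k\<close> would extend all of them and lie in no translate. Block \<open>k\<close> has to
  defeat only the single translate numbered \<open>k\<close>. The set \<open>S\<close> is arbitrary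
  because the argument is run with two different ones.\<close>

lemma fixing_diagonal:
  fixes h :: "nat \<Rightarrow> 'a \<Rightarrow>\<^sub>L 'a"
  assumes disj: "\<And>k l :: nat. k \<noteq> l \<Longrightarrow> A k \<inter> A l = {}" and X: "(\<Union>k. A k) = X"
    and h: "\<And>n. h n \<in> carrier G" and cov: "\<And>u. u \<in> fixing X \<Longrightarrow> \<exists>n. ginv (h n) o\<^sub>L u \<in> S"
  shows "\<exists>k. \<forall>u \<in> fixing (A k). \<exists>c \<in> fixing (X - A k). \<exists>s\<in>S. \<exists>s'\<in>S. ginv s o\<^sub>L s' = u o\<^sub>L c"
proof -
  have "\<exists>k. \<forall>u \<in> fixing (A k). \<exists>c \<in> fixing (X - A k). ginv (h k) o\<^sub>L (u o\<^sub>L c) \<in> S"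
  proof (rule ccontr)
    assume "\<not> ?thesis"
    then obtain u where u: "\<And>k. u k \<in> fixing (A k)"
      and neg: "\<And>k c. c \<in> fixing (X - A k) \<Longrightarrow> ginv (h k) o\<^sub>L (u k o\<^sub>L c) \<notin> S"
      by metis
    obtain g where g: "g \<in> fixing X" "\<And>k. \<exists>c \<in> fixing (X - A k). u k o\<^sub>L c = g"
      using fixing_glue[OF disj X u] by metis
    obtain n where "ginv (h n) o\<^sub>L g \<in> S" using cov[OF g(1)] by blast
    then show False using g(2)[of n] neg by metis
  qed
  then obtain k where k: "\<And>u. u \<in> fixing (A k) \<Longrightarrow>
      \<exists>c \<in> fixing (X - A k). ginv (h k) o\<^sub>L (u o\<^sub>L c) \<in> S" by blast
  \<comment> \<open>\<open>c'\<close> is an extension of the identity of block \<open>k\<close> from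
    the same translate. Dividing by it cancels \<open>h k\<close>, and it can be moved past
    \<open>u\<close> since it acts off the block.\<close>
  obtain c' where c': "c' \<in> fixing (X - A k)" "ginv (h k) o\<^sub>L (id_blinfun o\<^sub>L c') \<in> S"
    using k[OF id_in_fixing] by blast
  have "\<exists>c \<in> fixing (X - A k). \<exists>s\<in>S. \<exists>s'\<in>S. ginv s o\<^sub>L s' = u o\<^sub>L c"
    if u: "u \<in> fixing (A k)" for u
  proof -
    obtain c where c: "c \<in> fixing (X - A k)" "ginv (h k) o\<^sub>L (u o\<^sub>L c) \<in> S"
      using k[OF u] by blast
    have "ginv (ginv (h k) o\<^sub>L (id_blinfun o\<^sub>L c')) o\<^sub>L (ginv (h k) o\<^sub>L (u o\<^sub>L c))
        = u o\<^sub>L (ginv c' o\<^sub>L c)"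
    proof (rule blinfun_eqI)
      fix x
      have cG: "c' \<in> carrier G" using c'(1) by (rule fixing_in_G)
      have "ginv (ginv (h k) o\<^sub>L c') = ginv c' o\<^sub>L h k"
        using G.inv_mult_group[of "ginv (h k)" c'] h[of k] cG by simp
      then show "(ginv (ginv (h k) o\<^sub>L (id_blinfun o\<^sub>L c')) o\<^sub>L (ginv (h k) o\<^sub>L (u o\<^sub>L c))) x
          = (u o\<^sub>L (ginv c' o\<^sub>L c)) x"
        using h[of k] fixing_commute_app[OF u fixing_ginv[OF c'(1)], of "c x"]
          by (simp add: id_blinfun_compose)
    qed
    moreover have "ginv c' o\<^sub>L c \<in> fixing (X - A k)"
      by (intro fixing_mult fixing_ginv c c')
    ultimately show ?thesis using c(2) c'(2) by blast
  qed
  then show ?thesis by blast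
qed

text \<open>The commutator is obtained by swindling: \<open>a\<close> consists of copies of \<open>u\<close> on one half of a
  two-sided sequence of blocks that \<open>s\<close> shifts by one.\<close>

lemma fixing_commutator:
  assumes BA: "B \<subseteq> A" and infB: "infinite B" and infAB: "infinite (A - B)" and u: "u \<in> fixing B"
  shows "\<exists>a \<in> fixing A. \<exists>s \<in> fixing A. u = a o\<^sub>L s o\<^sub>L ginv a o\<^sub>L ginv s"
proof -
  \<comment> \<open>\<open>\<phi>\<close> enumerates \<open>A\<close> by pairs of block and position
    so that block 0 is exactly \<open>B\<close>; the pairs in \<open>Z\<close> take up the rest of
    \<open>A\<close>.\<close>
  define Z :: "(int \<times> nat) set" where "Z = {p. fst p \<noteq> 0}"
  have infZ: "infinite Z"
  proof
    assume "finite Z"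
    then have "finite (Pair (1 :: int) ` (UNIV :: nat set))"
      by (rule rev_finite_subset) (auto simp: Z_def)
    then show False by (simp add: finite_image_iff inj_on_def)
  qed
  define \<phi> where "\<phi> p = (if fst p = 0 then from_nat_into B (snd p)
    else from_nat_into (A - B) (to_nat_on Z p))" for p
  have bB: "bij_betw (from_nat_into B) UNIV B" and bAB: "bij_betw (from_nat_into (A - B)) UNIV (A - B)"
    using infB infAB by (simp_all add: bij_betw_from_nat_into)
  have bZ: "bij_betw (to_nat_on Z) Z UNIV" using infZ by (simp add: to_nat_on_infinite)
  have b1: "bij_betw \<phi> ({0} \<times> UNIV) B"
  proof -
    have "bij_betw snd ({0 :: int} \<times> (UNIV :: nat set)) UNIV"
      by (auto simp: bij_betw_def inj_on_def image_iff)
    from bij_betw_trans[OF this bB] show ?thesis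
      by (rule bij_betw_cong[THEN iffD1, rotated]) (auto simp: \<phi>_def)
  qed
  have b2: "bij_betw \<phi> Z (A - B)"
    using bij_betw_trans[OF bZ bAB] by (rule bij_betw_cong[THEN iffD1, rotated]) (auto simp: \<phi>_def Z_def)
  have "bij_betw \<phi> ({0} \<times> UNIV \<union> Z) (B \<union> (A - B))"
    by (rule bij_betw_combine[OF b1 b2]) auto
  moreover have "{0} \<times> UNIV \<union> Z = UNIV" by (auto simp: Z_def)
  moreover have "B \<union> (A - B) = A" using BA by auto
  ultimately have b\<phi>: "bij_betw \<phi> UNIV A" by simp
  have inj\<phi>: "inj \<phi>" using b\<phi> by (rule bij_betw_imp_inj_on)
  have \<phi>_inj: "\<phi> p = \<phi> q \<longleftrightarrow> p = q" for p q using inj\<phi> by (rule inj_eq)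
  have \<phi>_A: "\<phi> p \<in> A" for p using bij_betw_apply[OF b\<phi>] by simp
  have \<phi>_surj: "\<exists>i n. m = \<phi> (i, n)" if "m \<in> A" for m
    using bij_betw_imp_surj_on[OF b\<phi>] that by (metis imageE surj_pair)
  define \<sigma> where "\<sigma> m = (if m \<in> A then case inv_into UNIV \<phi> m of (i, n) \<Rightarrow> \<phi> (i + 1, n) else m)" for m
  have \<sigma>_\<phi>: "\<sigma> (\<phi> (i, n)) = \<phi> (i + 1, n)" for i n
    using inj\<phi> \<phi>_A by (simp add: \<sigma>_def)
  have \<sigma>_out: "m \<notin> A \<Longrightarrow> \<sigma> m = m" for m by (simp add: \<sigma>_def)
  have "bij \<sigma>"
  proof (rule bijI)
    show "inj \<sigma>"
    proof (rule injI)
      fix x y assume eq: "\<sigma> x = \<sigma> y"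
      have in_A: "\<sigma> m \<in> A \<longleftrightarrow> m \<in> A" for m
        using \<phi>_surj[of m] \<sigma>_\<phi> \<phi>_A \<sigma>_out by metis
      show "x = y"
      proof (cases "x \<in> A")
        case True
        then obtain i n i' n' where "x = \<phi> (i, n)" "y = \<phi> (i', n')"
          using \<phi>_surj in_A eq by metis
        then show ?thesis using eq by (simp add: \<sigma>_\<phi> \<phi>_inj)
      next
        case False
        then show ?thesis using in_A eq \<sigma>_out by metis
      qed
    qed
    show "surj \<sigma>"
    proof (rule surjI)
      show "\<sigma> (if y \<in> A then case inv_into UNIV \<phi> y of (i, n) \<Rightarrow> \<phi> (i - 1, n) else y) = y" for y
      proof (cases "y \<in> A")
        case True
        then obtain i n where "y = \<phi> (i, n)" using \<phi>_surj by blast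
        then show ?thesis using inj\<phi> \<phi>_A by (simp add: \<sigma>_\<phi>)
      qed (simp add: \<sigma>_out)
    qed
  qed
  obtain s where s: "s \<in> carrier G" "\<And>n. s (e n) = e (\<sigma> n)"
    using ex_perm[OF \<open>bij \<sigma>\<close>] by blast
  have sA: "s \<in> fixing A" using s \<sigma>_out by (simp add: fixing_def)
  \<comment> \<open>Only the blocks 0, 1, 2, ... of the two-sided sequence. \<open>v k\<close> is
    \<open>u\<close> transported to block \<open>k\<close> by \<open>k\<close> shifts, and
    \<open>a\<close> will be the block sum of all \<open>v k\<close>.\<close>
  define C where "C k = \<phi> ` ({int k} \<times> UNIV)" for k
  have C0: "C 0 = B" using b1 by (simp add: C_def bij_betw_def)
  have CSuc: "C (Suc k) = \<sigma> ` C k" for k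
  proof -
    have "\<sigma> ` C k = (\<lambda>p. \<phi> (fst p + 1, snd p)) ` ({int k} \<times> UNIV)"
      unfolding C_def image_image by (intro image_cong refl) (auto simp: \<sigma>_\<phi>)
    also have "\<dots> = C (Suc k)"
      unfolding C_def by (force simp: image_iff add.commute)
    finally show ?thesis by simp
  qed
  have Cdisj: "C k \<inter> C l = {}" if "k \<noteq> l" for k l
    using that by (auto simp: C_def \<phi>_inj)
  define v where "v = rec_nat u (\<lambda>_ x. s o\<^sub>L x o\<^sub>L ginv s)"
  have v_simps: "v 0 = u" "v (Suc k) = s o\<^sub>L v k o\<^sub>L ginv s" for k
    by (simp_all add: v_def)
  have vC: "v k \<in> fixing (C k)" for k
    by (induction k) (use u C0 in \<open>auto simp: v_simps CSuc intro: fixing_conj[OF s \<open>bij \<sigma>\<close>]\<close>)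
  define X where "X = (\<Union>k. C k)"
  obtain a where aX: "a \<in> fixing X" and a: "\<And>k n. n \<in> C k \<Longrightarrow> a (e n) = v k (e n)"
    using fixing_glue[OF Cdisj X_def[symmetric] vC] by blast
  have aG: "a \<in> carrier G" using aX by (rule fixing_in_G)
  have uG: "u \<in> carrier G" using u by (rule fixing_in_G)
  have XA: "X \<subseteq> A" using \<phi>_A by (auto simp: X_def C_def)
  \<comment> \<open>Conjugating \<open>a\<close> by the shift moves each copy of \<open>u\<close>
    one block further, which empties block 0; multiplying by \<open>u\<close> fills it again and
    restores \<open>a\<close>. Solving for \<open>u\<close> gives the commutator.\<close>
  have eq: "u o\<^sub>L s o\<^sub>L a o\<^sub>L ginv s = a"
  proof (rule G_eqI)
    fix n
    obtain m where m: "n = \<sigma> m" using \<open>bij \<sigma>\<close> by (metis bij_pointE)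
    have gs: "ginv s (e n) = e m" using s G_eq_ginv_iff m by metis
    show "(u o\<^sub>L s o\<^sub>L a o\<^sub>L ginv s) (e n) = a (e n)"
    proof (cases "m \<in> X")
      case True
      then obtain k where k: "m \<in> C k" by (auto simp: X_def)
      then have n: "n \<in> C (Suc k)" by (simp add: CSuc m)
      have "s (a (e m)) = v (Suc k) (e n)" using a[OF k] by (simp add: v_simps gs)
      moreover have "v (Suc k) (e n) \<in> supp (C (Suc k))"
        by (intro fixing_preserves_supp[OF vC] e_in_supp n order_refl)
      then have "u (v (Suc k) (e n)) = v (Suc k) (e n)"
        by (rule fixing_supp[OF u]) (use Cdisj[of 0 "Suc k"] C0 in auto)
      ultimately show ?thesis using a[OF n] by (simp add: gs)
    next
      case False
      then have "a (e m) = e m" using aX by (simp add: fixing_def)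
      then have L: "(u o\<^sub>L s o\<^sub>L a o\<^sub>L ginv s) (e n) = u (e n)" by (simp add: gs s(2) flip: m)
      show ?thesis
      proof (cases "n \<in> B")
        case True
        then show ?thesis using a[of n 0] L by (simp add: C0 v_simps)
      next
        case nB: False
        have "n \<notin> X"
        proof
          assume "n \<in> X"
          then obtain k where k: "n \<in> C k" by (auto simp: X_def)
          with nB C0 obtain k' where "k = Suc k'" by (cases k) auto
          with k m have "\<sigma> m \<in> \<sigma> ` C k'" by (simp add: CSuc)
          then have "m \<in> C k'" using \<open>bij \<sigma>\<close> by (auto simp: bij_def inj_def)
          then show False using False by (auto simp: X_def)
        qed
        then have "a (e n) = e n" "u (e n) = e n" using aX u nB by (auto simp: fixing_def)
        then show ?thesis using L by simp
      qed
    qed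
  qed (use uG s aG in auto)
  have "u = a o\<^sub>L s o\<^sub>L ginv a o\<^sub>L ginv s"
  proof (rule blinfun_eqI)
    fix x
    show "u x = (a o\<^sub>L s o\<^sub>L ginv a o\<^sub>L ginv s) x"
      using arg_cong[OF eq, of "\<lambda>k. blinfun_apply k (s (ginv a (ginv s x)))"] s(1) aG by simp
  qed
  moreover have "a \<in> fixing A" using aX fixing_mono[OF XA] by blast
  ultimately show ?thesis using sA by blast
qed

lemma sigma_syndetic_fixing:
  assumes W: "sigma_syndetic G W"
  shows "\<exists>B. infinite B \<and> infinite (- B) \<and> fixing B \<subseteq> wpow G W 12"
proof -
  obtain h where h: "\<And>n::nat. h n \<in> carrier G"
    and cov: "\<And>x. x \<in> carrier G \<Longrightarrow> \<exists>n. ginv (h n) o\<^sub>L x \<in> W"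
    using W unfolding sigma_syndetic_def G_mult by blast
  have sub: "W \<subseteq> carrier G" and sym: "\<And>x. x \<in> W \<Longrightarrow> ginv x \<in> W"
    using W by (auto simp: sigma_syndetic_def)
  have mult: "a o\<^sub>L b \<in> wpow G W (m + n)" if "a \<in> wpow G W m" "b \<in> wpow G W n" for a b m n
    using G.wpow_add[OF sub that] by simp
  have inv: "ginv a \<in> wpow G W m" if "a \<in> wpow G W m" for a m
    using G.wpow_inv[OF sub sym that] .
  have one: "a \<in> wpow G W 1" if "a \<in> W" for a
    using G.wpow_one[OF sub that] .
  define P where "P k = range (\<lambda>n. prod_encode (k, n))" for k
  have P_disj: "P k \<inter> P l = {}" if "k \<noteq> l" for k l
    using that by (auto simp: P_def)
  have P_UN: "(\<Union>k. P k) = UNIV"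
    unfolding P_def by (auto, metis prod_decode_inverse surj_pair range_eqI)
  obtain k where k: "\<And>u. u \<in> fixing (P k) \<Longrightarrow>
      \<exists>c \<in> fixing (UNIV - P k). \<exists>s\<in>W. \<exists>s'\<in>W. ginv s o\<^sub>L s' = u o\<^sub>L c"
    using fixing_diagonal[OF P_disj P_UN h cov] fixing_in_G by metis
  define X where "X = P k"
  have st1: "\<exists>c \<in> fixing (- X). u o\<^sub>L c \<in> wpow G W 2" if u: "u \<in> fixing X" for u
  proof -
    obtain c s s' where c: "c \<in> fixing (UNIV - P k)" "s \<in> W" "s' \<in> W" "ginv s o\<^sub>L s' = u o\<^sub>L c"
      using k[OF u[unfolded X_def]] by blast
    have "ginv s o\<^sub>L s' \<in> wpow G W (1 + 1)" by (intro mult inv one c)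
    then show ?thesis using c(1,4) by (auto simp: X_def Compl_eq_Diff_UNIV numeral_2_eq_2)
  qed
  define S where "S = wpow G W 2 \<inter> fixing X"
  \<comment> \<open>For a second run inside \<open>fixing X\<close> the translating elements must
    lie there. Each \<open>h n\<close> is replaced by a member of \<open>fixing X\<close> in its own
    translate, which turns \<open>W\<close> into \<open>W^2\<close>. A translate that misses
    \<open>fixing X\<close> takes no part in the covering; its \<open>h' n\<close> is set to the
    identity.\<close>
  define h' where "h' n = (if \<exists>v \<in> fixing X. ginv (h n) o\<^sub>L v \<in> W
    then SOME v. v \<in> fixing X \<and> ginv (h n) o\<^sub>L v \<in> W else id_blinfun)" for n
  have h'X: "h' n \<in> fixing X" for n
    unfolding h'_def by (auto intro: id_in_fixing someI2)
  have cov': "\<exists>n. ginv (h' n) o\<^sub>L u \<in> S" if u: "u \<in> fixing X" for u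
  proof -
    obtain n where n: "ginv (h n) o\<^sub>L u \<in> W" using cov fixing_in_G[OF u] by blast
    then have "ginv (h n) o\<^sub>L h' n \<in> W"
      unfolding h'_def using u by (auto intro: someI2)
    then have "ginv (ginv (h n) o\<^sub>L h' n) o\<^sub>L (ginv (h n) o\<^sub>L u) \<in> wpow G W (1 + 1)"
      by (intro mult inv one n)
    moreover have "ginv (ginv (h n) o\<^sub>L h' n) o\<^sub>L (ginv (h n) o\<^sub>L u) = ginv (h' n) o\<^sub>L u"
      using G.inv_mult_group[of "ginv (h n)" "h' n"] h[of n] fixing_in_G[OF h'X[of n]]
      by (intro blinfun_eqI) simp
    ultimately have "ginv (h' n) o\<^sub>L u \<in> S"
      using fixing_mult[OF fixing_ginv[OF h'X] u] by (simp add: S_def numeral_2_eq_2)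
    then show ?thesis by blast
  qed
  define A where "A j = (\<lambda>m. prod_encode (k, m)) ` P j" for j
  have A_disj: "A i \<inter> A j = {}" if "i \<noteq> j" for i j
    using P_disj[OF that] by (auto simp: A_def)
  have "(\<Union>j. A j) = (\<lambda>m. prod_encode (k, m)) ` (\<Union>j. P j)" by (auto simp: A_def)
  then have A_UN: "(\<Union>j. A j) = X" unfolding P_UN by (simp add: X_def P_def)
  obtain j where j: "\<And>u. u \<in> fixing (A j) \<Longrightarrow>
      \<exists>c \<in> fixing (X - A j). \<exists>s\<in>S. \<exists>s'\<in>S. ginv s o\<^sub>L s' = u o\<^sub>L c"
    using fixing_diagonal[OF A_disj A_UN fixing_in_G[OF h'X] cov'] by metis
  have AX: "A j \<subseteq> X" using A_UN by blast
  have st2: "\<exists>c \<in> fixing (X - A j). u o\<^sub>L c \<in> wpow G W 4" if u: "u \<in> fixing (A j)" for u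
  proof -
    obtain c s s' where c: "c \<in> fixing (X - A j)" "s \<in> S" "s' \<in> S" "ginv s o\<^sub>L s' = u o\<^sub>L c"
      using j[OF u] by blast
    have "ginv s o\<^sub>L s' \<in> wpow G W (2 + 2)" using c by (intro mult inv) (auto simp: S_def)
    then show ?thesis using c(1,4) by auto
  qed
  define \<psi> where "\<psi> n = prod_encode (k, prod_encode (j, n))" for n
  have \<psi>_inj: "inj \<psi>" by (simp add: \<psi>_def inj_def)
  have A_\<psi>: "A j = range \<psi>" by (simp add: A_def \<psi>_def P_def image_image)
  \<comment> \<open>Every second index of \<open>A j\<close>, so that \<open>A j - B\<close> stays
    infinite as the commutator lemma requires.\<close>
  define B where "B = range (\<lambda>n. \<psi> (2 * n))"
  have "infinite B"
    unfolding B_def by (rule range_inj_infinite) (simp add: \<psi>_def inj_def)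
  have "infinite (range (\<lambda>n. \<psi> (2 * n + 1)))"
    by (rule range_inj_infinite) (simp add: \<psi>_def inj_def)
  moreover have "\<psi> (2 * n + 1) \<notin> B" for n
    using \<psi>_inj by (auto simp: B_def inj_eq) presburger
  then have "range (\<lambda>n. \<psi> (2 * n + 1)) \<subseteq> A j - B" unfolding A_\<psi> by blast
  ultimately have "infinite (A j - B)" using finite_subset by blast
  moreover have "A j - B \<subseteq> - B" by auto
  ultimately have "infinite (- B)" using finite_subset by blast
  have "u \<in> wpow G W 12" if u: "u \<in> fixing B" for u
  proof -
    have "B \<subseteq> A j" by (auto simp: B_def A_\<psi>)
    then obtain a s where as: "a \<in> fixing (A j)" "s \<in> fixing (A j)"
      and u_eq: "u = a o\<^sub>L s o\<^sub>L ginv a o\<^sub>L ginv s"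
      using fixing_commutator[OF _ \<open>infinite B\<close> \<open>infinite (A j - B)\<close> u] by blast
    obtain c where c: "c \<in> fixing (- X)" "a o\<^sub>L c \<in> wpow G W 2"
      using st1[of a] as(1) fixing_mono[OF AX] by blast
    obtain d where d: "d \<in> fixing (X - A j)" "s o\<^sub>L d \<in> wpow G W 4"
      using st2[OF as(2)] by blast
    \<comment> \<open>Here the two runs pay off. \<open>c\<close> acts off \<open>X\<close> and so
      commutes with \<open>s\<close> and \<open>d\<close>; \<open>d\<close> acts on
      \<open>X - A j\<close> and so commutes with \<open>a\<close>. Both errors cancel in the
      commutator. After a single run both would act off the block, possibly on the same coordinates,
      and need not commute.\<close>
    have "(a o\<^sub>L c) o\<^sub>L ((s o\<^sub>L d) o\<^sub>L (ginv (a o\<^sub>L c) o\<^sub>L ginv (s o\<^sub>L d))) \<in> wpow G W (2 + (4 + (2 + 4)))"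
      by (intro mult inv c d)
    moreover have "(a o\<^sub>L c) o\<^sub>L ((s o\<^sub>L d) o\<^sub>L (ginv (a o\<^sub>L c) o\<^sub>L ginv (s o\<^sub>L d))) = u"
    proof (rule blinfun_eqI)
      fix x
      have G: "a \<in> carrier G" "s \<in> carrier G" "c \<in> carrier G" "d \<in> carrier G"
        using as c d fixing_in_G by blast+
      have iv: "ginv (a o\<^sub>L c) = ginv c o\<^sub>L ginv a" "ginv (s o\<^sub>L d) = ginv d o\<^sub>L ginv s"
        using G.inv_mult_group[of a c] G.inv_mult_group[of s d] G by simp_all
      have 1: "d (ginv c y) = ginv c (d y)" for y
        by (rule fixing_commute_app[OF d(1) fixing_ginv[OF c(1)]]) auto
      have 2: "d (ginv a y) = ginv a (d y)" for y
        by (rule fixing_commute_app[OF d(1) fixing_ginv[OF as(1)]]) auto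
      have 3: "s (ginv c y) = ginv c (s y)" for y
        by (rule fixing_commute_app[OF as(2) fixing_ginv[OF c(1)]]) (use AX in auto)
      show "((a o\<^sub>L c) o\<^sub>L ((s o\<^sub>L d) o\<^sub>L (ginv (a o\<^sub>L c) o\<^sub>L ginv (s o\<^sub>L d)))) x = u x"
        using G by (simp add: u_eq iv 1 2 3)
    qed
    ultimately show ?thesis by simp
  qed
  then show ?thesis using \<open>infinite B\<close> \<open>infinite (- B)\<close> by blast
qed

end

section \<open>Groups moving cofinitely many coordinates\<close>

context hilbert_basis
begin

text \<open>One vector \<open>v\<close> is treated at a time: each pair \<open>d (2 * n)\<close>,
  \<open>d (2 * n + 1)\<close> has a unit combination orthogonal to \<open>v\<close>, and disjoint
  pairs keep the combinations orthonormal. Conditions already achieved survive since they are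
  linear.\<close>

lemma ex_orthonormal_in_annihilator:
  fixes d :: "nat \<Rightarrow> 'a"
  assumes "finite V" "orthonormal UNIV d" "range d \<subseteq> supp B"
  shows "\<exists>d' :: nat \<Rightarrow> 'a. orthonormal UNIV d' \<and> range d' \<subseteq> supp B \<and> (\<forall>n. \<forall>v\<in>V. ip (d' n) v = 0)"
  using assms
proof (induction V rule: finite_induct)
  case empty
  then show ?case by auto
next
  case (insert v V)
  then obtain d :: "nat \<Rightarrow> 'a" where d: "orthonormal UNIV d" "range d \<subseteq> supp B" "\<And>n w. w \<in> V \<Longrightarrow> ip (d n) w = 0"
    by blast
  have dd: "ip (d i) (d j) = (if i = j then 1 else 0)" for i j
    using d(1) by (simp add: orthonormal_def)
  have "\<exists>x. ip x x = 1 \<and> ip x v = 0 \<and> (\<exists>a b. x = sc a (d (2 * n)) + sc b (d (2 * n + 1)))" for n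
  proof (cases "ip (d (2 * n)) v = 0")
    case True
    moreover have "d (2 * n) = sc 1 (d (2 * n)) + sc 0 (d (2 * n + 1))" by simp
    ultimately show ?thesis using dd[of "2 * n" "2 * n"] by metis
  next
    case False
    define y where "y = sc (ip (d (2 * n + 1)) v) (d (2 * n)) + sc (- ip (d (2 * n)) v) (d (2 * n + 1))"
    have yv: "ip y v = 0" by (simp add: y_def ip_add_left ip_diff_left ip_sc_left mult.commute)
    have "ip y (d (2 * n + 1)) \<noteq> 0" using False by (simp add: y_def ip_add_left ip_diff_left ip_sc_left dd)
    then have y0: "norm y \<noteq> 0" by auto
    have eq: "(1 / norm y) *\<^sub>R y = sc (of_real (1 / norm y) * ip (d (2 * n + 1)) v) (d (2 * n))
        + sc (of_real (1 / norm y) * (- ip (d (2 * n)) v)) (d (2 * n + 1))"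
      unfolding sc_of_real[symmetric] by (simp only: y_def scale_right_distrib scale_scale)
    have "ip ((1 / norm y) *\<^sub>R y) ((1 / norm y) *\<^sub>R y) = 1"
      using y0 by (simp add: ip_self power2_eq_square)
    moreover have "ip ((1 / norm y) *\<^sub>R y) v = 0" using yv by simp
    ultimately show ?thesis using eq by blast
  qed
  then obtain d' a b where d': "\<And>n. ip (d' n) (d' n) = 1" "\<And>n. ip (d' n) v = 0"
      "\<And>n. d' n = sc (a n) (d (2 * n)) + sc (b n) (d (2 * n + 1))"
    by metis
  have ne: "2 * m \<noteq> Suc (2 * n)" "Suc (2 * n) \<noteq> 2 * m" for m n :: nat by presburger+
  have "ip (d' m) (d' n) = 0" if "m \<noteq> n" for m n
    using that ne by (simp add: d'(3) ip_add_left ip_add_right ip_sc_left ip_sc_right dd)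
  then have "orthonormal UNIV d'" using d'(1) by (simp add: orthonormal_def)
  moreover have "ip (d' n) w = 0" if "w \<in> insert v V" for n w
    using that d'(2) d(3) by (cases "w = v") (auto simp: d'(3) ip_add_left ip_sc_left)
  moreover have "range d' \<subseteq> supp B"
  proof -
    have "d n \<in> supp B" for n using d(2) by blast
    then show ?thesis by (auto simp: supp_def d'(3) ip_add_left ip_sc_left)
  qed
  ultimately show ?case by blast
qed

lemma ex_unit_in_supp:
  assumes "infinite B" "finite V"
  shows "\<exists>x \<in> supp B. ip x x = 1 \<and> (\<forall>v\<in>V. ip x v = 0)"
proof -
  have inj: "inj (from_nat_into B)"
    using bij_betw_from_nat_into[of B] assms(1) by (simp add: bij_betw_def)
  have 1: "orthonormal UNIV (\<lambda>n. e (from_nat_into B n))"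
    using inj by (simp add: orthonormal_def ip_e inj_eq)
  have 2: "range (\<lambda>n. e (from_nat_into B n)) \<subseteq> supp B"
    using assms(1) from_nat_into[of B] by (auto intro!: e_in_supp)
  obtain d :: "nat \<Rightarrow> 'a" where d: "orthonormal UNIV d" "range d \<subseteq> supp B" "\<forall>n. \<forall>v\<in>V. ip (d n) v = 0"
    using ex_orthonormal_in_annihilator[OF assms(2) 1 2] by blast
  then show ?thesis by (intro bexI[of _ "d 0"]) (auto simp: orthonormal_def)
qed

text \<open>An isometric choice of images \<open>f n\<close> extends to a surjective isometry of
  \<open>supp B\<close> only if their complement has the right dimension. The family
  \<open>d\<close> certifies that it is infinite, hence matches the infinitely many remaining basis
  vectors.\<close>

lemma fixing_ex_map:
  fixes d :: "nat \<Rightarrow> 'a"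
  assumes A: "A \<subseteq> B" "infinite (B - A)"
    and f: "orthonormal A f" "\<And>n. n \<in> A \<Longrightarrow> f n \<in> supp B"
    and d: "orthonormal UNIV d" "\<And>n. d n \<in> supp B" "\<And>m n. n \<in> A \<Longrightarrow> ip (d m) (f n) = 0"
  shows "\<exists>h \<in> fixing B. \<forall>n\<in>A. h (e n) = f n"
proof -
  define Y where "Y = f ` A \<union> e ` (- B)"
  have "inj d"
  proof (rule injI)
    fix m n assume "d m = d n"
    then have "ip (d m) (d n) = 1" using d(1) by (simp add: orthonormal_def)
    then show "m = n" using d(1) by (simp add: orthonormal_def split: if_splits)
  qed
  have dr: "orthonormal (range d) id"
    using d(1) \<open>inj d\<close> by (auto simp: orthonormal_def inj_eq)
  have dY: "range d \<subseteq> {x. \<forall>y\<in>Y. ip x y = 0}"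
    using d(2,3) by (auto simp: Y_def supp_def)
  \<comment> \<open>An orthonormal basis of the complement of the \<open>f n\<close> in
    \<open>supp B\<close>; it is infinite because it contains \<open>range d\<close>, and will be
    the image of the \<open>e n\<close> with \<open>n \<in> B - A\<close>.\<close>
  obtain D where D: "range d \<subseteq> D" "orthonormal D id" "D \<subseteq> {x. \<forall>y\<in>Y. ip x y = 0}"
    and max': "\<forall>x. (\<forall>y\<in>Y. ip x y = 0) \<longrightarrow> (\<forall>d\<in>D. ip x d = 0) \<longrightarrow> x = 0"
    using orthonormal_ex_extension[OF dr dY] by (elim exE conjE)
  have max: "x = 0" if "\<forall>y\<in>Y. ip x y = 0" "\<forall>d\<in>D. ip x d = 0" for x
    using max' that by simp
  have "infinite D" using \<open>inj d\<close> D(1) range_inj_infinite finite_subset by blast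
  then have bD: "bij_betw (from_nat_into D) UNIV D"
    using bij_betw_from_nat_into[OF countable_orthonormal[OF D(2)]] by blast
  have "bij_betw (to_nat_on (B - A)) (B - A) UNIV" using A(2) by (simp add: to_nat_on_infinite)
  from bij_betw_trans[OF this bD] obtain \<beta> where \<beta>: "bij_betw \<beta> (B - A) D" by blast
  define g where "g n = (if n \<in> A then f n else if n \<in> B then \<beta> n else e n)" for n
  have gA: "g n = f n" if "n \<in> A" for n using that by (simp add: g_def)
  have gD: "g n = \<beta> n" "\<beta> n \<in> D" if "n \<in> B" "n \<notin> A" for n
    using that bij_betw_apply[OF \<beta>, of n] by (auto simp: g_def)
  have gB: "g n = e n" if "n \<notin> B" for n using that A(1) by (auto simp: g_def)
  have Df: "ip x (f n) = 0" "ip (f n) x = 0" if "x \<in> D" "n \<in> A" for x n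
    using that D(3) ip_eq_0_commute[of "f n" x] by (auto simp: Y_def)
  have De: "ip x (e n) = 0" "ip (e n) x = 0" if "x \<in> D" "n \<notin> B" for x n
    using that D(3) ip_eq_0_commute[of "e n" x] by (auto simp: Y_def)
  have fe: "ip (f m) (e n) = 0" "ip (e n) (f m) = 0" if "m \<in> A" "n \<notin> B" for m n
    using f(2)[OF that(1)] that(2) ip_eq_0_commute[of "e n" "f m"] by (auto simp: supp_def)
  have on: "orthonormal UNIV g"
    unfolding orthonormal_def
  proof (intro ballI)
    fix m n
    have \<beta>\<beta>: "ip (\<beta> m) (\<beta> n) = (if m = n then 1 else 0)" if "m \<in> B - A" "n \<in> B - A"
      using D(2) bij_betw_apply[OF \<beta> that(1)] bij_betw_apply[OF \<beta> that(2)]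
        bij_betw_imp_inj_on[OF \<beta>] that by (auto simp: orthonormal_def inj_on_def)
    consider "m \<in> A" | "m \<in> B - A" | "m \<notin> B" by blast
    then show "ip (g m) (g n) = (if m = n then 1 else 0)"
    proof cases
      case 1
      then show ?thesis using f(1) A(1) Df fe
        by (cases "n \<in> A"; cases "n \<in> B") (auto simp: gA gB gD orthonormal_def)
    next
      case 2
      then show ?thesis using A(1) Df De \<beta>\<beta>
        by (cases "n \<in> A"; cases "n \<in> B") (auto simp: gA gB gD)
    next
      case 3
      then show ?thesis using A(1) fe De
        by (cases "n \<in> A"; cases "n \<in> B") (auto simp: gA gB gD ip_e)
    qed
  qed
  have tot: "total g"
    unfolding total_def
  proof (intro allI impI max)
    fix x assume x: "\<forall>n. ip x (g n) = 0"
    show "\<forall>y\<in>Y. ip x y = 0"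
      unfolding Y_def using x gA gB by (auto; metis ComplD)
    show "\<forall>d\<in>D. ip x d = 0"
    proof
      fix z assume "z \<in> D"
      then obtain n where "n \<in> B - A" "z = \<beta> n" using \<beta> by (auto simp: bij_betw_def)
      then show "ip x z = 0" using x gD(1)[of n] by (metis DiffE)
    qed
  qed
  obtain h where "h \<in> carrier G" "\<And>n. h (e n) = g n"
    using G_ex_basis_map[OF orthonormal_e total_e on tot] by blast
  then show ?thesis using gA gB by (intro bexI[of _ h]) (auto simp: fixing_def)
qed

text \<open>The vectors \<open>z n\<close> are chosen in \<open>supp P\<close> so that the components of the \<open>g (z n)\<close> in \<open>supp B\<close>
  span a subspace of infinite codimension.\<close>

lemma ex_avoiding_sequences:
  assumes g: "g \<in> carrier G" and P: "infinite P" and B: "infinite B"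
  shows "\<exists>(z :: nat \<Rightarrow> 'a) (d :: nat \<Rightarrow> 'a). orthonormal UNIV z \<and> orthonormal UNIV d \<and>
    (\<forall>n. z n \<in> supp P) \<and> (\<forall>n. d n \<in> supp B) \<and> (\<forall>m n. ip (g (z m)) (d n) = 0)"
proof -
  define \<Phi> where "\<Phi> f n p \<longleftrightarrow> fst p \<in> supp P \<and> snd p \<in> supp B \<and> ip (fst p) (fst p) = 1 \<and>
      ip (snd p) (snd p) = 1 \<and> ip (g (fst p)) (snd p) = 0 \<and>
      (\<forall>m<n. ip (fst p) (fst (f m)) = 0 \<and> ip (snd p) (snd (f m)) = 0 \<and>
        ip (g (fst p)) (snd (f m)) = 0 \<and> ip (g (fst (f m))) (snd p) = 0)"
    for f :: "nat \<Rightarrow> 'a \<times> 'a" and n :: nat and p :: "'a \<times> 'a"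
  have "\<exists>f. \<forall>n. \<Phi> f n (f n)"
  proof (rule dependent_wf_choice[OF wf_less])
    fix f f' :: "nat \<Rightarrow> 'a \<times> 'a" and n :: nat and p
    assume "\<And>m. (m, n) \<in> {(m, n). m < n} \<Longrightarrow> f m = f' m"
    then show "\<Phi> f n p = \<Phi> f' n p" by (simp add: \<Phi>_def)
  next
    fix n :: nat and f :: "nat \<Rightarrow> 'a \<times> 'a"
    \<comment> \<open>Each new vector meets finitely many orthogonality conditions. \<open>z\<close>
      comes first and respects the earlier second components through \<open>ginv g\<close>;
      \<open>d\<close> then also has to avoid \<open>g z\<close>.\<close>
    obtain z where z: "z \<in> supp P" "ip z z = 1"
      "\<forall>v \<in> (\<lambda>m. fst (f m)) ` {..<n} \<union> (\<lambda>m. ginv g (snd (f m))) ` {..<n}. ip z v = 0"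
      using ex_unit_in_supp[OF P, of "(\<lambda>m. fst (f m)) ` {..<n} \<union> (\<lambda>m. ginv g (snd (f m))) ` {..<n}"]
      by auto
    obtain d where d: "d \<in> supp B" "ip d d = 1"
      "\<forall>v \<in> insert (g z) ((\<lambda>m. snd (f m)) ` {..<n} \<union> (\<lambda>m. g (fst (f m))) ` {..<n}). ip d v = 0"
      using ex_unit_in_supp[OF B, of "insert (g z) ((\<lambda>m. snd (f m)) ` {..<n} \<union> (\<lambda>m. g (fst (f m))) ` {..<n})"]
      by auto
    have "ip z (fst (f m)) = 0" "ip (g z) (snd (f m)) = 0" if "m < n" for m
      using z(3) that ip_ginv(2)[OF g, of z "snd (f m)"] by auto
    moreover have "ip d (snd (f m)) = 0" "ip (g (fst (f m))) d = 0" if "m < n" for m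
      using d(3) that ip_eq_0_commute[of d "g (fst (f m))"] by auto
    moreover have "ip (g z) d = 0" using d(3) ip_eq_0_commute[of d "g z"] by auto
    ultimately show "\<exists>p. \<Phi> f n p"
      using z(1,2) d(1,2) by (intro exI[of _ "(z, d)"]) (auto simp: \<Phi>_def)
  qed
  then obtain f where f: "\<And>n. \<Phi> f n (f n)" by blast
  define z where "z n = fst (f n)" for n
  define d where "d n = snd (f n)" for n
  have F: "z n \<in> supp P" "d n \<in> supp B" "ip (z n) (z n) = 1" "ip (d n) (d n) = 1" "ip (g (z n)) (d n) = 0"
    for n using f[of n] by (auto simp: \<Phi>_def z_def d_def)
  have F': "ip (z n) (z m) = 0" "ip (d n) (d m) = 0" "ip (g (z n)) (d m) = 0" "ip (g (z m)) (d n) = 0"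
    if "m < n" for m n using f[of n] that by (auto simp: \<Phi>_def z_def d_def)
  have F2: "ip (z m) (z n) = 0" "ip (d m) (d n) = 0" if "m \<noteq> n" for m n
    using that F'(1)[of m n] F'(1)[of n m] F'(2)[of m n] F'(2)[of n m]
      ip_eq_0_commute[of "z m" "z n"] ip_eq_0_commute[of "d m" "d n"]
    by (cases m n rule: linorder_cases; simp)+
  have F3: "ip (g (z m)) (d n) = 0" for m n
    using F(5)[of n] F'(3)[of n m] F'(4)[of m n] by (cases m n rule: linorder_cases) auto
  show ?thesis
    using F F2 F3 by (intro exI[of _ z] exI[of _ d]) (auto simp: orthonormal_def)
qed

text \<open>The aim is to cancel \<open>g\<close> on the coordinates in \<open>A - B\<close>. First
  \<open>h\<close> in \<open>fixing B\<close> sends the \<open>e n\<close> with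
  \<open>n \<in> B - A\<close> to vectors orthogonal to all \<open>g (z n)\<close>, so that
  \<open>y n = ginv h (g (z n))\<close> lies in \<open>supp A\<close>. Now \<open>z\<close> and
  \<open>y\<close> are both sequences in \<open>supp A\<close>, and elements \<open>q\<close>,
  \<open>p\<close> of \<open>fixing A\<close> can send the \<open>e n\<close> with
  \<open>n \<in> A - B\<close> to their terms. Then \<open>ginv p\<close>, \<open>ginv h\<close>,
  \<open>g\<close>, \<open>q\<close> compose to a map \<open>r\<close> fixing these
  \<open>e n\<close>, so \<open>r\<close> is in \<open>fixing B\<close>.\<close>

lemma fixing_Un:
  assumes inf: "infinite (A \<inter> B)" "infinite (A - B)" "infinite (B - A)" and g: "g \<in> fixing (A \<union> B)"
  shows "\<exists>p \<in> fixing B. \<exists>q \<in> fixing A. \<exists>r \<in> fixing B. \<exists>s \<in> fixing A. p o\<^sub>L (q o\<^sub>L (r o\<^sub>L s)) = g"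
proof -
  have gG: "g \<in> carrier G" using g by (rule fixing_in_G)
  have "infinite B" using inf(1) by auto
  obtain z d :: "nat \<Rightarrow> 'a" where z: "orthonormal UNIV z" "\<And>n. z n \<in> supp (A - B)"
    and d: "orthonormal UNIV d" "\<And>n. d n \<in> supp B"
    and zd: "\<And>m n. ip (g (z m)) (d n) = 0"
    using ex_avoiding_sequences[OF gG inf(2) \<open>infinite B\<close>] by blast
  have even_on: "orthonormal C (\<lambda>n. x (2 * to_nat_on C n))" if "orthonormal UNIV x" "infinite C"
    for x and C :: "nat set"
    using that bij_betw_imp_inj_on[OF to_nat_on_infinite[of C]]
    by (auto simp: orthonormal_def inj_on_def)
  have odd_on: "orthonormal UNIV (\<lambda>n. x (2 * n + 1))" if "orthonormal UNIV x" for x :: "nat \<Rightarrow> 'a"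
    using that by (auto simp: orthonormal_def)
  have even_odd: "ip (x (2 * m + 1)) (x (2 * n)) = 0" if "orthonormal UNIV x" for m n and x :: "nat \<Rightarrow> 'a"
  proof -
    have "2 * m + 1 \<noteq> 2 * n" by presburger
    then show ?thesis using that by (simp add: orthonormal_def)
  qed
  have BA: "B - (B - A) = A \<inter> B" by auto
  \<comment> \<open>Even-numbered terms of a sequence are used as images, here and for
    \<open>p\<close> and \<open>q\<close>; the odd-numbered ones witness the infinite complement
    that \<open>fixing_ex_map\<close> asks for.\<close>
  obtain h where h: "h \<in> fixing B" "\<And>n. n \<in> B - A \<Longrightarrow> h (e n) = d (2 * to_nat_on (B - A) n)"
    using fixing_ex_map[of "B - A" B "\<lambda>n. d (2 * to_nat_on (B - A) n)" "\<lambda>n. d (2 * n + 1)"]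
      even_on[OF d(1) inf(3)] odd_on[OF d(1)] even_odd[OF d(1)] d(2) inf(1) BA by auto
  have hG: "h \<in> carrier G" using h(1) by (rule fixing_in_G)
  define y where "y n = ginv h (g (z n))" for n
  have y_on: "orthonormal UNIV y"
    using z(1) gG hG by (simp add: orthonormal_def y_def ip_ginv G_ip)
  have y_supp: "y n \<in> supp A" for n
    unfolding supp_def
  proof (intro CollectI allI impI)
    fix m assume m: "m \<notin> A"
    show "ip (y n) (e m) = 0"
    proof (cases "m \<in> B")
      case True
      then show ?thesis using h(2)[of m] m zd hG by (simp add: y_def ip_ginv)
    next
      case False
      then have "h (e m) = e m" "g (e m) = e m" using h(1) g m by (auto simp: fixing_def)
      then have "ip (y n) (e m) = ip (g (z n)) (g (e m))" using hG by (simp add: y_def ip_ginv)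
      then show ?thesis using z(2)[of n] m gG by (auto simp: G_ip supp_def)
    qed
  qed
  have zA: "z n \<in> supp A" for n using z(2) supp_mono[of "A - B" A] by blast
  have AB: "A - (A - B) = A \<inter> B" by auto
  obtain p where p: "p \<in> fixing A" "\<And>n. n \<in> A - B \<Longrightarrow> p (e n) = y (2 * to_nat_on (A - B) n)"
    using fixing_ex_map[of "A - B" A "\<lambda>n. y (2 * to_nat_on (A - B) n)" "\<lambda>n. y (2 * n + 1)"]
      even_on[OF y_on inf(2)] odd_on[OF y_on] even_odd[OF y_on] y_supp inf(1) AB by auto
  obtain q where q: "q \<in> fixing A" "\<And>n. n \<in> A - B \<Longrightarrow> q (e n) = z (2 * to_nat_on (A - B) n)"
    using fixing_ex_map[of "A - B" A "\<lambda>n. z (2 * to_nat_on (A - B) n)" "\<lambda>n. z (2 * n + 1)"]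
      even_on[OF z(1) inf(2)] odd_on[OF z(1)] even_odd[OF z(1)] zA inf(1) AB by auto
  have pG: "p \<in> carrier G" "q \<in> carrier G" using p(1) q(1) by (auto intro: fixing_in_G)
  define r where "r = ginv p o\<^sub>L (ginv h o\<^sub>L (g o\<^sub>L q))"
  have "r (e n) = e n" if n: "n \<notin> B" for n
  proof (cases "n \<in> A")
    case True
    then show ?thesis
      using n p(2)[of n] q(2)[of n] pG G_eq_ginv_iff[OF pG(1)] by (simp add: r_def flip: y_def)
  next
    case False
    then have "q (e n) = e n" "g (e n) = e n" "h (e n) = e n" "p (e n) = e n"
      using n p(1) q(1) h(1) g by (auto simp: fixing_def)
    then show ?thesis using G_eq_ginv_iff[OF hG] G_eq_ginv_iff[OF pG(1)] by (simp add: r_def)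
  qed
  then have "r \<in> fixing B" using pG hG gG by (simp add: fixing_def r_def)
  moreover have "h o\<^sub>L (p o\<^sub>L (r o\<^sub>L ginv q)) = g"
    using pG hG by (intro blinfun_eqI) (simp add: r_def)
  ultimately show ?thesis using h(1) p(1) fixing_ginv[OF q(1)] by blast
qed

end

text \<open>Branches of the binary tree: \<open>c R n\<close> codes the first \<open>n\<close> bits
  of the characteristic function of \<open>R\<close>, and distinct branches share only a finite
  initial part. The factor 2 keeps all odd numbers free, which makes the complements of the unions
  infinite.\<close>

lemma almost_disjoint_family:
  "\<exists>A :: nat set \<Rightarrow> nat set. (\<forall>R. infinite (A R)) \<and> (\<forall>R S. R \<noteq> S \<longrightarrow> finite (A R \<inter> A S)) \<and>
    (\<forall>R S. infinite (- (A R \<union> A S)))"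
proof -
  define c where "c R n = 2 * to_nat (map (\<lambda>i. i \<in> R) [0..<n])" for R :: "nat set" and n
  have c_eq: "m = n \<and> (\<forall>i<n. i \<in> R \<longleftrightarrow> i \<in> S)" if "c R m = c S n" for R S m n
  proof -
    have eq: "map (\<lambda>i. i \<in> R) [0..<m] = map (\<lambda>i. i \<in> S) [0..<n]" using that by (simp add: c_def)
    then have "m = n" by (metis length_map length_upt diff_zero)
    with eq show ?thesis by auto
  qed
  define A where "A R = range (c R)" for R
  have "infinite (A R)" for R
    unfolding A_def by (rule range_inj_infinite) (use c_eq in \<open>auto simp: inj_def\<close>)
  moreover have "finite (A R \<inter> A S)" if RS: "R \<noteq> S" for R S
  proof -
    have "\<exists>k. (k \<in> R) \<noteq> (k \<in> S)" using RS by (simp add: set_eq_iff)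
    then obtain k where k: "(k \<in> R) \<noteq> (k \<in> S)" ..
    have "A R \<inter> A S \<subseteq> c R ` {..k}"
    proof
      fix x assume "x \<in> A R \<inter> A S"
      then obtain m n where x: "x = c R m" and mn: "c R m = c S n" by (auto simp: A_def)
      have "m = n" "\<forall>i<n. i \<in> R \<longleftrightarrow> i \<in> S" using c_eq[OF mn] by simp_all
      then have "m \<le> k" using k by (metis not_le_imp_less)
      then show "x \<in> c R ` {..k}" using x by simp
    qed
    then show ?thesis using finite_subset by blast
  qed
  moreover have "infinite (- (A R \<union> A S))" for R S
  proof -
    have "range (\<lambda>n. 2 * n + 1) \<subseteq> - (A R \<union> A S)"
    proof
      fix x :: nat assume "x \<in> range (\<lambda>n. 2 * n + 1)"
      then have "odd x" by auto
      then show "x \<in> - (A R \<union> A S)" by (auto simp: A_def c_def)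
    qed
    moreover have "infinite (range (\<lambda>n :: nat. 2 * n + 1))"
      by (rule range_inj_infinite) (simp add: inj_def)
    ultimately show ?thesis using finite_subset by blast
  qed
  ultimately show ?thesis by blast
qed

lemma uncountable_nat_set: "uncountable (UNIV :: nat set set)"
proof
  assume "countable (UNIV :: nat set set)"
  then obtain f :: "nat set \<Rightarrow> nat" where "inj f" by (auto simp: countable_def)
  then have "surj (inv_into UNIV f)" by (rule inj_imp_surj_inv)
  then show False using Cantors_theorem[of UNIV] by auto
qed

lemma bij_between_moieties:
  fixes X B :: "nat set"
  assumes "infinite X" "infinite (- X)" "infinite B" "infinite (- B)"
  shows "\<exists>\<sigma>. bij \<sigma> \<and> \<sigma> ` X = B"
proof -
  have ex: "\<exists>f. bij_betw f X B" if "infinite X" "infinite B" for X B :: "nat set"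
    using bij_betw_trans[OF to_nat_on_infinite[of X] bij_betw_from_nat_into[of B]] that by auto
  obtain f where f: "bij_betw f X B" using ex assms by blast
  obtain f' where f': "bij_betw f' (- X) (- B)" using ex assms by blast
  have "bij_betw (\<lambda>n. if n \<in> X then f n else f' n) (X \<union> - X) (B \<union> - B)"
    using f f' by (intro bij_betw_disjoint_Un) auto
  moreover have "(\<lambda>n. if n \<in> X then f n else f' n) ` X = B"
    using f by (auto simp: bij_betw_def)
  ultimately show ?thesis by (intro exI[of _ "\<lambda>n. if n \<in> X then f n else f' n"]) simp
qed

context hilbert_basis
begin

text \<open>Permutations \<open>g R\<close> conjugate \<open>fixing X\<close> to
  \<open>fixing (- A R)\<close>, one for each of uncountably many \<open>R\<close>, but each bound
  is relative to \<open>W\<close> conjugated by its own \<open>g R\<close>. The pigeonhole provides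
  \<open>r\<close> and \<open>s\<close> for which one conjugate of \<open>W\<close> serves both; the
  union of the complements misses only \<open>A r \<inter> A s\<close>, which is finite.\<close>

lemma sigma_syndetic_fixing_cofinite:
  assumes W: "sigma_syndetic G W"
  shows "\<exists>g \<in> carrier G. \<exists>F. finite F \<and>
    fixing (- F) \<subseteq> wpow G ((\<lambda>x. g o\<^sub>L x o\<^sub>L ginv g) ` W) 56"
proof -
  have sub: "W \<subseteq> carrier G" using W by (simp add: sigma_syndetic_def)
  obtain X where X: "infinite X" "infinite (- X)" "fixing X \<subseteq> wpow G W 12"
    using sigma_syndetic_fixing[OF W] by blast
  obtain A :: "nat set \<Rightarrow> nat set" where A: "\<And>R. infinite (A R)"
      "\<And>R S. R \<noteq> S \<Longrightarrow> finite (A R \<inter> A S)" "\<And>R S. infinite (- (A R \<union> A S))"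
    using almost_disjoint_family by blast
  have "\<exists>\<sigma>. bij \<sigma> \<and> \<sigma> ` X = - A R" for R
  proof (rule bij_between_moieties)
    show "infinite (- A R)" using A(3)[of R R] by simp
  qed (use X A in auto)
  then obtain \<sigma> where \<sigma>: "\<And>R. bij (\<sigma> R)" "\<And>R. \<sigma> R ` X = - A R" by metis
  obtain g where g: "\<And>R. g R \<in> carrier G" "\<And>R n. g R (e n) = e (\<sigma> R n)"
    using ex_perm[OF \<sigma>(1)] by metis
  obtain r s where rs: "r \<noteq> s" "ginv (g r) o\<^sub>L g s \<in> wpow G W 2"
    using G.sigma_syndetic_pigeonhole[OF W uncountable_nat_set, of g] g(1) by auto
  define W' where "W' = (\<lambda>x. g r o\<^sub>L x o\<^sub>L ginv (g r)) ` W"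
  have W': "sigma_syndetic G W'"
    using G.sigma_syndetic_conj[OF W g(1)[of r]] by (simp add: W'_def)
  have sub': "W' \<subseteq> carrier G" and sym': "\<And>x. x \<in> W' \<Longrightarrow> ginv x \<in> W'"
    using W' by (auto simp: sigma_syndetic_def)
  have mult: "a o\<^sub>L b \<in> wpow G W' (m + n)" if "a \<in> wpow G W' m" "b \<in> wpow G W' n" for a b m n
    using G.wpow_add[OF sub' that] by simp
  have inv: "ginv a \<in> wpow G W' m" if "a \<in> wpow G W' m" for a m
    using G.wpow_inv[OF sub' sym' that] .
  have conj: "g r o\<^sub>L a o\<^sub>L ginv (g r) \<in> wpow G W' m" if "a \<in> wpow G W m" for a m
    using G.wpow_conj[OF sub g(1)[of r] that] by (simp add: W'_def)
  have preimage: "\<exists>v \<in> fixing X. u = g R o\<^sub>L v o\<^sub>L ginv (g R)" if u: "u \<in> fixing (- A R)" for u R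
  proof
    have bi: "bij (inv_into UNIV (\<sigma> R))" using \<sigma>(1) by (rule bij_imp_bij_inv)
    have im: "inv_into UNIV (\<sigma> R) ` (- A R) = X"
      using \<sigma>(2)[of R] \<sigma>(1)[of R] by (metis bij_is_inj image_inv_f_f)
    have "ginv (g R) o\<^sub>L u o\<^sub>L ginv (ginv (g R)) \<in> fixing (inv_into UNIV (\<sigma> R) ` (- A R))"
      using g(1)[of R] ginv_perm[OF g(1)[of R] g(2) \<sigma>(1)] u bi by (intro fixing_conj) auto
    then show "ginv (g R) o\<^sub>L u o\<^sub>L g R \<in> fixing X" using im g(1)[of R] by simp
    show "u = g R o\<^sub>L (ginv (g R) o\<^sub>L u o\<^sub>L g R) o\<^sub>L ginv (g R)"
      using g(1)[of R] by (intro blinfun_eqI) simp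
  qed
  have 1: "u \<in> wpow G W' 12" if u: "u \<in> fixing (- A r)" for u
    using preimage[OF u] conj X(3) by blast
  have 2: "u \<in> wpow G W' 16" if u: "u \<in> fixing (- A s)" for u
  proof -
    obtain v where v: "v \<in> fixing X" "u = g s o\<^sub>L v o\<^sub>L ginv (g s)"
      using preimage[OF u] by blast
    \<comment> \<open>This is \<open>g s\<close> times the inverse of \<open>g r\<close>, written as
      a conjugate to exhibit it in the second power of \<open>W'\<close>. Conjugation by it turns
      the \<open>g r\<close>-conjugate of \<open>v\<close> into the
      \<open>g s\<close>-conjugate.\<close>
    define w where "w = g r o\<^sub>L (ginv (g r) o\<^sub>L g s) o\<^sub>L ginv (g r)"
    define v' where "v' = g r o\<^sub>L v o\<^sub>L ginv (g r)"
    have w: "w \<in> wpow G W' 2" unfolding w_def by (rule conj[OF rs(2)])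
    have v': "v' \<in> wpow G W' 12" unfolding v'_def using v X(3) conj by blast
    have wG: "w \<in> carrier G" using g(1) by (simp add: w_def)
    have iw: "ginv w (g s x) = g r x" for x
      using G_eq_ginv_iff[OF wG, of "g r x" "g s x"] g(1) by (simp add: w_def)
    have "w o\<^sub>L (v' o\<^sub>L ginv w) = u"
    proof (rule blinfun_eqI)
      fix x
      obtain x' where x': "x = g s x'" using ginv_app(1)[OF g(1)[of s]] by metis
      show "(w o\<^sub>L (v' o\<^sub>L ginv w)) x = u x"
        using g(1) by (simp add: x' iw) (simp add: v'_def w_def v(2))
    qed
    moreover have "w o\<^sub>L (v' o\<^sub>L ginv w) \<in> wpow G W' (2 + (12 + 2))"
      by (intro mult inv w v')
    ultimately show ?thesis by simp
  qed
  define F where "F = A r \<inter> A s"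
  have F: "- A r \<union> - A s = - F" by (auto simp: F_def)
  have "u \<in> wpow G W' 56" if u: "u \<in> fixing (- F)" for u
  proof -
    have i1: "infinite (- A r \<inter> - A s)" using A(3)[of r s] by simp
    have diff: "infinite (- A r' - - A s')" if "r' \<noteq> s'" for r' s'
    proof -
      have "A s' \<subseteq> (- A r' - - A s') \<union> (A r' \<inter> A s')" by auto
      then show ?thesis using A(1)[of s'] A(2)[OF that] by (meson finite_UnI finite_subset)
    qed
    obtain p q t v where "p \<in> fixing (- A s)" "q \<in> fixing (- A r)" "t \<in> fixing (- A s)"
        "v \<in> fixing (- A r)" and eq: "p o\<^sub>L (q o\<^sub>L (t o\<^sub>L v)) = u"
      using fixing_Un[OF i1 diff[OF rs(1)] diff[OF rs(1)[symmetric]]] u F by metis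
    then have "p o\<^sub>L (q o\<^sub>L (t o\<^sub>L v)) \<in> wpow G W' (16 + (12 + (16 + 12)))"
      by (intro mult 1 2)
    then show ?thesis by (simp add: eq)
  qed
  then have "finite F \<and> fixing (- F) \<subseteq> wpow G W' 56" using A(2)[OF rs(1)] by (auto simp: F_def)
  then show ?thesis unfolding W'_def using g(1) by (intro bexI[of _ "g r"] exI[of _ F])
qed

end

section \<open>Double cosets of a rotation\<close>

context hilbert
begin

lemma ip_sum_orthonormal:
  assumes "orthonormal I d" "finite A" "A \<subseteq> I"
  shows "ip (\<Sum>p\<in>A. sc (a p) (d p)) (\<Sum>p\<in>A. sc (b p) (d p)) = (\<Sum>p\<in>A. a p * cj (b p))"
proof -
  have "ip (\<Sum>p\<in>A. sc (a p) (d p)) (\<Sum>p\<in>A. sc (b p) (d p))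
      = (\<Sum>p\<in>A. a p * (\<Sum>q\<in>A. cj (b q) * ip (d p) (d q)))"
    by (simp add: ip_sum_left ip_sc_left) (simp add: ip_sum_right ip_sc_right)
  also have "\<dots> = (\<Sum>p\<in>A. a p * (\<Sum>q\<in>A. if p = q then cj (b q) else 0))"
    using assms by (intro sum.cong refl arg_cong2[where f = "(*)"]) (auto simp: orthonormal_def subset_iff)
  also have "\<dots> = (\<Sum>p\<in>A. a p * cj (b p))"
    using assms(2) by simp
  finally show ?thesis .
qed

text \<open>The off-diagonal entry at \<open>(i, j)\<close> is produced by a vector \<open>d (i, j)\<close> common to the \<open>i\<close>-th and the
  \<open>j\<close>-th member of the family; \<open>d (i, i)\<close> then corrects the length.\<close>

lemma ex_family_of_Gram:
  fixes E :: "nat \<Rightarrow> nat \<Rightarrow> 'f" and d :: "nat \<times> nat \<Rightarrow> 'a"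
  assumes d: "orthonormal UNIV d" and \<kappa>: "\<kappa> > 0"
    and off: "\<And>i j. i < N \<Longrightarrow> j < N \<Longrightarrow> i \<noteq> j \<Longrightarrow> norm (E i j) \<le> \<kappa>\<^sup>2"
    and herm: "\<And>i j. E j i = cj (E i j)"
    and diag: "\<And>i. i < N \<Longrightarrow> E i i = of_real (\<rho> i)"
    and dom: "\<And>i. i < N \<Longrightarrow> (real N)\<^sup>2 * \<kappa>\<^sup>2 \<le> \<rho> i"
  shows "\<exists>v. (\<forall>i<N. \<forall>j<N. ip (v i) (v j) = E i j) \<and>
    (\<forall>i x. (\<forall>p. ip (d p) x = 0) \<longrightarrow> ip (v i) x = 0)"
proof -
  \<comment> \<open>On the coordinate \<open>(i, j)\<close> with \<open>i < j\<close> only members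
    \<open>i\<close> and \<open>j\<close> are nonzero, with entries \<open>E i j / \<kappa>\<close>
    and \<open>\<kappa>\<close>, so that their inner product is \<open>E i j\<close>. The bound on
    \<open>E\<close> keeps both at most \<open>\<kappa>\<close> in norm; the total spent is then at
    most \<open>N * N\<close> times the square of \<open>\<kappa>\<close>, and \<open>\<tau>\<close>
    is the squared length still missing.\<close>
  define co where "co i p = (if fst p < snd p then if i = fst p then E (fst p) (snd p) / of_real \<kappa>
      else if i = snd p then of_real \<kappa> else 0 else 0)" for i :: nat and p :: "nat \<times> nat"
  define P where "P = {..<N} \<times> {..<N}"
  define u where "u i = (\<Sum>p\<in>P. sc (co i p) (d p))" for i
  define \<tau> where "\<tau> i = \<rho> i - (\<Sum>p\<in>P. (norm (co i p))\<^sup>2)" for i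
  define v where "v i = u i + sqrt (\<tau> i) *\<^sub>R d (i, i)" for i
  have dd: "ip (d p) (d q) = (if p = q then 1 else 0)" for p q
    using d unfolding orthonormal_def by blast
  have uu: "ip (u i) (u j) = (\<Sum>p\<in>P. co i p * cj (co j p))" for i j
    unfolding u_def by (rule ip_sum_orthonormal[OF d]) (auto simp: P_def)
  have ud: "ip (u i) (d (j, j)) = 0" for i j
    unfolding u_def ip_sum_left ip_sc_left by (rule sum.neutral) (auto simp: dd co_def)
  then have du: "ip (d (j, j)) (u i) = 0" for i j
    using ip_eq_0_commute by blast
  have \<tau>: "\<tau> i \<ge> 0" if i: "i < N" for i
  proof -
    have "norm (co i p) \<le> \<kappa>" if "p \<in> P" for p
      using off[of "fst p" "snd p"] that \<kappa>
      by (auto simp: co_def P_def norm_divide divide_le_eq power2_eq_square)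
    then have "(norm (co i p))\<^sup>2 \<le> \<kappa>\<^sup>2" if "p \<in> P" for p
      using that by (simp add: power_mono)
    then have "(\<Sum>p\<in>P. (norm (co i p))\<^sup>2) \<le> of_nat (card P) * \<kappa>\<^sup>2"
      by (rule sum_bounded_above)
    also have "\<dots> = (real N)\<^sup>2 * \<kappa>\<^sup>2" by (simp add: P_def power2_eq_square)
    finally show ?thesis using dom[OF i] by (simp add: \<tau>_def)
  qed
  have less: "ip (v i) (v j) = E i j" if ij: "i < N" "j < N" "i < j" for i j
  proof -
    have "ip (v i) (v j) = ip (u i) (u j)"
      using ij by (simp add: v_def ip_add_left ip_add_right ud du dd)
    also have "\<dots> = (\<Sum>p\<in>P. if p = (i, j) then E i j else 0)"
      unfolding uu using ij \<kappa> by (intro sum.cong refl) (auto simp: co_def)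
    also have "\<dots> = E i j" using ij by (simp add: P_def)
    finally show ?thesis .
  qed
  have eq: "ip (v i) (v i) = E i i" if i: "i < N" for i
  proof -
    have "ip (v i) (v i) = ip (u i) (u i) + of_real (sqrt (\<tau> i)) * of_real (sqrt (\<tau> i))"
      by (simp add: v_def ip_add_left ip_add_right ud du dd)
    also have "ip (u i) (u i) = of_real (\<Sum>p\<in>P. (norm (co i p))\<^sup>2)"
      by (simp add: uu mult_cj)
    also have "of_real (sqrt (\<tau> i)) * of_real (sqrt (\<tau> i)) = (of_real (\<tau> i) :: 'f)"
      using \<tau>[OF i] by (simp flip: of_real_mult)
    finally show ?thesis by (simp add: diag[OF i] \<tau>_def del: of_real_sum)
  qed
  have "ip (v i) (v j) = E i j" if ij: "i < N" "j < N" for i j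
  proof (cases i j rule: linorder_cases)
    case less
    then show ?thesis using ij by (intro \<open>\<And>i j. i < N \<Longrightarrow> j < N \<Longrightarrow> i < j \<Longrightarrow> ip (v i) (v j) = E i j\<close>)
  next
    case equal
    then show ?thesis using eq ij by simp
  next
    case greater
    then show ?thesis using less[of j i] ij ip_commute[of "v i" "v j"] herm[of j i] by simp
  qed
  moreover have "ip (v i) x = 0" if "\<forall>p. ip (d p) x = 0" for i x
  proof -
    have "ip (d p) x = 0" for p using that by blast
    then show ?thesis by (simp add: v_def u_def ip_add_left ip_sum_left ip_sc_left)
  qed
  ultimately show ?thesis by blast
qed

end

section \<open>Rotations and the neighbourhood of the identity\<close>

context hilbert_basis
begin

lemma ex_rotation:
  "\<exists>R \<in> carrier G. \<forall>i<N. R (e i) = cos t *\<^sub>R e i + sin t *\<^sub>R e (N + i) \<and>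
     R (e (N + i)) = (- sin t) *\<^sub>R e i + cos t *\<^sub>R e (N + i)"
proof -
  define c :: 'f where "c = of_real (cos t)"
  define s :: 'f where "s = of_real (sin t)"
  have cs: "c * c + s * s = 1"
    using sin_cos_squared_add2[of t] by (simp add: c_def s_def power2_eq_square flip: of_real_mult of_real_add)
  have cjc: "cj c = c" "cj s = s" by (simp_all add: c_def s_def)
  define f where "f n = (if n < N then sc c (e n) + sc s (e (N + n))
      else if n < 2 * N then sc (- s) (e (n - N)) + sc c (e n) else e n)" for n
  have f1: "f i = sc c (e i) + sc s (e (N + i))" and f2: "f (N + i) = sc (- s) (e i) + sc c (e (N + i))"
    if "i < N" for i using that by (simp_all add: f_def)
  have f3: "f n = e n" if "2 * N \<le> n" for n using that by (simp add: f_def)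
  have split: "n < N \<or> (\<exists>i<N. n = N + i) \<or> 2 * N \<le> n" for n :: nat
    by presburger
  have on: "orthonormal UNIV f"
    unfolding orthonormal_def
  proof (intro ballI)
    fix m n
    show "ip (f m) (f n) = (if m = n then 1 else 0)"
      using split[of m] split[of n] cs
      by (elim disjE exE conjE; simp only: f1 f2 f3)
        (simp_all add: ip_add_left ip_add_right ip_diff_left ip_diff_right ip_sc_left ip_sc_right
          ip_e cjc add.commute mult.commute)
  qed
  have tot: "total f"
    unfolding total_def
  proof (intro allI impI)
    fix x assume x: "\<forall>n. ip x (f n) = 0"
    have 1: "ip x (e i) = 0 \<and> ip x (e (N + i)) = 0" if i: "i < N" for i
    proof -
      define a where "a = ip x (e i)"
      define b where "b = ip x (e (N + i))"
      have 1: "c * a + s * b = 0" using x[rule_format, of i] i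
        by (simp add: f_def a_def b_def ip_add_right ip_sc_right cjc)
      have 2: "c * b = s * a" using x[rule_format, of "N + i"] i
        by (simp add: f_def a_def b_def ip_diff_right ip_sc_right cjc)
      have "(c * c + s * s) * a = c * (c * a + s * b) + (s * (s * a) - s * (c * b))"
        by (simp add: algebra_simps)
      then have "a = 0" by (simp add: cs 1 2)
      moreover have "(c * c + s * s) * b = s * (c * a + s * b) + (c * (c * b) - c * (s * a))"
        by (simp add: algebra_simps)
      then have "b = 0" by (simp add: cs 1 2)
      ultimately show ?thesis by (simp add: a_def b_def)
    qed
    have "ip x (e n) = ip 0 (e n)" for n
    proof -
      consider "n < N" | "N \<le> n" "n < 2 * N" | "n \<ge> 2 * N" by linarith
      then show ?thesis
      proof cases
        case 2
        then show ?thesis using 1[of "n - N"] by simp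
      next
        case 3
        then show ?thesis using x[rule_format, of n] by (simp add: f_def)
      qed (use 1 in auto)
    qed
    then show "x = 0" by (rule eq_if_ip_e)
  qed
  obtain R where R: "R \<in> carrier G" "\<And>n. R (e n) = f n"
    using G_ex_basis_map[OF orthonormal_e total_e on tot] by blast
  have "f i = cos t *\<^sub>R e i + sin t *\<^sub>R e (N + i)"
    "f (N + i) = (- sin t) *\<^sub>R e i + cos t *\<^sub>R e (N + i)" if "i < N" for i
    using that by (simp_all add: f_def c_def s_def sc_of_real)
  then show ?thesis using R by (intro bexI[of _ R]) simp_all
qed

lemma G_scaleR: "U \<in> carrier G \<Longrightarrow> U (r *\<^sub>R x) = r *\<^sub>R U x"
  by (simp add: blinfun.scaleR_right)

text \<open>Fixing the \<open>e j\<close> is obtained by adjoining them to both families; the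
  boolean tag distinguishes the two kinds of vectors.\<close>

lemma fixing_ex_map_of_Gram_eq:
  assumes xx: "\<And>i j. i < N \<Longrightarrow> j < N \<Longrightarrow> ip (x i) (x j) = ip (y i) (y j)"
    and xe: "\<And>i j. i < N \<Longrightarrow> j < N \<Longrightarrow> ip (x i) (e j) = ip (y i) (e j)"
  shows "\<exists>k \<in> fixing (- {..<N}). \<forall>i<N. k (x i) = y i"
proof -
  have "ip (e j) (x i) = ip (e j) (y i)" if "i < N" "j < N" for i j
    using xe[OF that] ip_commute[of "e j"] by metis
  then have ex: "ip (e j) (x i) = ip (e j) (y i)" if "i < N" "j < N" for i j using that by blast
  define X where "X p = (if fst p then x (snd p) else e (snd p))" for p
  define Y where "Y p = (if fst p then y (snd p) else e (snd p))" for p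
  have "ip (X p) (X q) = ip (Y p) (Y q)" if "p \<in> UNIV \<times> {..<N}" "q \<in> UNIV \<times> {..<N}" for p q
    using xx xe ex that by (auto simp: X_def Y_def)
  then obtain k where k: "k \<in> carrier G" "\<And>p. p \<in> UNIV \<times> {..<N} \<Longrightarrow> k (X p) = Y p"
    using G_ex_map_of_Gram_eq[of "UNIV \<times> {..<N}" X Y] by auto
  have "k (x i) = y i" "k (e i) = e i" if "i < N" for i
    using k(2)[of "(True, i)"] k(2)[of "(False, i)"] that by (auto simp: X_def Y_def)
  then show ?thesis using k(1) by (intro bexI[of _ k]) (auto simp: fixing_def)
qed

text \<open>It suffices to find orthonormal \<open>f i\<close> with
  \<open>ip (f i) (e j) = ip (g (e i)) (e j)\<close> and
  \<open>ip (f i) (w (e j)) = ip (e i) (w (e j))\<close>. By the first some \<open>k\<close> fixing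
  the \<open>e j\<close> carries \<open>g (e i)\<close> to \<open>f i\<close>; by the second some
  \<open>k'\<close> fixing the \<open>e j\<close> carries \<open>ginv w (e i)\<close> to
  \<open>ginv w (f i)\<close>; what is left of \<open>g\<close> then fixes the
  \<open>e i\<close>.\<close>

lemma double_coset_if_near:
  fixes c s :: real
  assumes w: "w \<in> carrier G" "\<And>i. i < N \<Longrightarrow> w (e i) = c *\<^sub>R e i + s *\<^sub>R e (N + i)"
    and cs: "c\<^sup>2 + s\<^sup>2 = 1" and s: "s \<noteq> 0" and g: "g \<in> carrier G"
    and near: "\<And>i j. i < N \<Longrightarrow> j < N \<Longrightarrow>
      norm (ip (g (e i)) (e j) - (if i = j then of_real (c\<^sup>2) else 0)) \<le> s\<^sup>2 / (real N + 1)\<^sup>2"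
  shows "\<exists>k \<in> fixing (- {..<N}). \<exists>k' \<in> fixing (- {..<N}). \<exists>k'' \<in> fixing (- {..<N}).
    k o\<^sub>L (w o\<^sub>L (k' o\<^sub>L (ginv w o\<^sub>L k''))) = g"
proof -
  \<comment> \<open>The coefficient of \<open>q j\<close> in \<open>f i\<close>: as
    \<open>ip (q j) (e j)\<close> is \<open>s\<close>, it corrects the product with
    \<open>e j\<close> from its value for \<open>c *\<^sub>R w (e i)\<close> to that for
    \<open>g (e i)\<close>.\<close>
  define \<beta> where "\<beta> i j = (ip (g (e i)) (e j) - (if i = j then of_real (c\<^sup>2) else 0)) / of_real s" for i j
  define \<eta> where "\<eta> = \<bar>s\<bar> / (real N + 1)\<^sup>2"
  have \<beta>: "norm (\<beta> i j) \<le> \<eta>" if "i < N" "j < N" for i j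
  proof -
    have "norm (\<beta> i j) \<le> s\<^sup>2 / (real N + 1)\<^sup>2 / \<bar>s\<bar>"
      unfolding \<beta>_def norm_divide norm_of_real using near[OF that] by (rule divide_right_mono) simp
    also have "\<dots> = \<eta>" using s by (simp add: \<eta>_def power2_eq_square divide_simps)
    finally show ?thesis .
  qed
  define \<beta>\<beta> where "\<beta>\<beta> i j = (\<Sum>l<N. \<beta> i l * cj (\<beta> j l))" for i j
  \<comment> \<open>The Gram matrix that the remaining part \<open>v i\<close> of \<open>f i\<close>
    must have for the \<open>f i\<close> to be orthonormal. It is a small perturbation of
    \<open>s * s\<close> times the identity, hence realisable.\<close>
  define E where "E i j = (if i = j then of_real (s\<^sup>2) else 0) - \<beta>\<beta> i j" for i j
  \<comment> \<open>The bound in \<open>near\<close> is calibrated for two inequalities: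
    \<open>N * \<eta>^2 \<le> \<kappa>^2\<close> bounds the off-diagonal entries of
    \<open>E\<close>, and \<open>(N^2 + 1) * \<kappa>^2 \<le> s^2\<close>, which is
    \<open>N^2 + 1 \<le> (N + 1)^2\<close>, leaves enough on the diagonal.\<close>
  define \<kappa> where "\<kappa> = \<bar>s\<bar> / (real N + 1)"
  define \<rho> where "\<rho> i = s\<^sup>2 - (\<Sum>l<N. (norm (\<beta> i l))\<^sup>2)" for i
  define d where "d p = e (2 * N + prod_encode p)" for p
  have \<eta>\<kappa>: "real N * \<eta>\<^sup>2 \<le> \<kappa>\<^sup>2"
  proof -
    have "real N * \<eta>\<^sup>2 = \<kappa>\<^sup>2 * (real N / (real N + 1)\<^sup>2)"
      by (simp add: \<eta>_def \<kappa>_def power2_eq_square divide_simps)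
    also have "real N \<le> (real N + 1)\<^sup>2" by (simp add: power2_eq_square algebra_simps)
    then have "real N / (real N + 1)\<^sup>2 \<le> 1"
      by (subst divide_le_eq_1_pos) (auto intro!: zero_less_power)
    then have "\<kappa>\<^sup>2 * (real N / (real N + 1)\<^sup>2) \<le> \<kappa>\<^sup>2 * 1" by (intro mult_left_mono) auto
    finally show ?thesis by simp
  qed
  have dom: "(real N)\<^sup>2 * \<kappa>\<^sup>2 \<le> s\<^sup>2 - real N * \<eta>\<^sup>2"
  proof -
    have "((real N)\<^sup>2 + 1) * \<kappa>\<^sup>2 \<le> s\<^sup>2"
    proof -
      have "((real N)\<^sup>2 + 1) * \<kappa>\<^sup>2 = s\<^sup>2 * (((real N)\<^sup>2 + 1) / (real N + 1)\<^sup>2)"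
        by (simp add: \<kappa>_def power2_eq_square divide_simps)
      also have "(real N)\<^sup>2 + 1 \<le> (real N + 1)\<^sup>2" by (simp add: power2_eq_square algebra_simps)
      then have "((real N)\<^sup>2 + 1) / (real N + 1)\<^sup>2 \<le> 1"
        by (subst divide_le_eq_1_pos) (auto intro!: zero_less_power)
      then have "s\<^sup>2 * (((real N)\<^sup>2 + 1) / (real N + 1)\<^sup>2) \<le> s\<^sup>2 * 1"
        by (intro mult_left_mono) auto
      finally show ?thesis by simp
    qed
    then show ?thesis using \<eta>\<kappa> by (simp add: algebra_simps)
  qed
  have d_on: "orthonormal UNIV d" by (simp add: orthonormal_def d_def ip_e)
  have "\<exists>v. (\<forall>i<N. \<forall>j<N. ip (v i) (v j) = E i j) \<and>
    (\<forall>i x. (\<forall>p. ip (d p) x = 0) \<longrightarrow> ip (v i) x = 0)"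
  proof (rule ex_family_of_Gram[OF d_on])
    show "\<kappa> > 0" using s by (simp add: \<kappa>_def)
    show "norm (E i j) \<le> \<kappa>\<^sup>2" if "i < N" "j < N" "i \<noteq> j" for i j
    proof -
      have "norm (E i j) \<le> (\<Sum>l<N. norm (\<beta> i l * cj (\<beta> j l)))"
        using that(3) norm_sum[of "\<lambda>l. \<beta> i l * cj (\<beta> j l)" "{..<N}"] by (simp add: E_def \<beta>\<beta>_def)
      also have "\<dots> \<le> of_nat (card {..<N}) * \<eta>\<^sup>2"
        unfolding norm_mult norm_cj power2_eq_square
        using \<beta> that by (intro sum_bounded_above mult_mono) (auto simp: \<eta>_def)
      finally show ?thesis using \<eta>\<kappa> by simp
    qed
    show "E j i = cj (E i j)" for i j
      by (auto simp: E_def \<beta>\<beta>_def cj_sum mult.commute)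
    show "E i i = of_real (\<rho> i)" if "i < N" for i
      by (simp add: E_def \<beta>\<beta>_def \<rho>_def mult_cj)
    show "(real N)\<^sup>2 * \<kappa>\<^sup>2 \<le> \<rho> i" if "i < N" for i
    proof -
      have "(\<Sum>l<N. (norm (\<beta> i l))\<^sup>2) \<le> of_nat (card {..<N}) * \<eta>\<^sup>2"
        using \<beta> that by (intro sum_bounded_above power_mono) auto
      then show ?thesis using dom by (simp add: \<rho>_def)
    qed
  qed
  then obtain v where vv: "\<And>i j. i < N \<Longrightarrow> j < N \<Longrightarrow> ip (v i) (v j) = E i j"
    and vd: "\<And>i x. (\<forall>p. ip (d p) x = 0) \<Longrightarrow> ip (v i) x = 0" by blast
  have ve: "ip (v i) (e n) = 0" if "n < 2 * N" for i n
    by (rule vd) (use that in \<open>auto simp: d_def ip_e\<close>)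
  have ve': "ip (e n) (v i) = 0" if "n < 2 * N" for i n
    using ve[OF that, of i] ip_eq_0_commute by blast
  \<comment> \<open>\<open>w (e j)\<close> and \<open>q j\<close> form an orthonormal basis of the
    plane of \<open>e j\<close> and \<open>e (N + j)\<close>, so adding multiples of
    \<open>q j\<close> leaves the products with the \<open>w (e i)\<close> unchanged.\<close>
  define q where "q j = s *\<^sub>R e j - c *\<^sub>R e (N + j)" for j
  define y where "y i = (\<Sum>j<N. sc (\<beta> i j) (q j))" for i
  define f where "f i = c *\<^sub>R w (e i) + y i + v i" for i
  have cs': "of_real c * of_real c + of_real s * of_real s = (1 :: 'f)"
    using cs by (metis of_real_1 of_real_add of_real_mult power2_eq_square)
  have sc': "of_real s * of_real s + of_real c * of_real c = (1 :: 'f)"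
    using cs' by (simp add: add.commute)
  have q_on: "orthonormal {..<N} q"
    by (auto simp: orthonormal_def q_def ip_diff_left ip_diff_right ip_e sc')
  have yy: "ip (y i) (y j) = \<beta>\<beta> i j" for i j
    unfolding y_def \<beta>\<beta>_def by (rule ip_sum_orthonormal[OF q_on]) auto
  have ww: "ip (w (e i)) (w (e j)) = (if i = j then 1 else 0)" for i j
    using w(1) by (simp add: G_ip ip_e)
  have yw: "ip (y i) (w (e j)) = 0" if "j < N" for i j
    unfolding y_def ip_sum_left ip_sc_left using that
    by (intro sum.neutral) (auto simp: w(2) q_def ip_diff_left ip_add_right ip_e)
  have yv: "ip (y i) (v j) = 0" for i j
    unfolding y_def ip_sum_left ip_sc_left
    by (intro sum.neutral) (auto simp: q_def ip_diff_left ve')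
  have ye: "ip (y i) (e j) = \<beta> i j * of_real s" if "j < N" for i j
  proof -
    have "ip (y i) (e j) = (\<Sum>l<N. if l = j then \<beta> i l * of_real s else 0)"
      unfolding y_def ip_sum_left ip_sc_left using that
      by (intro sum.cong refl) (auto simp: q_def ip_diff_left ip_e)
    then show ?thesis using that by simp
  qed
  have wv: "ip (w (e i)) (v j) = 0" if "i < N" for i j
    using that by (simp add: w(2) ip_add_left ve')
  have wy: "ip (w (e j)) (y i) = 0" "ip (v i) (w (e j)) = 0" if "j < N" for i j
    using yw[OF that] wv[OF that] ip_eq_0_commute by blast+
  have vy: "ip (v j) (y i) = 0" for i j using yv ip_eq_0_commute by blast
  have ff: "ip (f i) (f j) = (if i = j then 1 else 0)" if "i < N" "j < N" for i j
  proof -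
    have "ip (f i) (f j) = (if i = j then of_real c * of_real c else 0) + \<beta>\<beta> i j + E i j"
      using that by (simp add: f_def ip_add_left ip_add_right ww yy vv wv wy yw yv vy)
    then show ?thesis using cs' by (simp add: E_def power2_eq_square)
  qed
  have fw: "ip (f i) (w (e j)) = (if i = j then of_real c else 0)" if "i < N" "j < N" for i j
    using that by (simp add: f_def ip_add_left ww wy yw)
  have fe: "ip (f i) (e j) = ip (g (e i)) (e j)" if "i < N" "j < N" for i j
    using that s by (auto simp: f_def ip_add_left w(2) ip_e ye ve \<beta>_def power2_eq_square)
  obtain k where k: "k \<in> fixing (- {..<N})" "\<And>i. i < N \<Longrightarrow> k (g (e i)) = f i"
    using fixing_ex_map_of_Gram_eq[of N "\<lambda>i. g (e i)" f] ff fe g by (auto simp: G_ip ip_e)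
  obtain k' where k': "k' \<in> fixing (- {..<N})" "\<And>i. i < N \<Longrightarrow> k' (ginv w (e i)) = ginv w (f i)"
  proof -
    have "ip (ginv w (e i)) (ginv w (e j)) = ip (ginv w (f i)) (ginv w (f j))"
      "ip (ginv w (e i)) (e j) = ip (ginv w (f i)) (e j)" if "i < N" "j < N" for i j
    proof -
      show "ip (ginv w (e i)) (ginv w (e j)) = ip (ginv w (f i)) (ginv w (f j))"
        using ff[OF that] w(1) by (simp add: ip_ginv(2) ip_e)
      show "ip (ginv w (e i)) (e j) = ip (ginv w (f i)) (e j)"
        unfolding ip_ginv(1)[OF w(1)] fw[OF that] using that by (simp add: w(2) ip_add_right ip_e)
    qed
    then show ?thesis
      using that fixing_ex_map_of_Gram_eq[of N "\<lambda>i. ginv w (e i)" "\<lambda>i. ginv w (f i)"] by blast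
  qed
  have kG: "k \<in> carrier G" "k' \<in> carrier G" using k k' by (auto intro: fixing_in_G)
  define k'' where "k'' = w o\<^sub>L (ginv k' o\<^sub>L (ginv w o\<^sub>L (k o\<^sub>L g)))"
  have "k'' (e i) = e i" if "i < N" for i
  proof -
    have "ginv k' (ginv w (f i)) = ginv w (e i)"
      using k'(2)[OF that] kG(2) G_eq_ginv_iff by metis
    then show ?thesis using w(1) by (simp add: k''_def k(2)[OF that])
  qed
  then have "k'' \<in> fixing (- {..<N})" using w(1) kG g by (simp add: fixing_def k''_def)
  moreover have "ginv k o\<^sub>L (w o\<^sub>L (k' o\<^sub>L (ginv w o\<^sub>L k''))) = g"
    using w(1) kG by (intro blinfun_eqI) (simp add: k''_def)
  ultimately show ?thesis using fixing_ginv[OF k(1)] k'(1) by blast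
qed

lemma sigma_syndetic_imp_nhd:
  assumes W: "sigma_syndetic G W"
  shows "\<exists>S \<epsilon>. finite S \<and> \<epsilon> > 0 \<and>
    {h \<in> carrier G. \<forall>x\<in>S. norm (h x - x) < \<epsilon>} \<subseteq> wpow G W 344"
proof -
  have subW: "W \<subseteq> carrier G" using W by (simp add: sigma_syndetic_def)
  obtain g F where g: "g \<in> carrier G" and F: "finite F"
    and fixF: "fixing (- F) \<subseteq> wpow G ((\<lambda>x. g o\<^sub>L x o\<^sub>L ginv g) ` W) 56"
    using sigma_syndetic_fixing_cofinite[OF W] by blast
  define W' where "W' = (\<lambda>x. g o\<^sub>L x o\<^sub>L ginv g) ` W"
  have W': "sigma_syndetic G W'"
    using G.sigma_syndetic_conj[OF W g] by (simp add: W'_def)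
  have sub': "W' \<subseteq> carrier G" and sym': "\<And>x. x \<in> W' \<Longrightarrow> ginv x \<in> W'"
    using W' by (auto simp: sigma_syndetic_def)
  have mult: "a o\<^sub>L b \<in> wpow G W' (m + n)" if "a \<in> wpow G W' m" "b \<in> wpow G W' n" for a b m n
    using G.wpow_add[OF sub' that] by simp
  have inv: "ginv a \<in> wpow G W' m" if "a \<in> wpow G W' m" for a m
    using G.wpow_inv[OF sub' sym' that] .
  obtain N where N: "F \<subseteq> {..<N}" using finite_nat_bounded[OF F] by blast
  have fixN: "fixing (- {..<N}) \<subseteq> wpow G W' 56"
    using fixF fixing_mono[of "- {..<N}" "- F"] N unfolding W'_def by blast
  obtain R where R: "\<And>t. R t \<in> carrier G"
      "\<And>t i. i < N \<Longrightarrow> R t (e i) = cos t *\<^sub>R e i + sin t *\<^sub>R e (N + i)"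
      "\<And>t i. i < N \<Longrightarrow> R t (e (N + i)) = (- sin t) *\<^sub>R e i + cos t *\<^sub>R e (N + i)"
    using ex_rotation[of N] by metis
  \<comment> \<open>Two distinct angles from this interval differ by less than \<open>pi\<close>,
    which makes the sine of the difference nonzero.\<close>
  have "uncountable {0<..<pi}" using uncountable_open_interval[of 0 pi] by simp
  then obtain r s where rs: "r \<in> {0<..<pi}" "s \<in> {0<..<pi}" "r \<noteq> s" "ginv (R r) o\<^sub>L R s \<in> wpow G W' 2"
    using G.sigma_syndetic_pigeonhole[OF W', of "{0<..<pi}" R] R(1) by auto
  define w where "w = ginv (R r) o\<^sub>L R s"
  have wG: "w \<in> carrier G" using R(1) by (simp add: w_def)
  have w2: "w \<in> wpow G W' 2" using rs(4) by (simp add: w_def)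
  have we: "w (e i) = cos (s - r) *\<^sub>R e i + sin (s - r) *\<^sub>R e (N + i)" if i: "i < N" for i
  proof -
    have cos': "cos (s - r) * cos r - sin (s - r) * sin r = cos s"
      using cos_add[of "s - r" r] by simp
    have sin': "cos (s - r) * sin r + sin (s - r) * cos r = sin s"
      using sin_add[of "s - r" r] by simp
    have "R r (cos (s - r) *\<^sub>R e i + sin (s - r) *\<^sub>R e (N + i))
        = (cos (s - r) * cos r - sin (s - r) * sin r) *\<^sub>R e i
          + (cos (s - r) * sin r + sin (s - r) * cos r) *\<^sub>R e (N + i)"
      using i by (simp add: G_app(1)[OF R(1)] G_scaleR[OF R(1)] R(2,3) algebra_simps)
    then have "R r (cos (s - r) *\<^sub>R e i + sin (s - r) *\<^sub>R e (N + i)) = R s (e i)"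
      unfolding cos' sin' using i by (simp add: R(2))
    then show ?thesis using G_eq_ginv_iff[OF R(1)[of r]] by (simp add: w_def)
  qed
  have sin0: "sin (s - r) \<noteq> 0"
  proof (cases "s > r")
    case True
    then show ?thesis using sin_gt_zero[of "s - r"] rs by auto
  next
    case False
    then show ?thesis using sin_gt_zero[of "r - s"] rs sin_minus[of "r - s"] by auto
  qed
  define \<epsilon> where "\<epsilon> = (sin (s - r))\<^sup>2 / (real N + 1)\<^sup>2"
  have \<epsilon>0: "\<epsilon> > 0" using sin0 by (simp add: \<epsilon>_def)
  have dc: "k \<in> wpow G W' 172" if k: "k \<in> carrier G" and near: "\<And>i j. i < N \<Longrightarrow> j < N \<Longrightarrow>
      norm (ip (k (e i)) (e j) - (if i = j then of_real ((cos (s - r))\<^sup>2) else 0)) \<le> \<epsilon>" for k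
  proof -
    obtain a b c where "a \<in> fixing (- {..<N})" "b \<in> fixing (- {..<N})" "c \<in> fixing (- {..<N})"
        "a o\<^sub>L (w o\<^sub>L (b o\<^sub>L (ginv w o\<^sub>L c))) = k"
      using double_coset_if_near[OF wG we _ sin0 k near[unfolded \<epsilon>_def]] by auto
    moreover have "a o\<^sub>L (w o\<^sub>L (b o\<^sub>L (ginv w o\<^sub>L c))) \<in> wpow G W' (56 + (2 + (56 + (2 + 56))))"
      using calculation(1-3) fixN by (intro mult inv w2) auto
    ultimately show ?thesis by simp
  qed
  \<comment> \<open>The rotation by \<open>t\<close> has compression exactly
    \<open>cos t = (cos (s - r))^2\<close> times the identity, the centre of the set covered by
    \<open>dc\<close>. For \<open>h\<close> near the identity, \<open>ginv (R t) o\<^sub>L h\<close>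
    is still in that set, so \<open>h\<close> is a product of two of its members.\<close>
  define t where "t = arccos ((cos (s - r))\<^sup>2)"
  have cost: "cos t = (cos (s - r))\<^sup>2"
    unfolding t_def by (rule cos_arccos) (auto simp: abs_square_le_1 intro: order_trans[of _ 0])
  have Rt: "ip (R t (e i)) (e j) = (if i = j then of_real ((cos (s - r))\<^sup>2) else 0)"
    if "i < N" "j < N" for i j
    using that by (simp add: R(2) ip_add_left ip_e cost)
  have Rt': "ip (e i) (R t (e j)) = (if i = j then of_real ((cos (s - r))\<^sup>2) else 0)"
    if "i < N" "j < N" for i j
    using Rt[OF that(2,1)] ip_commute[of "e i" "R t (e j)"] by auto
  have near_in: "h \<in> wpow G W' 344" if h: "h \<in> carrier G" and hn: "\<And>i. i < N \<Longrightarrow> norm (h (e i) - e i) < \<epsilon>" for h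
  proof -
    have 1: "R t \<in> wpow G W' 172"
      by (rule dc[OF R(1)]) (use Rt \<epsilon>0 in \<open>auto simp del: of_real_power\<close>)
    have 2: "ginv (R t) o\<^sub>L h \<in> wpow G W' 172"
    proof (rule dc)
      show "ginv (R t) o\<^sub>L h \<in> carrier G" using R(1) h by simp
      fix i j assume ij: "i < N" "j < N"
      have "ip ((ginv (R t) o\<^sub>L h) (e i)) (e j) - (if i = j then of_real ((cos (s - r))\<^sup>2) else 0)
          = ip (h (e i) - e i) (R t (e j))"
        using Rt'[OF ij] R(1) by (simp add: ip_ginv ip_diff_left)
      also have "norm \<dots> \<le> norm (h (e i) - e i) * norm (R t (e j))" by (rule Cauchy_Schwarz)
      also have "norm (R t (e j)) = 1"
        using G_app(3)[OF R(1)] ip_self_eq_1[of "e j"] by (simp add: ip_e)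
      finally show "norm (ip ((ginv (R t) o\<^sub>L h) (e i)) (e j)
          - (if i = j then of_real ((cos (s - r))\<^sup>2) else 0)) \<le> \<epsilon>"
        using hn[OF ij(1)] by linarith
    qed
    have "R t o\<^sub>L (ginv (R t) o\<^sub>L h) \<in> wpow G W' (172 + 172)" by (intro mult 1 2)
    moreover have "R t o\<^sub>L (ginv (R t) o\<^sub>L h) = h" using R(1) by (intro blinfun_eqI) simp
    ultimately show ?thesis by simp
  qed
  \<comment> \<open>Closeness of the conjugate of \<open>h\<close> by \<open>g\<close> to the
    identity at \<open>e i\<close> is closeness of \<open>h\<close> itself at
    \<open>ginv g (e i)\<close>.\<close>
  define S where "S = (\<lambda>i. ginv g (e i)) ` {..<N}"
  have "h \<in> wpow G W 344" if h: "h \<in> carrier G" and hS: "\<forall>x\<in>S. norm (h x - x) < \<epsilon>" for h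
  proof -
    define h' where "h' = g o\<^sub>L h o\<^sub>L ginv g"
    have "norm (h' (e i) - e i) < \<epsilon>" if "i < N" for i
    proof -
      have "h' (e i) - e i = g (h (ginv g (e i)) - ginv g (e i))"
        using g by (simp add: h'_def G_app(4))
      then show ?thesis using hS that G_app(3)[OF g] by (simp add: S_def)
    qed
    then have h': "h' \<in> wpow G W' 344" using near_in[of h'] g h by (simp add: h'_def)
    have "ginv g o\<^sub>L h' o\<^sub>L ginv (ginv g) \<in> wpow G ((\<lambda>x. ginv g o\<^sub>L x o\<^sub>L ginv (ginv g)) ` W') 344"
      using G.wpow_conj[OF sub' _ h', of "ginv g"] g by simp
    moreover have "ginv g o\<^sub>L (g o\<^sub>L x o\<^sub>L ginv g) o\<^sub>L g = x" for x
      using g by (intro blinfun_eqI) simp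
    then have "(\<lambda>x. ginv g o\<^sub>L x o\<^sub>L ginv (ginv g)) ` W' = W" "ginv g o\<^sub>L h' o\<^sub>L ginv (ginv g) = h"
      using g by (simp_all add: W'_def image_image h'_def)
    ultimately show ?thesis by simp
  qed
  then show ?thesis using \<epsilon>0 by (intro exI[of _ S] exI[of _ \<epsilon>]) (auto simp: S_def)
qed

end

section \<open>Continuity of homomorphisms\<close>

lemma wpow_mono: "W \<subseteq> W' \<Longrightarrow> wpow K W n \<subseteq> wpow K W' n"
  by (induction n) auto

lemma (in group) hom_wpow:
  assumes f: "f \<in> hom G K" and K: "group K" and W: "W \<subseteq> carrier G"
  shows "x \<in> wpow G W n \<Longrightarrow> f x \<in> wpow K (f ` W) n"
proof (induction n arbitrary: x)
  case 0
  then show ?case using hom_one[OF f is_group K] by simp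
next
  case (Suc n)
  then obtain a b where "x = a \<otimes> b" "a \<in> W" "b \<in> wpow G W n" by auto
  then show ?case
    using Suc.IH[of b] hom_mult[OF f, of a b] W wpow_closed[OF W, of n] by auto
qed

lemma topological_group_wpow_nhd:
  assumes T: "topological_group K S"
  shows "openin S V \<Longrightarrow> \<one>\<^bsub>K\<^esub> \<in> V \<Longrightarrow> \<exists>U. openin S U \<and> \<one>\<^bsub>K\<^esub> \<in> U \<and> wpow K U n \<subseteq> V"
proof (induction n arbitrary: V)
  case 0
  then show ?case by auto
next
  case (Suc n)
  interpret K: group K using T by (simp add: topological_group_def)
  have top: "topspace S = carrier K" using T by (simp add: topological_group_def)
  define M where "M = {p \<in> topspace (prod_topology S S). (case p of (x, y) \<Rightarrow> x \<otimes>\<^bsub>K\<^esub> y) \<in> V}"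
  have "continuous_map (prod_topology S S) S (\<lambda>(x, y). x \<otimes>\<^bsub>K\<^esub> y)"
    using T by (simp add: topological_group_def)
  then have oM: "openin (prod_topology S S) M"
    unfolding M_def using Suc.prems(1) by (rule openin_continuous_map_preimage)
  have 1: "(\<one>\<^bsub>K\<^esub>, \<one>\<^bsub>K\<^esub>) \<in> M" using Suc.prems(2) top by (simp add: M_def)
  obtain A B where AB: "openin S A" "openin S B" "\<one>\<^bsub>K\<^esub> \<in> A" "\<one>\<^bsub>K\<^esub> \<in> B" "A \<times> B \<subseteq> M"
    using oM[unfolded openin_prod_topology_alt, rule_format, OF 1] by (elim exE conjE)
  obtain U where U: "openin S U" "\<one>\<^bsub>K\<^esub> \<in> U" "wpow K U n \<subseteq> B"
    using Suc.IH[OF AB(2,4)] by blast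
  have "wpow K (A \<inter> U) (Suc n) \<subseteq> V"
  proof
    fix x assume "x \<in> wpow K (A \<inter> U) (Suc n)"
    then obtain a b where x: "x = a \<otimes>\<^bsub>K\<^esub> b" "a \<in> A" "b \<in> wpow K (A \<inter> U) n" by auto
    then have "b \<in> B" using U(3) wpow_mono[of "A \<inter> U" U K n] by blast
    then have "(a, b) \<in> M" using AB(5) x(2) by blast
    then show "x \<in> V" by (simp add: M_def x(1))
  qed
  then show ?case using AB U by (intro exI[of _ "A \<inter> U"]) auto
qed

lemma topological_group_quotient_nhd:
  assumes T: "topological_group K S" and V: "openin S V" "\<one>\<^bsub>K\<^esub> \<in> V"
  shows "\<exists>U. openin S U \<and> \<one>\<^bsub>K\<^esub> \<in> U \<and> (\<forall>a\<in>U. \<forall>b\<in>U. inv\<^bsub>K\<^esub> a \<otimes>\<^bsub>K\<^esub> b \<in> V)"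
proof -
  interpret K: group K using T by (simp add: topological_group_def)
  have top: "topspace S = carrier K" and cinv: "continuous_map S S (\<lambda>x. inv\<^bsub>K\<^esub> x)"
    using T by (auto simp: topological_group_def)
  obtain U where U: "openin S U" "\<one>\<^bsub>K\<^esub> \<in> U" "wpow K U 2 \<subseteq> V"
    using topological_group_wpow_nhd[OF T V] by blast
  define U' where "U' = U \<inter> {x \<in> topspace S. inv\<^bsub>K\<^esub> x \<in> U}"
  have "openin S U'"
    unfolding U'_def by (intro openin_Int U openin_continuous_map_preimage[OF cinv])
  moreover have "\<one>\<^bsub>K\<^esub> \<in> U'" using U top by (simp add: U'_def)
  moreover have "inv\<^bsub>K\<^esub> a \<otimes>\<^bsub>K\<^esub> b \<in> V" if "a \<in> U'" "b \<in> U'" for a b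
  proof -
    have UK: "U \<subseteq> carrier K" using openin_subset[OF U(1)] top by simp
    have "inv\<^bsub>K\<^esub> a \<otimes>\<^bsub>K\<^esub> b \<in> wpow K U (1 + 1)"
      using that by (intro K.wpow_add K.wpow_one UK) (auto simp: U'_def)
    then show ?thesis using U(3) by (auto simp only: one_add_one)
  qed
  ultimately show ?thesis by blast
qed

lemma topological_group_continuous_translations:
  assumes T: "topological_group K S" and c: "c \<in> carrier K"
  shows "continuous_map S S (\<lambda>y. c \<otimes>\<^bsub>K\<^esub> y)" "continuous_map S S (\<lambda>y. inv\<^bsub>K\<^esub> y \<otimes>\<^bsub>K\<^esub> c)"
proof -
  have top: "topspace S = carrier K" and cinv: "continuous_map S S (\<lambda>x. inv\<^bsub>K\<^esub> x)"
    and mult: "continuous_map (prod_topology S S) S (\<lambda>(x, y). x \<otimes>\<^bsub>K\<^esub> y)"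
    using T by (auto simp: topological_group_def)
  have "continuous_map S (prod_topology S S) (\<lambda>y. (c, y))"
    "continuous_map S (prod_topology S S) (\<lambda>y. (inv\<^bsub>K\<^esub> y, c))"
    using c top cinv by (auto intro!: continuous_map_pairedI simp: continuous_map_const)
  from this[THEN continuous_map_compose, OF mult]
  show "continuous_map S S (\<lambda>y. c \<otimes>\<^bsub>K\<^esub> y)" "continuous_map S S (\<lambda>y. inv\<^bsub>K\<^esub> y \<otimes>\<^bsub>K\<^esub> c)"
    by (simp_all add: o_def)
qed

text \<open>The translates of \<open>U\<close> by a countable dense set cover the target, but their
  centres \<open>d\<close> need not be values of \<open>f\<close>. Each is replaced by a value
  \<open>f (g d)\<close> in the same translate when there is one; comparing two points of that
  translate produces a quotient of members of \<open>U\<close>, hence the form of the set.\<close>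

lemma (in group) sigma_syndetic_preimage:
  assumes T: "topological_group K S" and sep: "separable_space S" and f: "f \<in> hom G K"
    and U: "openin S U" "\<one>\<^bsub>K\<^esub> \<in> U"
  shows "sigma_syndetic G {g \<in> carrier G. \<exists>a\<in>U. \<exists>b\<in>U. f g = inv\<^bsub>K\<^esub> a \<otimes>\<^bsub>K\<^esub> b}"
proof -
  interpret K: group K using T by (simp add: topological_group_def)
  interpret f: group_hom G K f by unfold_locales (rule f)
  have top: "topspace S = carrier K" using T by (simp add: topological_group_def)
  have UK: "U \<subseteq> carrier K" using openin_subset[OF U(1)] top by simp
  define W where "W = {g \<in> carrier G. \<exists>a\<in>U. \<exists>b\<in>U. f g = inv\<^bsub>K\<^esub> a \<otimes>\<^bsub>K\<^esub> b}"
  have sym: "inv x \<in> W" if x: "x \<in> W" for x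
  proof -
    obtain a b where ab: "x \<in> carrier G" "a \<in> U" "b \<in> U" "f x = inv\<^bsub>K\<^esub> a \<otimes>\<^bsub>K\<^esub> b"
      using x by (auto simp: W_def)
    then have "f (inv x) = inv\<^bsub>K\<^esub> b \<otimes>\<^bsub>K\<^esub> a"
      using UK by (simp add: K.inv_mult_group subset_iff)
    then show ?thesis using ab by (auto simp: W_def)
  qed
  obtain C where C: "countable C" "C \<subseteq> topspace S" "S closure_of C = topspace S"
    using sep unfolding separable_space_def by blast
  define g where "g d = (if \<exists>x\<in>carrier G. \<exists>v\<in>U. f x = d \<otimes>\<^bsub>K\<^esub> v
    then SOME x. x \<in> carrier G \<and> (\<exists>v\<in>U. f x = d \<otimes>\<^bsub>K\<^esub> v) else \<one>)" for d
  have g: "g d \<in> carrier G \<and> (\<exists>v\<in>U. f (g d) = d \<otimes>\<^bsub>K\<^esub> v)"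
    if "x \<in> carrier G" "v \<in> U" "f x = d \<otimes>\<^bsub>K\<^esub> v" for d x v
  proof -
    have "\<exists>x. x \<in> carrier G \<and> (\<exists>v\<in>U. f x = d \<otimes>\<^bsub>K\<^esub> v)" using that by blast
    from someI_ex[OF this] show ?thesis using that by (auto simp: g_def)
  qed
  have gG: "g d \<in> carrier G" for d
  proof (cases "\<exists>x\<in>carrier G. \<exists>v\<in>U. f x = d \<otimes>\<^bsub>K\<^esub> v")
    case True
    then show ?thesis using g by blast
  next
    case False
    then show ?thesis unfolding g_def by simp
  qed
  define h where "h n = g (from_nat_into C n)" for n
  have "\<exists>n. inv (h n) \<otimes> x \<in> W" if x: "x \<in> carrier G" for x
  proof -
    have fx: "f x \<in> carrier K" using x by simp
    \<comment> \<open>The centres \<open>y\<close> whose translate of \<open>U\<close> contains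
      \<open>f x\<close>: an open set containing \<open>f x\<close>, hence met by the dense
      set.\<close>
    define Q where "Q = {y \<in> topspace S. inv\<^bsub>K\<^esub> y \<otimes>\<^bsub>K\<^esub> f x \<in> U}"
    have "openin S Q" unfolding Q_def
      by (rule openin_continuous_map_preimage[OF topological_group_continuous_translations(2)[OF T fx] U(1)])
    moreover have "f x \<in> Q" using fx U(2) by (simp add: Q_def top)
    ultimately obtain d where d: "d \<in> C" "d \<in> Q"
      using C(3) unfolding dense_intersects_open by blast
    define v where "v = inv\<^bsub>K\<^esub> d \<otimes>\<^bsub>K\<^esub> f x"
    have dK: "d \<in> carrier K" and v: "v \<in> U" using d C(2) top by (auto simp: Q_def v_def)
    have vK: "v \<in> carrier K" using v UK by blast
    have fxd: "f x = d \<otimes>\<^bsub>K\<^esub> v" unfolding v_def using dK fx by (simp flip: K.m_assoc)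
    obtain v' where v': "v' \<in> U" "f (g d) = d \<otimes>\<^bsub>K\<^esub> v'" using g[OF x v fxd] by blast
    have v'K: "v' \<in> carrier K" using v' UK by blast
    have "f (inv (g d) \<otimes> x) = inv\<^bsub>K\<^esub> (d \<otimes>\<^bsub>K\<^esub> v') \<otimes>\<^bsub>K\<^esub> (d \<otimes>\<^bsub>K\<^esub> v)"
      using gG x by (simp add: v'(2) fxd[symmetric])
    also have "\<dots> = inv\<^bsub>K\<^esub> v' \<otimes>\<^bsub>K\<^esub> (inv\<^bsub>K\<^esub> d \<otimes>\<^bsub>K\<^esub> (d \<otimes>\<^bsub>K\<^esub> v))"
      using dK v'K vK by (simp add: K.inv_mult_group K.m_assoc)
    also have "inv\<^bsub>K\<^esub> d \<otimes>\<^bsub>K\<^esub> (d \<otimes>\<^bsub>K\<^esub> v) = v" using dK vK by (simp flip: K.m_assoc)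
    finally have "inv (g d) \<otimes> x \<in> W" using gG x v v'(1) by (auto simp: W_def)
    moreover obtain n where "from_nat_into C n = d" using from_nat_into_surj[OF C(1) d(1)] by blast
    ultimately show ?thesis by (auto simp: h_def)
  qed
  then have "sigma_syndetic G W"
    unfolding sigma_syndetic_def using sym gG by (auto simp: W_def h_def intro!: exI[of _ h])
  then show ?thesis by (simp add: W_def)
qed

section \<open>Continuity from the Steinhaus property\<close>

context hilbert
begin

lemma openin_SOT_nhd:
  assumes "finite X"
  shows "openin (SOT G) {h \<in> carrier G. \<forall>x\<in>X. norm (h x - y x) < \<epsilon>}"
  using assms
proof (induction X rule: finite_induct)
  case empty
  show ?case using openin_topspace[of "SOT G"] by (simp add: topspace_SOT)
next
  case (insert x X)
  have "openin (SOT G) {h \<in> topspace (SOT G). blinfun_apply h x \<in> ball (y x) \<epsilon>}"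
    by (rule openin_continuous_map_preimage[OF continuous_map_SOT_eval]) simp
  then have "openin (SOT G) ({h \<in> topspace (SOT G). blinfun_apply h x \<in> ball (y x) \<epsilon>} \<inter>
      {h \<in> carrier G. \<forall>x\<in>X. norm (h x - y x) < \<epsilon>})"
    using insert.IH by (rule openin_Int)
  also have "{h \<in> topspace (SOT G). blinfun_apply h x \<in> ball (y x) \<epsilon>} \<inter>
      {h \<in> carrier G. \<forall>x\<in>X. norm (h x - y x) < \<epsilon>} = {h \<in> carrier G. \<forall>x\<in>insert x X. norm (h x - y x) < \<epsilon>}"
    by (auto simp: topspace_SOT dist_norm norm_minus_commute)
  finally show ?case .
qed

theorem automatic_continuity_isometry_group: "automatic_continuity G (SOT G) TYPE('k)"
  unfolding automatic_continuity_def
proof (intro allI impI ballI)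
  fix K :: "'k monoid" and S f
  assume KS: "topological_group K S \<and> separable_space S" and f: "f \<in> hom G K"
  then have T: "topological_group K S" and sep: "separable_space S" by auto
  interpret K: group K using T by (simp add: topological_group_def)
  interpret f: group_hom G K f by unfold_locales (rule f)
  have top: "topspace S = carrier K" using T by (simp add: topological_group_def)
  obtain e :: "nat \<Rightarrow> 'a" where e: "orthonormal UNIV e" "total e"
    using ex_orthonormal_basis by blast
  interpret hilbert_basis sc ip cj e by unfold_locales (fact e)+
  show "continuous_map (SOT G) S f"
    unfolding continuous_map
  proof (intro conjI allI impI)
    show "f ` topspace (SOT G) \<subseteq> topspace S"
      by (auto simp: topspace_SOT top)
    fix V assume V: "openin S V"
    show "openin (SOT G) {g \<in> topspace (SOT G). f g \<in> V}"
    proof (subst openin_subopen, intro ballI)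
      fix g assume "g \<in> {g \<in> topspace (SOT G). f g \<in> V}"
      then have g: "g \<in> carrier G" "f g \<in> V" by (auto simp: topspace_SOT)
      have fg: "f g \<in> carrier K" using g by simp
      define V1 where "V1 = {y \<in> topspace S. f g \<otimes>\<^bsub>K\<^esub> y \<in> V}"
      have V1: "openin S V1" "\<one>\<^bsub>K\<^esub> \<in> V1"
        using openin_continuous_map_preimage[OF topological_group_continuous_translations(1)[OF T fg] V]
          g(2) fg top by (auto simp: V1_def)
      \<comment> \<open>Possible only because the exponent 344 is known before \<open>U\<close> and
        \<open>W\<close> are chosen.\<close>
      obtain V2 where V2: "openin S V2" "\<one>\<^bsub>K\<^esub> \<in> V2" "wpow K V2 344 \<subseteq> V1"
        using topological_group_wpow_nhd[OF T V1] by blast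
      obtain U where U: "openin S U" "\<one>\<^bsub>K\<^esub> \<in> U" "\<And>a b. a \<in> U \<Longrightarrow> b \<in> U \<Longrightarrow> inv\<^bsub>K\<^esub> a \<otimes>\<^bsub>K\<^esub> b \<in> V2"
        using topological_group_quotient_nhd[OF T V2(1,2)] by blast
      define W where "W = {g \<in> carrier G. \<exists>a\<in>U. \<exists>b\<in>U. f g = inv\<^bsub>K\<^esub> a \<otimes>\<^bsub>K\<^esub> b}"
      have W: "sigma_syndetic G W"
        unfolding W_def by (rule G.sigma_syndetic_preimage[OF T sep f U(1,2)])
      have WG: "W \<subseteq> carrier G" by (auto simp: W_def)
      have fW: "f ` W \<subseteq> V2" using U(3) by (auto simp: W_def)
      obtain X \<epsilon> where X: "finite X" "\<epsilon> > 0"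
          "{h \<in> carrier G. \<forall>x\<in>X. norm (h x - x) < \<epsilon>} \<subseteq> wpow G W 344"
        using sigma_syndetic_imp_nhd[OF W] by blast
      define N where "N = {h \<in> carrier G. \<forall>x\<in>X. norm (h x - g x) < \<epsilon>}"
      have "f h \<in> V" if h: "h \<in> N" for h
      proof -
        have hG: "h \<in> carrier G" using h by (simp add: N_def)
        define k where "k = ginv g o\<^sub>L h"
        have kG: "k \<in> carrier G" using g hG by (simp add: k_def)
        have "norm (k x - x) = norm (h x - g x)" for x
          using G_app(3)[OF g(1), of "k x - x"] g(1) by (simp add: G_app(4) k_def)
        then have "k \<in> wpow G W 344" using X(3) h kG by (auto simp: N_def)
        then have "f k \<in> V1"
          using G.hom_wpow[OF f K.is_group WG] wpow_mono[OF fW] V2(3) by blast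
        then have "f g \<otimes>\<^bsub>K\<^esub> f k \<in> V" by (simp add: V1_def)
        moreover have "g \<otimes>\<^bsub>G\<^esub> k = h" using g(1) by (auto simp: k_def intro!: blinfun_eqI)
        then have "f g \<otimes>\<^bsub>K\<^esub> f k = f h" using f.hom_mult[OF g(1) kG] by simp
        ultimately show ?thesis by simp
      qed
      then have "N \<subseteq> {g \<in> topspace (SOT G). f g \<in> V}" by (auto simp: N_def topspace_SOT)
      moreover have "g \<in> N" using g X(2) by (simp add: N_def)
      moreover have "openin (SOT G) N" unfolding N_def by (rule openin_SOT_nhd[OF X(1)])
      ultimately show "\<exists>T. openin (SOT G) T \<and> g \<in> T \<and> T \<subseteq> {g \<in> topspace (SOT G). f g \<in> V}"
        by blast
    qed
  qed
qed

end

section \<open>The complex and the real case\<close>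

theorem theorem1:
  shows "(infinite_dimensional (scaleC :: complex \<Rightarrow> 'h \<Rightarrow> 'h::{complex_inner, complete_space}) \<and>
          separable_space (euclidean :: 'h topology) \<longrightarrow>
            automatic_continuity (unitary_group :: ('h \<Rightarrow>\<^sub>L 'h) monoid) (SOT unitary_group) TYPE('k))
       \<and> (infinite_dimensional (scaleR :: real \<Rightarrow> 'r \<Rightarrow> 'r::{real_inner, complete_space}) \<and>
          separable_space (euclidean :: 'r topology) \<longrightarrow>
            automatic_continuity (orthogonal_group :: ('r \<Rightarrow>\<^sub>L 'r) monoid) (SOT orthogonal_group) TYPE('k))"
proof (intro conjI impI)
  assume "infinite_dimensional (scaleC :: complex \<Rightarrow> 'h \<Rightarrow> 'h) \<and> separable_space (euclidean :: 'h topology)"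
  then have "hilbert (scaleC :: complex \<Rightarrow> 'h \<Rightarrow> 'h) cinner cnj"
    by (intro hilbert.intro vector_space_scaleC)
      (simp_all add: scaleR_scaleC cinner_add_left cinner_scaleC_left cinner_self complex_norm_square
        del: of_real_power flip: cinner_commute)
  then show "automatic_continuity (unitary_group :: ('h \<Rightarrow>\<^sub>L 'h) monoid) (SOT unitary_group) TYPE('k)"
    unfolding unitary_group_def by (rule hilbert.automatic_continuity_isometry_group)
next
  assume "infinite_dimensional (scaleR :: real \<Rightarrow> 'r \<Rightarrow> 'r) \<and> separable_space (euclidean :: 'r topology)"
  then have "hilbert (scaleR :: real \<Rightarrow> 'r \<Rightarrow> 'r) inner (\<lambda>x. x)"
    by (intro hilbert.intro vector_space_scaleR)
      (simp_all add: inner_add_left power2_norm_eq_inner, simp_all add: power2_eq_square inner_commute)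
  then show "automatic_continuity (orthogonal_group :: ('r \<Rightarrow>\<^sub>L 'r) monoid) (SOT orthogonal_group) TYPE('k)"
    unfolding orthogonal_group_def by (rule hilbert.automatic_continuity_isometry_group)
qed

end
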